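(* For every triple $(u,v,w)\in\{0,1\}^3$ with $(u,v,w)\neq(1,1,1)$, the collection $\mathscr{M}(u,v,w)$ of all quasi-symmetric equivalence classes $\mathcal{G}(X,d)$ of Cantor metric spaces $(X,d)$ of type $(u,v,w)$ has cardinality exactly the continuum: \[ \operatorname{card}(\mathscr{M}(u,v,w))=2^{\aleph_0}. \]
   Context: A Cantor metric space is a metric space homeomorphic to the middle-third Cantor set. $B(x,r)$ and $U(x,r)$ denote the closed and open metric balls. Quasi-symmetry: for a homeomorphism $\eta:[0,\infty)\to[0,\infty)$, a homeomorphism $f:X\to Y$ between metric spaces is $\eta$-quasi-symmetric if $\frac{d_Y(f(x),f(y))}{d_Y(f(x),f(z))}\le \eta\left(\frac{d_X(x,y)}{d_X(x,z)}\right)$ for all distinct $x,y,z\in X$; $f$ is quasi-symmetric if it is $\eta$-quasi-symmetric for some $\eta$. Existence of a quasi-symmetric homeomorphism is an equivalence relation on metric spaces; $\mathcal{G}(X,d)$ (the conformal gauge) denotes the quasi-symmetric equivalence class of $(X,d)$. Properties of a metric space $(X,d)$: - Doubling ($D$): there is a positive integer $N$ such that every closed ball of radius $r$ can be covered by at most $N$ closed balls of radius $r/2$. - Uniformly disconnected ($UD$): there is $\delta\in(0,1)$ such that every $\delta$-chain is constant, where a $\delta$-chain is a finite sequence $x:\{0,1,\dots,N\}\to X$ with $d(x(i-1),x(i))\le\delta\, d(x(0),x(N))$ for all $i\in\{1,\dots,N\}$. - Uniformly perfect ($UP$): there is $\rho\in(0,1]$ such that for every $x\in X$ and every $r\in(0,\operatorname{diam}(X))$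 the set $B(x,r)\setminus U(x,\rho r)$ is non-empty. For a property $P$, $T_P(X,d)=1$ if $(X,d)$ satisfies $P$ and $T_P(X,d)=0$ otherwise. $(X,d)$ has type $(u,v,w)\in\{0,1\}^3$ if $T_D(X,d)=u$, $T_{UD}(X,d)=v$, $T_{UP}(X,d)=w$. $\mathscr{M}(u,v,w)=\{\mathcal{G}(X,d)\mid (X,d)\text{ is a Cantor metric space of type }(u,v,w)\}$; its cardinality is the number of distinct quasi-symmetric equivalence classes of Cantor metric spaces of type $(u,v,w)$. *)

theory Defs
  imports "HOL-Analysis.Analysis"
begin

section \<open>Cantor metric spaces\<close>

primrec cantor_stage :: "nat \<Rightarrow> real set" where
  "cantor_stage 0 = {0..1}"
| "cantor_stage (Suc n) = (\<lambda>x. x / 3) ` cantor_stage n \<union> (\<lambda>x. (2 + x) / 3) ` cantor_stage n"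

definition cantor_set :: "real set" where
  "cantor_set = (\<Inter>n. cantor_stage n)"

definition Cantor_metric_space :: "'a metric \<Rightarrow> bool" where
  "Cantor_metric_space m \<longleftrightarrow> mtopology_of m homeomorphic_space top_of_set cantor_set"


section \<open>Quasi-symmetric maps and the conformal gauge\<close>

definition eta_quasi_symmetric ::
    "(real \<Rightarrow> real) \<Rightarrow> 'a metric \<Rightarrow> 'b metric \<Rightarrow> ('a \<Rightarrow> 'b) \<Rightarrow> bool" where
  "eta_quasi_symmetric \<eta> m m' f \<longleftrightarrow>
     homeomorphic_map (mtopology_of m) (mtopology_of m') f \<and>
     (\<forall>x\<in>mspace m. \<forall>y\<in>mspace m. \<forall>z\<in>mspace m. x \<noteq> y \<longrightarrow> x \<noteq> z \<longrightarrow> y \<noteq> z \<longrightarrow>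
        mdist m' (f x) (f y) / mdist m' (f x) (f z) \<le> \<eta> (mdist m x y / mdist m x z))"

definition quasi_symmetric :: "'a metric \<Rightarrow> 'b metric \<Rightarrow> ('a \<Rightarrow> 'b) \<Rightarrow> bool" where
  "quasi_symmetric m m' f \<longleftrightarrow>
     (\<exists>\<eta>. homeomorphic_map (top_of_set {0..}) (top_of_set {0..}) \<eta> \<and> eta_quasi_symmetric \<eta> m m' f)"

definition conformal_gauge :: "'a metric \<Rightarrow> 'a metric set" where
  "conformal_gauge m = {m'. \<exists>f. quasi_symmetric m m' f}"


section \<open>The three metric properties\<close>

definition doubling :: "'a metric \<Rightarrow> bool" where
  "doubling m \<longleftrightarrow>
     (\<exists>N::nat. N > 0 \<and>
        (\<forall>x\<in>mspace m. \<forall>r>0. \<exists>S. S \<subseteq> mspace m \<and> finite S \<and> card S \<le> N \<and>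
           mcball_of m x r \<subseteq> (\<Union>s\<in>S. mcball_of m s (r / 2))))"

text \<open>A chain is a function on \<open>nat\<close> of which only the values at \<open>0, ..., N\<close> matter.\<close>

definition delta_chain :: "'a metric \<Rightarrow> real \<Rightarrow> nat \<Rightarrow> (nat \<Rightarrow> 'a) \<Rightarrow> bool" where
  "delta_chain m \<delta> N x \<longleftrightarrow>
     (\<forall>i\<in>{0..N}. x i \<in> mspace m) \<and>
     (\<forall>i\<in>{1..N}. mdist m (x (i - 1)) (x i) \<le> \<delta> * mdist m (x 0) (x N))"

definition uniformly_disconnected :: "'a metric \<Rightarrow> bool" where
  "uniformly_disconnected m \<longleftrightarrow>
     (\<exists>\<delta>::real. 0 < \<delta> \<and> \<delta> < 1 \<and>
        (\<forall>N x. delta_chain m \<delta> N x \<longrightarrow> (\<forall>i\<in>{0..N}. x i = x 0)))"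

text \<open>Extended-real valued, so that unbounded spaces have diameter \<open>\<infinity>\<close>.\<close>

definition mdiam :: "'a metric \<Rightarrow> ereal" where
  "mdiam m = (SUP (x, y) \<in> mspace m \<times> mspace m. ereal (mdist m x y))"

definition uniformly_perfect :: "'a metric \<Rightarrow> bool" where
  "uniformly_perfect m \<longleftrightarrow>
     (\<exists>\<rho>::real. 0 < \<rho> \<and> \<rho> \<le> 1 \<and>
        (\<forall>x\<in>mspace m. \<forall>r::real. 0 < r \<and> ereal r < mdiam m \<longrightarrow>
           mcball_of m x r - mball_of m x (\<rho> * r) \<noteq> {}))"


section \<open>Types and collections of conformal gauges\<close>

definition truth_value :: "('a metric \<Rightarrow> bool) \<Rightarrow> 'a metric \<Rightarrow> nat" where
  "truth_value P m = (if P m then 1 else 0)"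

definition has_type :: "'a metric \<Rightarrow> nat \<times> nat \<times> nat \<Rightarrow> bool" where
  "has_type m t \<longleftrightarrow>
     (truth_value doubling m, truth_value uniformly_disconnected m,
      truth_value uniformly_perfect m) = t"

text \<open>
  The class of all metric spaces is rendered as the type \<open>'a metric\<close> of metric spaces whose points
  are drawn from \<open>'a\<close>. As soon as \<open>'a\<close> has at least continuum many elements, every Cantor metric
  space, over whatever type, has an isometric copy in \<open>'a metric\<close> (lemma
  \<open>Cantor_metric_space_isometric_copy\<close> below), so no quasi-symmetric class is lost.
\<close>

definition gauge_collection :: "nat \<Rightarrow> nat \<Rightarrow> nat \<Rightarrow> 'a metric set set" where
  "gauge_collection u v w =
     {conformal_gauge m | m. Cantor_metric_space m \<and> has_type m (u, v, w)}"

lemma Cantor_metric_space_isometric_copy: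
  fixes m :: "'b metric"
  assumes "(UNIV :: real set) \<lesssim> (UNIV :: 'a set)" and "Cantor_metric_space m"
  obtains m' :: "'a metric" and f :: "'b \<Rightarrow> 'a"
  where "bij_betw f (mspace m) (mspace m')"
    and "\<And>x y. x \<in> mspace m \<Longrightarrow> y \<in> mspace m \<Longrightarrow> mdist m' (f x) (f y) = mdist m x y"
proof -
  obtain h where "homeomorphic_map (mtopology_of m) (top_of_set cantor_set) h"
    using assms(2) homeomorphic_space unfolding Cantor_metric_space_def by blast
  then have "inj_on h (mspace m)"
    by (simp add: homeomorphic_eq_everything_map)
  then have "mspace m \<lesssim> (UNIV :: real set)"
    unfolding lepoll_def by blast
  then have "mspace m \<lesssim> (UNIV :: 'a set)"
    using assms(1) lepoll_trans by blast
  then obtain f :: "'b \<Rightarrow> 'a" where f: "inj_on f (mspace m)"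
    unfolding lepoll_def by blast
  define g where "g = inv_into (mspace m) f"
  have gf: "g (f x) = x" if "x \<in> mspace m" for x
    using f that by (simp add: g_def)
  interpret M': Metric_space "f ` mspace m" "\<lambda>a b. mdist m (g a) (g b)"
  proof
    show "mdist m (g a) (g b) = mdist m (g b) (g a)" for a b
      by (rule mdist_commute)
  qed (auto simp: gf intro: mdist_triangle)
  show thesis
    by (rule that[of f "metric (f ` mspace m, \<lambda>a b. mdist m (g a) (g b))"])
       (use f in \<open>auto simp: gf bij_betw_def\<close>)
qed

end

theory Submission
  imports Defs
begin

text \<open>
  Every space is realised on the Cantor space of bit sequences by a distance that induces the product
  topology, and isometry classes of Cantor metric spaces are determined by the distances between
  the points of a countable dense set; this gives at most continuum many gauges.

  For the lower bound, almost disjoint sparse sets \<open>marks A\<close> of naturals are coded into distances, and the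
  code is read off again from any quasi-symmetric map. The bits are cut into blocks, block \<open>k\<close> having size
  \<open>s k\<close> and scale \<open>r k\<close>; the pieces of a cylinder that are given by the values of the next block are
  either all at the same distance or lined up on a real interval.
  Without uniform perfectness, take \<open>r (k + 1) / r k\<close> tending to 0: cylinders become
  arbitrarily well isolated, a quasi-symmetric map carries small cylinders to cylinders, and counting
  children shows that the sequences \<open>s\<close> agree up to a shift. In the uniformly perfect case without
  uniform disconnectedness, line up more and more pieces: small cylinders are
  connected through relatively tiny steps, and again cylinders go to cylinders. In the
  remaining case, uniformly disconnected but not doubling, blocks of rapidly growing size sit at the marked scales,
  and the size of a large family of roughly equidistant points determines the scale exactly.
  A disjoint union with a fixed space adjusts the remaining properties.
\<close>

section \<open>Quasi-symmetric maps\<close>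

text \<open>The three properties are quasi-symmetric invariants, so within one type a finer
  invariant is needed; for type (1,1,1) there is none, all such spaces being equivalent to the
  middle-third Cantor set (David and Semmes). Hence each family exploits the failure of one
  property. A quasi-symmetric map controls scales only up to an unknown distortion, and matching
  cylinders identifies levels only up to an unknown shift. The code has to survive this and the loss
  of finitely many levels: marks are powers of two, so a nonzero shift cannot carry large marks to
  marks, and each mark encodes an initial segment of the set, so infinitely many common marks
  determine the set. The summand that spoils the other properties must not resemble the coded part:
  it is uniformly perfect when cylinders are recognised by isolation, and an ultrametric space when
  they are recognised by connectedness. Then the image of a small cylinder cannot fall into
  it.\<close>

text \<open>Passing to the inverse map interchanges the last two clauses.\<close>

definition qs :: "('b \<Rightarrow> 'b \<Rightarrow> real) \<Rightarrow> ('c \<Rightarrow> 'c \<Rightarrow> real) \<Rightarrow> ('b \<Rightarrow> 'c) \<Rightarrow> bool" where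
  "qs d d' F \<longleftrightarrow> bij F \<and>
     (\<forall>t>0. \<exists>H>0. \<forall>x y z. d x y \<le> t * d x z \<longrightarrow> d' (F x) (F y) \<le> H * d' (F x) (F z)) \<and>
     (\<forall>e>0. \<exists>t>0. \<forall>x y z. d x y \<le> t * d x z \<longrightarrow> d' (F x) (F y) \<le> e * d' (F x) (F z))"

lemma qs_bounded:
  assumes "qs d d' F" "t > 0"
  obtains H where "H > 0" "\<And>x y z. d x y \<le> t * d x z \<Longrightarrow> d' (F x) (F y) \<le> H * d' (F x) (F z)"
  using assms unfolding qs_def by blast

lemma qs_small:
  assumes "qs d d' F" "e > 0"
  obtains t where "t > 0" "\<And>x y z. d x y \<le> t * d x z \<Longrightarrow> d' (F x) (F y) \<le> e * d' (F x) (F z)"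
  using assms unfolding qs_def by blast

lemma qs_inverse:
  assumes q: "qs d d' F" and M: "Metric_space UNIV d" and M': "Metric_space UNIV d'"
  shows "qs d' d (inv F)"
proof -
  have bij: "bij F" using q by (simp add: qs_def)
  interpret M: Metric_space UNIV d by (rule M)
  interpret M': Metric_space UNIV d' by (rule M')
  have FF [simp]: "F (inv F y) = y" for y
    using bij by (simp add: bij_is_surj surj_f_inv_f)
  \<comment> \<open>If the bound failed, \<open>H\<close> with the roles of \<open>y\<close> and
    \<open>z\<close> exchanged would give \<open>d' x z \<le> e * u * d' x z\<close> with
    \<open>e * u < 1\<close>. Hence \<open>d' x z = 0\<close>, so \<open>d' x y = 0\<close> by
    \<open>le\<close>, although failure forces \<open>x \<noteq> y\<close>.\<close>
  have contra: "d (inv F x) (inv F y) \<le> s * d (inv F x) (inv F z)"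
    if "t > 0" "e > 0" "t * s = 1" "e * u < 1"
      and H: "\<And>x y z. d x y \<le> t * d x z \<Longrightarrow> d' (F x) (F y) \<le> e * d' (F x) (F z)"
      and le: "d' x y \<le> u * d' x z" for x y z t s e u
  proof (rule ccontr)
    assume n: "\<not> ?thesis"
    then have "t * (s * d (inv F x) (inv F z)) < t * d (inv F x) (inv F y)"
      using \<open>t > 0\<close> by (simp add: mult_less_cancel_left_disj)
    then have "d (inv F x) (inv F z) \<le> t * d (inv F x) (inv F y)"
      using \<open>t * s = 1\<close> by (simp flip: mult.assoc)
    from H[OF this] have a: "d' x z \<le> e * d' x y" by simp
    have "x \<noteq> y"
    proof
      assume "x = y"
      have "t * s > 0" using \<open>t * s = 1\<close> by simp
      then have "s > 0" using \<open>t > 0\<close> zero_less_mult_pos by blast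
      then show False
        using n \<open>x = y\<close> M.nonneg[of "inv F x" "inv F z"] by simp
    qed
    then have "d' x y > 0" by (metis M'.mdist_pos_less UNIV_I)
    have "e * d' x y \<le> e * (u * d' x z)" using le \<open>e > 0\<close> by simp
    also have "\<dots> = (e * u) * d' x z" by simp
    finally have "d' x z \<le> (e * u) * d' x z" using a by linarith
    then have "d' x z * (1 - e * u) \<le> 0" by (simp add: algebra_simps)
    then have "d' x z \<le> 0" using \<open>e * u < 1\<close>
      by (metis diff_gt_0_iff_gt linorder_not_less mult_pos_pos)
    then have "d' x z = 0" using M'.nonneg[of x z] by linarith
    then have "d' x y \<le> 0" using le by simp
    then show False using \<open>d' x y > 0\<close> by simp
  qed
  show ?thesis
    unfolding qs_def
  proof (intro conjI allI impI)
    show "bij (inv F)" by (simp add: bij bij_imp_bij_inv)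
  next
    fix u :: real assume "u > 0"
    \<comment> \<open>The factor 2 makes the product \<open>e * u\<close> of \<open>contra\<close>
      equal to 1/2, here and in the last clause.\<close>
    then obtain t where t: "t > 0"
      "\<And>x y z. d x y \<le> t * d x z \<Longrightarrow> d' (F x) (F y) \<le> (1 / (2 * u)) * d' (F x) (F z)"
      using qs_small[OF q, of "1 / (2 * u)"] by auto
    show "\<exists>H>0. \<forall>x y z. d' x y \<le> u * d' x z \<longrightarrow> d (inv F x) (inv F y) \<le> H * d (inv F x) (inv F z)"
      using contra[of t "1 / (2 * u)" "1 / t" u, OF t(1) _ _ _ t(2)] t(1) \<open>u > 0\<close>
      by (intro exI[of _ "1 / t"]) simp
  next
    fix e :: real assume "e > 0"
    then obtain H where H: "H > 0"
      "\<And>x y z. d x y \<le> (1 / e) * d x z \<Longrightarrow> d' (F x) (F y) \<le> H * d' (F x) (F z)"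
      using qs_bounded[OF q, of "1 / e"] by auto
    show "\<exists>t>0. \<forall>x y z. d' x y \<le> t * d' x z \<longrightarrow> d (inv F x) (inv F y) \<le> e * d (inv F x) (inv F z)"
      using contra[of "1 / e" H e "1 / (2 * H)", OF _ H(1) _ _ H(2)] H(1) \<open>e > 0\<close>
      by (intro exI[of _ "1 / (2 * H)"] conjI allI impI) auto
  qed
qed

text \<open>A zero at some \<open>a > 0\<close> would be an interior point of the half-line, so
  small positive values would be taken on both sides of it, against injectivity.\<close>

lemma homeomorphic_map_halfline_zero:
  fixes \<eta> :: "real \<Rightarrow> real"
  assumes "homeomorphic_map (top_of_set {0..}) (top_of_set {0..}) \<eta>"
  shows "\<eta> 0 = 0"
proof (rule ccontr)
  assume "\<eta> 0 \<noteq> 0"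
  have cont: "continuous_on {0..} \<eta>" and im: "\<eta> ` {0..} = {0..}" and inj: "inj_on \<eta> {0..}"
    using assms by (auto simp: homeomorphic_eq_everything_map)
  have "\<eta> 0 > 0" using im \<open>\<eta> 0 \<noteq> 0\<close> by (metis atLeast_iff image_eqI order_le_less order_refl)
  obtain a where a: "a \<ge> 0" "\<eta> a = 0" using im by (metis atLeast_iff image_iff order_refl)
  then have "a > 0" using \<open>\<eta> 0 \<noteq> 0\<close> by (metis order_le_less)
  have "\<eta> (a + 1) \<ge> 0" using im \<open>a > 0\<close> by (metis add_nonneg_nonneg atLeast_iff a(1) image_eqI zero_le_one)
  moreover have "\<eta> (a + 1) \<noteq> \<eta> a"
    using inj_onD[OF inj, of "a + 1" a] a by auto
  ultimately have "\<eta> (a + 1) > 0" using a by simp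
  define v where "v = min (\<eta> 0) (\<eta> (a + 1)) / 2"
  have v: "0 < v" "v < \<eta> 0" "v < \<eta> (a + 1)"
    using \<open>\<eta> 0 > 0\<close> \<open>\<eta> (a + 1) > 0\<close> by (auto simp: v_def min_def)
  obtain b where b: "0 \<le> b" "b \<le> a" "\<eta> b = v"
    using IVT2'[of \<eta> a v 0] a v continuous_on_subset[OF cont, of "{0..a}"] by auto
  obtain c where c: "a \<le> c" "c \<le> a + 1" "\<eta> c = v"
    using IVT'[of \<eta> a v "a + 1"] a v continuous_on_subset[OF cont, of "{a..a+1}"] by auto
  have "b = c" using inj b c a by (auto simp: inj_on_def)
  then have "b = a" using b c by simp
  then show False using b a v by simp
qed

lemma eta_bounded:
  fixes \<eta> :: "real \<Rightarrow> real"
  assumes "homeomorphic_map (top_of_set {0..}) (top_of_set {0..}) \<eta>"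
  obtains H where "H > 0" "\<And>s. 0 \<le> s \<Longrightarrow> s \<le> t \<Longrightarrow> \<eta> s \<le> H"
proof -
  have "continuous_on {0..} \<eta>"
    using assms by (auto simp: homeomorphic_eq_everything_map)
  then have "continuous_on {0..t} \<eta>" by (rule continuous_on_subset) auto
  then have "bounded (\<eta> ` {0..t})" by (simp add: compact_continuous_image compact_imp_bounded)
  then obtain H where "H > 0" "\<forall>x\<in>\<eta> ` {0..t}. norm x \<le> H" using bounded_pos by blast
  then show ?thesis by (intro that[of H]) force+
qed

lemma eta_small:
  fixes \<eta> :: "real \<Rightarrow> real"
  assumes "homeomorphic_map (top_of_set {0..}) (top_of_set {0..}) \<eta>" "e > 0"
  obtains t where "t > 0" "\<And>s. 0 \<le> s \<Longrightarrow> s \<le> t \<Longrightarrow> \<eta> s \<le> e"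
proof -
  have "continuous_on {0..} \<eta>"
    using assms by (auto simp: homeomorphic_eq_everything_map)
  then obtain t where "t > 0" "\<forall>s\<in>{0..}. dist s 0 < t \<longrightarrow> dist (\<eta> s) (\<eta> 0) < e"
    using assms(2) unfolding continuous_on_iff by (metis atLeast_iff order_refl)
  then show ?thesis
    using homeomorphic_map_halfline_zero[OF assms(1)]
    by (intro that[of "t / 2"]) (auto simp: dist_real_def abs_less_iff intro: less_imp_le)
qed

lemma mdist_pos: "a \<in> mspace m \<Longrightarrow> b \<in> mspace m \<Longrightarrow> a \<noteq> b \<Longrightarrow> 0 < mdist m a b"
  by (simp add: less_le)

text \<open>Of the gauge function only two facts survive: it is bounded on bounded intervals and
  small near 0. In exchange \<open>qs\<close> also covers coinciding points, which the quotients of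
  the definition exclude.\<close>

lemma quasi_symmetric_imp_qs:
  fixes m :: "'a metric" and m' :: "'c metric" and h :: "'b \<Rightarrow> 'a" and h' :: "'d \<Rightarrow> 'c"
  assumes "quasi_symmetric m m' f"
    and h: "bij_betw h UNIV (mspace m)" "\<And>x y. mdist m (h x) (h y) = d x y"
    and h': "bij_betw h' UNIV (mspace m')" "\<And>x y. mdist m' (h' x) (h' y) = d' x y"
  obtains F where "qs d d' F"
proof -
  obtain \<eta> where \<eta>: "homeomorphic_map (top_of_set {0..}) (top_of_set {0..}) \<eta>"
    and eta: "eta_quasi_symmetric \<eta> m m' f"
    using assms(1) unfolding quasi_symmetric_def by (elim exE conjE)
  have f: "homeomorphic_map (mtopology_of m) (mtopology_of m') f"
    and q: "\<And>x y z. x \<in> mspace m \<Longrightarrow> y \<in> mspace m \<Longrightarrow> z \<in> mspace m \<Longrightarrow> x \<noteq> y \<Longrightarrow> x \<noteq> z \<Longrightarrow>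
      y \<noteq> z \<Longrightarrow> mdist m' (f x) (f y) / mdist m' (f x) (f z) \<le> \<eta> (mdist m x y / mdist m x z)"
    using eta unfolding eta_quasi_symmetric_def by simp_all
  have fbij: "bij_betw f (mspace m) (mspace m')"
    using f by (auto simp: homeomorphic_eq_everything_map bij_betw_def)
  define F where "F = inv h' \<circ> f \<circ> h"
  have bij: "bij F"
    unfolding F_def
    by (intro bij_betw_trans[OF h(1)] bij_betw_trans[OF fbij] bij_betw_inv_into h'(1))
  have hm: "h x \<in> mspace m" for x using h(1) by (auto simp: bij_betw_def)
  have hF: "h' (F x) = f (h x)" for x
    using fbij h'(1) hm[of x] unfolding F_def bij_betw_def o_def
    by (metis f_inv_into_f imageI)
  have d': "d' (F x) (F y) = mdist m' (f (h x)) (f (h y))" for x y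
    by (metis h'(2) hF)
  have fm: "f (h x) \<in> mspace m'" for x using fbij hm by (auto simp: bij_betw_def)
  \<comment> \<open>For \<open>y = z\<close> the hypothesis forces \<open>t \<ge> 1\<close>, and
    then \<open>H \<ge> 1\<close> is needed. This is why \<open>max 1 H\<close> and
    \<open>min t (1/2)\<close> are passed below.\<close>
  have core: "d' (F x) (F y) \<le> H * d' (F x) (F z)"
    if H: "\<And>s. 0 \<le> s \<Longrightarrow> s \<le> t \<Longrightarrow> \<eta> s \<le> H" and le: "d x y \<le> t * d x z"
      and t: "t < 1 \<or> 1 \<le> H" "H > 0" for t H x y z
  proof (cases "x = y")
    case True
    have "mdist m' (f (h y)) (f (h y)) = 0" using mdist_zero[OF fm[of y] fm[of y]] by simp
    then show ?thesis using True \<open>H > 0\<close> by (simp add: d')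
  next
    case False
    then have "h x \<noteq> h y" using h(1) by (auto simp: bij_betw_def inj_on_def)
    then have xy: "d x y > 0" using hm by (simp flip: h(2) add: mdist_pos)
    have "x \<noteq> z" using le xy mdist_zero[OF hm hm, of x x] by (auto simp: h(2))
    then have "h x \<noteq> h z" using h(1) by (auto simp: bij_betw_def inj_on_def)
    then have xz: "d x z > 0" using hm by (simp flip: h(2) add: mdist_pos)
    have "f (h x) \<noteq> f (h z)" using fbij \<open>h x \<noteq> h z\<close> hm by (auto simp: bij_betw_def inj_on_def)
    then have fxz: "mdist m' (f (h x)) (f (h z)) > 0" using fm by (simp add: mdist_pos)
    show ?thesis
    proof (cases "y = z")
      case True
      then have "1 \<le> t" using le xz by simp
      then show ?thesis using t fxz \<open>y = z\<close> by (simp add: d')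
    next
      case yz: False
      then have "h y \<noteq> h z" using h(1) by (auto simp: bij_betw_def inj_on_def)
      have "mdist m' (f (h x)) (f (h y)) / mdist m' (f (h x)) (f (h z)) \<le> \<eta> (d x y / d x z)"
        using q[of "h x" "h y" "h z"] hm \<open>h x \<noteq> h y\<close> \<open>h x \<noteq> h z\<close> \<open>h y \<noteq> h z\<close> by (simp add: h(2))
      also have "\<dots> \<le> H"
        using H xy xz le by (simp add: divide_simps)
      finally show ?thesis using fxz by (simp add: d' divide_simps)
    qed
  qed
  have "qs d d' F"
    unfolding qs_def
  proof (intro conjI bij allI impI)
    fix t :: real assume "t > 0"
    obtain H where H: "H > 0" "\<And>s. 0 \<le> s \<Longrightarrow> s \<le> t \<Longrightarrow> \<eta> s \<le> H" using eta_bounded[OF \<eta>] by blast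
    have "d' (F x) (F y) \<le> max 1 H * d' (F x) (F z)" if "d x y \<le> t * d x z" for x y z
      by (rule core[of t]) (use H that in \<open>auto simp: le_max_iff_disj\<close>)
    then show "\<exists>H>0. \<forall>x y z. d x y \<le> t * d x z \<longrightarrow> d' (F x) (F y) \<le> H * d' (F x) (F z)"
      by (intro exI[of _ "max 1 H"]) auto
  next
    fix e :: real assume "e > 0"
    obtain t where t: "t > 0" "\<And>s. 0 \<le> s \<Longrightarrow> s \<le> t \<Longrightarrow> \<eta> s \<le> e"
      using eta_small[OF \<eta> \<open>e > 0\<close>] by blast
    have "d' (F x) (F y) \<le> e * d' (F x) (F z)" if "d x y \<le> min t (1/2) * d x z" for x y z
      by (rule core[of "min t (1/2)"]) (use t that \<open>e > 0\<close> in auto)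
    then show "\<exists>t>0. \<forall>x y z. d x y \<le> t * d x z \<longrightarrow> d' (F x) (F y) \<le> e * d' (F x) (F z)"
      using t(1) by (intro exI[of _ "min t (1/2)"]) auto
  qed
  then show ?thesis by (rule that)
qed

lemma conformal_gauge_refl: "m \<in> conformal_gauge m"
proof -
  have "homeomorphic_map (top_of_set {0::real..}) (top_of_set {0..}) id"
    and "homeomorphic_map (mtopology_of m) (mtopology_of m) id" by simp_all
  then show ?thesis
    unfolding conformal_gauge_def quasi_symmetric_def eta_quasi_symmetric_def
    by (intro CollectI exI[of _ id]) simp
qed

text \<open>Composition with an isometry leaves \<eta> unchanged. Applied in both directions, this
  makes the gauges of isometric spaces equal.\<close>

lemma conformal_gauge_mono_isometry:
  assumes g: "homeomorphic_map (mtopology_of m') (mtopology_of m) g"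
    and iso: "\<And>x y. x \<in> mspace m' \<Longrightarrow> y \<in> mspace m' \<Longrightarrow> mdist m (g x) (g y) = mdist m' x y"
  shows "conformal_gauge m \<subseteq> conformal_gauge m'"
proof
  fix n assume "n \<in> conformal_gauge m"
  then obtain \<eta> f where \<eta>: "homeomorphic_map (top_of_set {0..}) (top_of_set {0..}) \<eta>"
    and eta: "eta_quasi_symmetric \<eta> m n f"
    unfolding conformal_gauge_def quasi_symmetric_def by (elim CollectE exE conjE)
  have f: "homeomorphic_map (mtopology_of m) (mtopology_of n) f"
    and q: "\<And>x y z. x \<in> mspace m \<Longrightarrow> y \<in> mspace m \<Longrightarrow> z \<in> mspace m \<Longrightarrow> x \<noteq> y \<Longrightarrow> x \<noteq> z \<Longrightarrow>
      y \<noteq> z \<Longrightarrow> mdist n (f x) (f y) / mdist n (f x) (f z) \<le> \<eta> (mdist m x y / mdist m x z)"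
    using eta unfolding eta_quasi_symmetric_def by simp_all
  have gm: "g x \<in> mspace m" if "x \<in> mspace m'" for x
    using g that by (auto simp: homeomorphic_eq_everything_map)
  have gi: "inj_on g (mspace m')"
    using g by (simp add: homeomorphic_eq_everything_map)
  have "mdist n (f (g x)) (f (g y)) / mdist n (f (g x)) (f (g z)) \<le> \<eta> (mdist m' x y / mdist m' x z)"
    if "x \<in> mspace m'" "y \<in> mspace m'" "z \<in> mspace m'" "x \<noteq> y" "x \<noteq> z" "y \<noteq> z" for x y z
    using q[of "g x" "g y" "g z"] that gm gi by (simp add: iso inj_on_eq_iff)
  moreover have "homeomorphic_map (mtopology_of m') (mtopology_of n) (f \<circ> g)"
    using homeomorphic_map_compose[OF g f] .
  ultimately show "n \<in> conformal_gauge m'"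
    unfolding conformal_gauge_def quasi_symmetric_def eta_quasi_symmetric_def
    using \<eta> by (auto intro!: exI[of _ "f \<circ> g"] exI[of _ \<eta>])
qed

section \<open>The Cantor set as a space of bit sequences\<close>

type_synonym bits = "nat \<Rightarrow> bool"

definition agree :: "nat \<Rightarrow> bits \<Rightarrow> bits \<Rightarrow> bool" where
  "agree n x y \<longleftrightarrow> (\<forall>i<n. x i = y i)"

definition shift :: "bits \<Rightarrow> bits" where
  "shift x = (\<lambda>n. x (Suc n))"

lemma agree_0 [simp]: "agree 0 x y"
  by (simp add: agree_def)

lemma agree_Suc: "agree (Suc n) x y \<longleftrightarrow> x 0 = y 0 \<and> agree n (shift x) (shift y)"
  unfolding agree_def shift_def by (metis less_Suc_eq_0_disj zero_less_Suc)

lemma agree_mono: "agree n x y \<Longrightarrow> m \<le> n \<Longrightarrow> agree m x y"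
  by (simp add: agree_def)

lemma agree_all_eq: "(\<And>n. agree n x y) \<Longrightarrow> x = y"
  by (auto simp: agree_def)

lemma shift_case_nat [simp]: "shift (case_nat b x) = x"
  by (simp add: shift_def)

lemma case_nat_shift: "case_nat (x 0) (shift x) = x"
  by (rule ext) (simp add: shift_def split: nat.split)

text \<open>The bound 1 normalises the diameter: two such spaces can be put at mutual distance 1
  without violating the triangle inequality. The last two clauses say that balls and prefix
  cylinders refine each other.\<close>

definition cantor_dist :: "(bits \<Rightarrow> bits \<Rightarrow> real) \<Rightarrow> bool" where
  "cantor_dist d \<longleftrightarrow> Metric_space UNIV d \<and> (\<forall>x y. d x y \<le> 1) \<and>
     (\<forall>x n. \<exists>e>0. \<forall>y. d x y < e \<longrightarrow> agree n x y) \<and>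
     (\<forall>x e. e > 0 \<longrightarrow> (\<exists>n. \<forall>y. agree n x y \<longrightarrow> d x y < e))"

section \<open>Ternary expansions and the middle-third Cantor set\<close>

definition ternary :: "bits \<Rightarrow> real" where
  "ternary x = (\<Sum>n. 2 * of_bool (x n) / 3 ^ Suc n)"

lemma ternary_summable: "summable (\<lambda>n. 2 * of_bool (x n) / 3 ^ Suc n :: real)"
proof (rule summable_comparison_test)
  show "summable (\<lambda>n. 2 * (1 / 3 :: real) ^ Suc n)"
    by (intro summable_mult) (simp add: summable_geometric)
  show "\<exists>N. \<forall>n\<ge>N. norm (2 * of_bool (x n) / 3 ^ Suc n :: real) \<le> 2 * (1 / 3) ^ Suc n"
    by (intro exI[of _ 0]) (auto simp: power_one_over divide_simps of_bool_def)
qed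

lemma ternary_shift: "ternary x = (2 * of_bool (x 0) + ternary (shift x)) / 3"
proof -
  have "ternary x = 2 * of_bool (x 0) / 3 + (\<Sum>n. 2 * of_bool (x (Suc n)) / 3 ^ Suc (Suc n))"
    unfolding ternary_def using suminf_split_head[OF ternary_summable[of x]] by simp
  also have "(\<Sum>n. 2 * of_bool (x (Suc n)) / 3 ^ Suc (Suc n)) =
      (\<Sum>n. 2 * of_bool (shift x n) / 3 ^ Suc n / (3::real))"
    by (simp add: shift_def mult.commute)
  also have "\<dots> = ternary (shift x) / 3"
    unfolding ternary_def by (rule suminf_divide[OF ternary_summable])
  finally show ?thesis by (simp add: field_simps)
qed

lemma ternary_bounds: "0 \<le> ternary x" "ternary x \<le> 1"
proof -
  show "0 \<le> ternary x"
    unfolding ternary_def by (intro suminf_nonneg ternary_summable) auto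
  have "(\<lambda>n. 2 / 3 * (1 / 3 :: real) ^ n) sums (2 / 3 * (1 / (1 - 1 / 3)))"
    by (intro sums_mult geometric_sums) auto
  then have s: "(\<lambda>n. 2 * (1 / 3 :: real) ^ Suc n) sums 1"
    by simp
  have "ternary x \<le> (\<Sum>n. 2 * (1 / 3 :: real) ^ Suc n)"
    unfolding ternary_def
    by (intro suminf_le ternary_summable sums_summable[OF s])
       (auto simp: power_one_over divide_simps of_bool_def)
  then show "ternary x \<le> 1" using sums_unique[OF s] by simp
qed

lemma ternary_agree: "agree n x y \<Longrightarrow> \<bar>ternary x - ternary y\<bar> \<le> (1 / 3) ^ n"
proof (induction n arbitrary: x y)
  case 0
  then show ?case using ternary_bounds[of x] ternary_bounds[of y] by auto
next
  case (Suc n)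
  then have "\<bar>ternary (shift x) - ternary (shift y)\<bar> \<le> (1 / 3) ^ n" "x 0 = y 0"
    by (simp_all add: agree_Suc)
  then show ?case
    by (simp add: ternary_shift[of x] ternary_shift[of y] flip: diff_divide_distrib)
qed

text \<open>If the first bits differ, the values lie in opposite outer thirds of [0,1], at distance
  at least 1/3; otherwise deleting the first bit magnifies the difference by 3.\<close>

lemma ternary_not_agree: "\<not> agree n x y \<Longrightarrow> (1 / 3) ^ n \<le> \<bar>ternary x - ternary y\<bar>"
proof (induction n arbitrary: x y)
  case 0
  then show ?case by simp
next
  case (Suc n)
  show ?case
  proof (cases "x 0 = y 0")
    case True
    then have "(1 / 3) ^ n \<le> \<bar>ternary (shift x) - ternary (shift y)\<bar>"
      using Suc by (simp add: agree_Suc)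
    then show ?thesis
      using True by (simp add: ternary_shift[of x] ternary_shift[of y] flip: diff_divide_distrib)
  next
    case False
    have "1 / 3 \<le> \<bar>ternary x - ternary y\<bar>"
      using False ternary_bounds[of "shift x"] ternary_bounds[of "shift y"]
      unfolding ternary_shift[of x] ternary_shift[of y] diff_divide_distrib[symmetric]
      by (cases "x 0"; cases "y 0") (simp_all add: abs_if)
    moreover have "(1 / 3 :: real) ^ Suc n \<le> 1 / 3"
      by (simp add: power_le_one)
    ultimately show ?thesis by linarith
  qed
qed

lemma inj_ternary: "inj ternary"
proof (rule injI, rule agree_all_eq, rule ccontr)
  fix x y n assume "ternary x = ternary y" "\<not> agree n x y"
  then have "(1 / 3 :: real) ^ n \<le> 0" using ternary_not_agree[of n x y] by simp
  moreover have "(1 / 3 :: real) ^ n > 0" by simp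
  ultimately show False by linarith
qed

lemma ternary_in_stage: "ternary x \<in> cantor_stage n"
proof (induction n arbitrary: x)
  case 0
  then show ?case using ternary_bounds by simp
next
  case (Suc n)
  then show ?case
    by (cases "x 0") (auto simp: ternary_shift[of x])
qed

lemma cantor_stage_bounds: "cantor_stage n \<subseteq> {0..1}"
  by (induction n) auto

text \<open>The expanding map that inverts both contractions of the construction. The side of 1/2 on
  which its orbit lies gives the ternary digits.\<close>

definition cantor_step :: "real \<Rightarrow> real" where
  "cantor_step t = (if t \<le> 1 / 2 then 3 * t else 3 * t - 2)"

lemma cantor_step_in: "t \<in> cantor_stage (Suc n) \<Longrightarrow> cantor_step t \<in> cantor_stage n"
proof -
  assume "t \<in> cantor_stage (Suc n)"
  then obtain u where u: "u \<in> cantor_stage n" "t = u / 3 \<or> t = (2 + u) / 3" by auto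
  then have "0 \<le> u" "u \<le> 1" using cantor_stage_bounds[of n] by auto
  moreover have "3 * t = u \<or> 3 * t - 2 = u" using u(2) by auto
  ultimately have "cantor_step t = u" using u(2) by (auto simp: cantor_step_def)
  then show ?thesis using u(1) by simp
qed

lemma cantor_step_funpow: "t \<in> cantor_set \<Longrightarrow> (cantor_step ^^ n) t \<in> cantor_set"
  by (induction n) (auto simp: cantor_set_def intro: cantor_step_in)

lemma range_ternary: "range ternary = cantor_set"
proof
  show "range ternary \<subseteq> cantor_set"
    using ternary_in_stage by (auto simp: cantor_set_def)
  show "cantor_set \<subseteq> range ternary"
  proof
    fix t assume t: "t \<in> cantor_set"
    define digits where "digits t = (\<lambda>n. (cantor_step ^^ n) t > 1 / 2)" for t :: real
    have sh: "shift (digits t) = digits (cantor_step t)" for t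
      by (simp add: digits_def shift_def funpow_swap1)
    \<comment> \<open>One application of \<open>cantor_step\<close> triples the error, and the error
      is never more than 1; so \<open>n\<close> applications bound the original one by
      \<open>(1 / 3) ^ n\<close>.\<close>
    have *: "\<bar>ternary (digits t) - t\<bar> \<le> (1 / 3) ^ n" if "t \<in> cantor_set" for t n
      using that
    proof (induction n arbitrary: t)
      case 0
      have "t \<in> {0..1}" using 0 cantor_stage_bounds by (force simp: cantor_set_def)
      then show ?case using ternary_bounds[of "digits t"] by auto
    next
      case (Suc n)
      have le: "\<bar>ternary (digits (cantor_step t)) - cantor_step t\<bar> \<le> (1 / 3) ^ n"
        using Suc.IH cantor_step_funpow[of t 1] Suc.prems by simp
      have "ternary (digits t) - t = (ternary (digits (cantor_step t)) - cantor_step t) / 3"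
        by (simp add: ternary_shift[of "digits t"] sh) (simp add: digits_def cantor_step_def field_simps)
      then have "\<bar>ternary (digits t) - t\<bar> = \<bar>ternary (digits (cantor_step t)) - cantor_step t\<bar> / 3"
        by (simp only: abs_divide abs_numeral)
      then show ?case using le by simp
    qed
    have "(\<lambda>n. (1 / 3 :: real) ^ n) \<longlonglongrightarrow> 0" by (rule LIMSEQ_realpow_zero) auto
    then have "\<bar>ternary (digits t) - t\<bar> \<le> 0"
      by (rule LIMSEQ_le_const) (use *[OF t] in auto)
    then have "t = ternary (digits t)" by simp
    then show "t \<in> range ternary" by blast
  qed
qed

section \<open>Cantor metric spaces from distances on bit sequences\<close>

definition push_metric :: "('b \<Rightarrow> 'a) \<Rightarrow> ('b \<Rightarrow> 'b \<Rightarrow> real) \<Rightarrow> 'a metric" where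
  "push_metric h d = metric (range h, \<lambda>a b. d (inv h a) (inv h b))"

lemma push_metric_simps:
  assumes "inj h" "Metric_space UNIV d"
  shows "mspace (push_metric h d) = range h" "mdist (push_metric h d) (h x) (h y) = d x y"
proof -
  interpret Metric_space UNIV d by (rule assms(2))
  interpret H: Metric_space "range h" "\<lambda>a b. d (inv h a) (inv h b)"
    by unfold_locales (auto simp: commute assms(1) inj_eq triangle)
  show "mspace (push_metric h d) = range h" "mdist (push_metric h d) (h x) (h y) = d x y"
    unfolding push_metric_def by (simp_all add: assms(1))
qed

text \<open>The same condition on bit prefixes describes the open sets here and in
  \<open>openin_cantor_set\<close>, so that the homeomorphism to the Cantor set becomes a matter of
  transporting prefixes.\<close>

lemma openin_push_metric:
  assumes "inj h" "cantor_dist d"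
  shows "openin (mtopology_of (push_metric h d)) U \<longleftrightarrow>
    U \<subseteq> range h \<and> (\<forall>x. h x \<in> U \<longrightarrow> (\<exists>n. \<forall>y. agree n x y \<longrightarrow> h y \<in> U))"
proof -
  have M: "Metric_space UNIV d"
    and a: "\<And>x n. \<exists>e>0. \<forall>y. d x y < e \<longrightarrow> agree n x y"
    and b: "\<And>x e. e > 0 \<Longrightarrow> \<exists>n. \<forall>y. agree n x y \<longrightarrow> d x y < e"
    using assms(2) by (auto simp: cantor_dist_def)
  note ps = push_metric_simps[OF assms(1) M]
  have ball: "Metric_space.mball (range h) (mdist (push_metric h d)) (h x) r \<subseteq> U \<longleftrightarrow>
      (\<forall>y. d x y < r \<longrightarrow> h y \<in> U)" for x r
    using Metric_space.mball_def[OF Metric_space_mspace_mdist, of "push_metric h d"]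
    by (auto simp: ps)
  have "openin (mtopology_of (push_metric h d)) U \<longleftrightarrow> U \<subseteq> range h \<and>
      (\<forall>x. x \<in> U \<longrightarrow> (\<exists>r>0. Metric_space.mball (range h) (mdist (push_metric h d)) x r \<subseteq> U))"
    using Metric_space.openin_mtopology[OF Metric_space_mspace_mdist, of "push_metric h d"]
    by (simp add: mtopology_of_def ps(1))
  also have "\<dots> \<longleftrightarrow> U \<subseteq> range h \<and>
      (\<forall>x. h x \<in> U \<longrightarrow> (\<exists>r>0. \<forall>y. d x y < r \<longrightarrow> h y \<in> U))"
    unfolding ball[symmetric] by blast
  also have "\<dots> \<longleftrightarrow> U \<subseteq> range h \<and> (\<forall>x. h x \<in> U \<longrightarrow> (\<exists>n. \<forall>y. agree n x y \<longrightarrow> h y \<in> U))"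
    using a b by meson
  finally show ?thesis .
qed

lemma openin_cantor_set:
  "openin (top_of_set cantor_set) W \<longleftrightarrow>
    W \<subseteq> cantor_set \<and> (\<forall>x. ternary x \<in> W \<longrightarrow> (\<exists>n. \<forall>y. agree n x y \<longrightarrow> ternary y \<in> W))"
proof -
  have a: "\<exists>e>0. \<forall>y. dist (ternary y) (ternary x) < e \<longrightarrow> agree n x y" for x n
    using ternary_not_agree[of n x]
    by (intro exI[of _ "(1 / 3) ^ n"]) (force simp: dist_real_def abs_minus_commute)
  have b: "\<exists>n. \<forall>y. agree n x y \<longrightarrow> dist (ternary y) (ternary x) < e" if "e > 0" for x e
  proof -
    obtain n where "(1 / 3 :: real) ^ n < e" using real_arch_pow_inv[of e "1 / 3 :: real"] \<open>e > 0\<close> by auto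
    then show ?thesis
      using ternary_agree[of n x] by (intro exI[of _ n]) (force simp: dist_real_def abs_minus_commute)
  qed
  have "openin (top_of_set cantor_set) W \<longleftrightarrow> W \<subseteq> cantor_set \<and>
      (\<forall>x. ternary x \<in> W \<longrightarrow> (\<exists>r>0. \<forall>y. dist (ternary y) (ternary x) < r \<longrightarrow> ternary y \<in> W))"
    unfolding openin_euclidean_subtopology_iff range_ternary[symmetric] by blast
  also have "\<dots> \<longleftrightarrow>
    W \<subseteq> cantor_set \<and> (\<forall>x. ternary x \<in> W \<longrightarrow> (\<exists>n. \<forall>y. agree n x y \<longrightarrow> ternary y \<in> W))"
    using a b by meson
  finally show ?thesis .
qed

lemma Cantor_push_metric:
  assumes "inj h" "cantor_dist d"
  shows "Cantor_metric_space (push_metric h d)"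
proof -
  have M: "Metric_space UNIV d" using assms(2) by (auto simp: cantor_dist_def)
  note ps = push_metric_simps[OF assms(1) M]
  let ?c = "ternary \<circ> inv h"
  have "homeomorphic_map (mtopology_of (push_metric h d)) (top_of_set cantor_set) ?c"
  proof (rule bijective_open_imp_homeomorphic_map)
    show "continuous_map (mtopology_of (push_metric h d)) (top_of_set cantor_set) ?c"
      unfolding continuous_map_def
      using range_ternary by (auto simp: openin_cantor_set openin_push_metric[OF assms] ps(1) assms(1))
    show "open_map (mtopology_of (push_metric h d)) (top_of_set cantor_set) ?c"
      unfolding open_map_def openin_cantor_set openin_push_metric[OF assms]
    proof (intro allI impI conjI; elim conjE)
      fix U assume U: "U \<subseteq> range h" "\<forall>x. h x \<in> U \<longrightarrow> (\<exists>n. \<forall>y. agree n x y \<longrightarrow> h y \<in> U)"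
      have iff: "ternary x \<in> ?c ` U \<longleftrightarrow> h x \<in> U" for x
        using U(1) inj_ternary assms(1) by (force simp: inj_eq image_iff)
      show "?c ` U \<subseteq> cantor_set" using range_ternary by auto
      show "\<exists>n. \<forall>y. agree n x y \<longrightarrow> ternary y \<in> ?c ` U" if "ternary x \<in> ?c ` U" for x
        using U(2) that unfolding iff by blast
    qed
    show "?c ` topspace (mtopology_of (push_metric h d)) = topspace (top_of_set cantor_set)"
      using assms(1) by (simp add: ps(1) image_comp range_ternary comp_def)
    show "inj_on ?c (topspace (mtopology_of (push_metric h d)))"
      using assms(1) inj_ternary by (auto simp: ps(1) inj_on_def)
  qed
  then show ?thesis
    unfolding Cantor_metric_space_def homeomorphic_space by blast
qed

section \<open>Transfer of the metric properties, and disjoint unions\<close>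

definition doubling_dist :: "('b \<Rightarrow> 'b \<Rightarrow> real) \<Rightarrow> bool" where
  "doubling_dist d \<longleftrightarrow> (\<exists>N::nat. N > 0 \<and> (\<forall>x. \<forall>r>0. \<exists>S. finite S \<and> card S \<le> N \<and>
     (\<forall>y. d x y \<le> r \<longrightarrow> (\<exists>s\<in>S. d s y \<le> r / 2))))"

definition chains_constant :: "('b \<Rightarrow> 'b \<Rightarrow> real) \<Rightarrow> real \<Rightarrow> bool" where
  "chains_constant d \<delta> \<longleftrightarrow> (\<forall>(N::nat) x. (\<forall>i\<in>{1..N}. d (x (i - 1)) (x i) \<le> \<delta> * d (x 0) (x N)) \<longrightarrow>
     (\<forall>i\<in>{0..N}. x i = x 0))"

definition disconnected_dist :: "('b \<Rightarrow> 'b \<Rightarrow> real) \<Rightarrow> bool" where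
  "disconnected_dist d \<longleftrightarrow> (\<exists>\<delta>::real. 0 < \<delta> \<and> \<delta> < 1 \<and> chains_constant d \<delta>)"

lemma chains_constantD:
  fixes N :: nat
  assumes "chains_constant d \<delta>" "\<forall>i\<in>{1..N}. d (x (i - 1)) (x i) \<le> \<delta> * d (x 0) (x N)"
  shows "\<forall>i\<in>{0..N}. x i = x 0"
  using assms unfolding chains_constant_def by (elim allE impE)

text \<open>The bound \<open>r < 1\<close> stands for the diameter; the transfer lemma below
  therefore asks for two points at distance exactly 1.\<close>

definition perfect_dist :: "('b \<Rightarrow> 'b \<Rightarrow> real) \<Rightarrow> bool" where
  "perfect_dist d \<longleftrightarrow> (\<exists>\<rho>::real. 0 < \<rho> \<and> \<rho> \<le> 1 \<and>
     (\<forall>x. \<forall>r. 0 < r \<and> r < 1 \<longrightarrow> (\<exists>y. \<rho> * r \<le> d x y \<and> d x y \<le> r)))"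

lemma doubling_push_metric:
  assumes h: "inj h" and M: "Metric_space UNIV d"
  shows "doubling (push_metric h d) \<longleftrightarrow> doubling_dist d"
proof -
  note ps = push_metric_simps[OF h M]
  have *: "(\<exists>S\<subseteq>range h. finite S \<and> card S \<le> N \<and>
        mcball_of (push_metric h d) (h x) r \<subseteq> (\<Union>s\<in>S. mcball_of (push_metric h d) s (r / 2))) \<longleftrightarrow>
      (\<exists>S. finite S \<and> card S \<le> N \<and> (\<forall>y. d x y \<le> r \<longrightarrow> (\<exists>s\<in>S. d s y \<le> r / 2)))" (is "?L \<longleftrightarrow> ?R")
    for x r and N :: nat
  proof
    assume ?L
    then obtain S where S: "S \<subseteq> range h" "finite S" "card S \<le> N"
      "mcball_of (push_metric h d) (h x) r \<subseteq> (\<Union>s\<in>S. mcball_of (push_metric h d) s (r / 2))" by blast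
    obtain T where T: "S = h ` T" using S(1) by (meson subset_imageE)
    have "finite T" "card T \<le> N"
      using S T h by (auto simp: card_image finite_image_iff inj_on_subset)
    moreover have "\<exists>s\<in>T. d s y \<le> r / 2" if "d x y \<le> r" for y
    proof -
      have "h y \<in> mcball_of (push_metric h d) (h x) r" using that by (simp add: ps)
      then have "h y \<in> (\<Union>s\<in>S. mcball_of (push_metric h d) s (r / 2))" using S(4) by blast
      then show ?thesis by (auto simp: T ps)
    qed
    ultimately show ?R by blast
  next
    assume ?R
    then obtain T where T: "finite T" "card T \<le> N" "\<And>y. d x y \<le> r \<Longrightarrow> \<exists>s\<in>T. d s y \<le> r / 2" by blast
    have "mcball_of (push_metric h d) (h x) r \<subseteq> (\<Union>s\<in>h ` T. mcball_of (push_metric h d) s (r / 2))"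
      using T(3) by (auto simp: ps)
    moreover have "card (h ` T) \<le> N" using T card_image_le order_trans by blast
    ultimately show ?L using T(1) by (intro exI[of _ "h ` T"]) auto
  qed
  show ?thesis
    unfolding doubling_def doubling_dist_def ps(1) by (simp add: *)
qed

lemma uniformly_disconnected_push_metric:
  assumes h: "inj h" and M: "Metric_space UNIV d"
  shows "uniformly_disconnected (push_metric h d) \<longleftrightarrow> disconnected_dist d"
proof -
  note ps = push_metric_simps[OF h M]
  have "(\<forall>N x. delta_chain (push_metric h d) \<delta> N x \<longrightarrow> (\<forall>i\<in>{0..N}. x i = x 0)) \<longleftrightarrow>
     (\<forall>(N::nat) x. (\<forall>i\<in>{1..N}. d (x (i - 1)) (x i) \<le> \<delta> * d (x 0) (x N)) \<longrightarrow> (\<forall>i\<in>{0..N}. x i = x 0))"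
    (is "?L \<longleftrightarrow> ?R") for \<delta> :: real
  proof
    assume L: ?L
    show ?R
    proof (intro allI impI)
      fix N :: nat and x assume "\<forall>i\<in>{1..N}. d (x (i - 1)) (x i) \<le> \<delta> * d (x 0) (x N)"
      then have "delta_chain (push_metric h d) \<delta> N (h \<circ> x)"
        unfolding delta_chain_def comp_apply ps by blast
      then have "\<forall>i\<in>{0..N}. (h \<circ> x) i = (h \<circ> x) 0"
        by (rule L[THEN spec, THEN spec, THEN mp])
      then show "\<forall>i\<in>{0..N}. x i = x 0" unfolding comp_apply inj_eq[OF h] .
    qed
  next
    assume R: ?R
    show ?L
    proof (intro allI impI)
      fix N x assume c: "delta_chain (push_metric h d) \<delta> N x"
      define y where "y = inv h \<circ> x"
      have y: "h (y i) = x i" if "i \<le> N" for i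
        using c that by (simp add: delta_chain_def ps(1) y_def f_inv_into_f)
      have "\<forall>i\<in>{1..N}. d (y (i - 1)) (y i) \<le> \<delta> * d (y 0) (y N)"
      proof
        fix i assume "i \<in> {1..N}"
        then have i: "i - 1 \<le> N" "i \<le> N" by auto
        have "mdist (push_metric h d) (x (i - 1)) (x i) \<le> \<delta> * mdist (push_metric h d) (x 0) (x N)"
          using c \<open>i \<in> {1..N}\<close> by (simp add: delta_chain_def)
        then show "d (y (i - 1)) (y i) \<le> \<delta> * d (y 0) (y N)"
          unfolding y[OF i(1), symmetric] y[OF i(2), symmetric] y[OF le0, symmetric] y[OF order_refl, symmetric] ps(2) .
      qed
      then have "\<forall>i\<in>{0..N}. y i = y 0"
        by (rule R[THEN spec, THEN spec, THEN mp])
      then show "\<forall>i\<in>{0..N}. x i = x 0" using y by (metis atLeastAtMost_iff le0)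
    qed
  qed
  then show ?thesis
    unfolding uniformly_disconnected_def disconnected_dist_def chains_constant_def by simp
qed

lemma mdiam_push_metric:
  assumes h: "inj h" and M: "Metric_space UNIV d" and d: "\<And>x y. d x y \<le> 1" "d a b = 1"
  shows "mdiam (push_metric h d) = 1"
  unfolding mdiam_def
proof (rule antisym)
  note ps = push_metric_simps[OF h M]
  show "(SUP (x, y)\<in>mspace (push_metric h d) \<times> mspace (push_metric h d).
      ereal (mdist (push_metric h d) x y)) \<le> 1"
    by (rule SUP_least) (auto simp: ps d)
  show "1 \<le> (SUP (x, y)\<in>mspace (push_metric h d) \<times> mspace (push_metric h d).
      ereal (mdist (push_metric h d) x y))"
    by (rule SUP_upper2[of "(h a, h b)"]) (auto simp: ps d)
qed

lemma uniformly_perfect_push_metric: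
  assumes h: "inj h" and M: "Metric_space UNIV d" and d: "\<And>x y. d x y \<le> 1" "d a b = 1"
  shows "uniformly_perfect (push_metric h d) \<longleftrightarrow> perfect_dist d"
proof -
  note ps = push_metric_simps[OF h M]
  have "mcball_of (push_metric h d) (h x) r - mball_of (push_metric h d) (h x) s \<noteq> {} \<longleftrightarrow>
      (\<exists>y. s \<le> d x y \<and> d x y \<le> r)" (is "?L \<longleftrightarrow> ?R") for x r s
  proof -
    have "?L \<longleftrightarrow> (\<exists>y. h y \<in> mcball_of (push_metric h d) (h x) r - mball_of (push_metric h d) (h x) s)"
      unfolding set_eq_iff Diff_iff in_mcball_of in_mball_of ps(1) by blast
    then show ?thesis by (auto simp: ps not_less)
  qed
  then show ?thesis
    unfolding uniformly_perfect_def perfect_dist_def mdiam_push_metric[OF h M d]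
    by (simp add: ps(1) one_ereal_def)
qed

section \<open>The upper bound: gauges coded by sets of naturals\<close>

lemma cantor_gauge_code:
  obtains code :: "'a metric set \<Rightarrow> nat set"
  where "inj_on code {conformal_gauge m | m. Cantor_metric_space m}"
proof -
  obtain T where T: "countable T" "T \<subseteq> cantor_set" "cantor_set \<subseteq> closure T"
    by (rule separable)
  have "cantor_set \<noteq> {}" using range_ternary by auto
  then have "T \<noteq> {}" using T(3) by auto
  define q where "q = from_nat_into T"
  have rq: "range q = T"
    unfolding q_def using \<open>T \<noteq> {}\<close> T(1) by (rule range_from_nat_into)
  \<comment> \<open>The rational lower cuts of all distances between points of the dense sequence.
    They form a set of triples of countable type, which \<open>to_nat\<close> turns into a set of
    naturals.\<close>
  define C where "C m \<phi> = {(i, j, p :: rat). of_rat p < mdist m (\<phi> (q i)) (\<phi> (q j))}"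
    for m :: "'a metric" and \<phi>
  have sub: "conformal_gauge m \<subseteq> conformal_gauge m'"
    if \<phi>: "homeomorphic_map (top_of_set cantor_set) (mtopology_of m) \<phi>"
      and \<phi>': "homeomorphic_map (top_of_set cantor_set) (mtopology_of m') \<phi>'"
      and C: "C m \<phi> = C m' \<phi>'" for m m' :: "'a metric" and \<phi> \<phi>'
  proof -
    have eqq: "mdist m (\<phi> (q i)) (\<phi> (q j)) = mdist m' (\<phi>' (q i)) (\<phi>' (q j))" for i j
    proof -
      have "of_rat p < mdist m (\<phi> (q i)) (\<phi> (q j)) \<longleftrightarrow> of_rat p < mdist m' (\<phi>' (q i)) (\<phi>' (q j))" for p
        using C unfolding C_def by (auto simp: set_eq_iff)
      then show ?thesis
        by (metis linorder_neqE_linordered_idom not_less_iff_gr_or_eq of_rat_dense)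
    qed
    let ?K = "top_of_set cantor_set"
    \<comment> \<open>The two distances, pulled back to the Cantor set, are continuous on its
      square; agreement on the dense set \<open>T \<times> T\<close> therefore extends to all
      pairs.\<close>
    have cl: "(x, y) \<in> prod_topology ?K ?K closure_of (T \<times> T)" if "x \<in> cantor_set" "y \<in> cantor_set" for x y
      using that T(2,3) closure_of_subtopology[of euclidean cantor_set T]
      unfolding closure_of_Times by (auto simp: Int_absorb1)
    have cont: "continuous_map (prod_topology ?K ?K) euclidean (\<lambda>z. mdist n (\<psi> (fst z)) (\<psi> (snd z)))"
      if "homeomorphic_map ?K (mtopology_of n) \<psi>" for n :: "'a metric" and \<psi>
    proof -
      have c: "continuous_map ?K (mtopology_of n) \<psi>"
        using that homeomorphic_imp_continuous_map by blast
      show ?thesis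
        using continuous_map_compose[OF continuous_map_fst c] continuous_map_compose[OF continuous_map_snd c]
        unfolding comp_def by (rule continuous_map_mdist)
    qed
    have dd: "mdist m (\<phi> x) (\<phi> y) = mdist m' (\<phi>' x) (\<phi>' y)" if "x \<in> cantor_set" "y \<in> cantor_set" for x y
    proof -
      have "mdist m (\<phi> (fst z)) (\<phi> (snd z)) = mdist m' (\<phi>' (fst z)) (\<phi>' (snd z))" if "z \<in> T \<times> T" for z
        using that eqq by (auto simp flip: rq)
      from forall_in_closure_of_eq[OF cl[OF that] Hausdorff_space_euclidean cont[OF \<phi>] cont[OF \<phi>'] this]
      show ?thesis by simp
    qed
    obtain \<psi> where \<psi>: "homeomorphic_maps ?K (mtopology_of m') \<phi>' \<psi>"
      using \<phi>' homeomorphic_map_maps by blast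
    then have "homeomorphic_map (mtopology_of m') ?K \<psi>"
      using homeomorphic_maps_map by blast
    then have "homeomorphic_map (mtopology_of m') (mtopology_of m) (\<phi> \<circ> \<psi>)"
      using homeomorphic_map_compose \<phi> by blast
    moreover have "mdist m ((\<phi> \<circ> \<psi>) x) ((\<phi> \<circ> \<psi>) y) = mdist m' x y" if "x \<in> mspace m'" "y \<in> mspace m'" for x y
    proof -
      have "\<psi> z \<in> cantor_set" "\<phi>' (\<psi> z) = z" if "z \<in> mspace m'" for z
        using \<psi> that unfolding homeomorphic_maps_def continuous_map_def by auto
      then show ?thesis using dd that by simp
    qed
    ultimately show ?thesis by (rule conformal_gauge_mono_isometry)
  qed
  let ?S = "{conformal_gauge m | m :: 'a metric. Cantor_metric_space m}"
  \<comment> \<open>The code of a gauge depends on a chosen representative and a chosen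
    parametrisation of it. This is harmless: equal codes make the two representatives
    isometric.\<close>
  have "\<forall>G\<in>?S. \<exists>z. G = conformal_gauge (fst z) \<and>
      homeomorphic_map (top_of_set cantor_set) (mtopology_of (fst z)) (snd z)"
  proof
    fix G assume "G \<in> ?S"
    then obtain m where m: "G = conformal_gauge m" "Cantor_metric_space m"
      by (elim CollectE exE conjE)
    from m(2) have "top_of_set cantor_set homeomorphic_space mtopology_of m"
      unfolding Cantor_metric_space_def by (subst homeomorphic_space_sym)
    then obtain \<phi> where "homeomorphic_map (top_of_set cantor_set) (mtopology_of m) \<phi>"
      unfolding homeomorphic_space by (elim exE)
    with m(1) show "\<exists>z. G = conformal_gauge (fst z) \<and>
      homeomorphic_map (top_of_set cantor_set) (mtopology_of (fst z)) (snd z)"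
      by (intro exI[of _ "(m, \<phi>)"]) simp
  qed
  from bchoice[OF this] obtain z where z: "\<forall>G\<in>?S. G = conformal_gauge (fst (z G)) \<and>
      homeomorphic_map (top_of_set cantor_set) (mtopology_of (fst (z G))) (snd (z G))" ..
  define m where "m G = fst (z G)" for G
  define \<phi> where "\<phi> G = snd (z G)" for G
  have m\<phi>: "G = conformal_gauge (m G)"
      "homeomorphic_map (top_of_set cantor_set) (mtopology_of (m G)) (\<phi> G)" if "G \<in> ?S" for G
    using bspec[OF z that] by (simp_all add: m_def \<phi>_def)
  have "inj_on (\<lambda>G. to_nat ` C (m G) (\<phi> G)) {conformal_gauge m | m. Cantor_metric_space m}"
  proof (rule inj_onI)
    fix G G' assume G: "G \<in> {conformal_gauge m | m. Cantor_metric_space m}"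
        "G' \<in> {conformal_gauge m | m. Cantor_metric_space m}"
      and "to_nat ` C (m G) (\<phi> G) = to_nat ` C (m G') (\<phi> G')"
    then have "C (m G) (\<phi> G) = C (m G') (\<phi> G')" by (simp add: inj_image_eq_iff)
    then show "G = G'"
      using sub[OF m\<phi>(2)[OF G(1)] m\<phi>(2)[OF G(2)]] sub[OF m\<phi>(2)[OF G(2)] m\<phi>(2)[OF G(1)]]
        m\<phi>(1)[OF G(1)] m\<phi>(1)[OF G(2)] by simp
  qed
  then show ?thesis by (rule that)
qed


section \<open>Disjoint unions\<close>

definition glue :: "(bits \<Rightarrow> bits \<Rightarrow> real) \<Rightarrow> (bits \<Rightarrow> bits \<Rightarrow> real) \<Rightarrow> bits \<Rightarrow> bits \<Rightarrow> real" where
  "glue d1 d2 x y = (if x 0 \<noteq> y 0 then 1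
     else (if x 0 then d1 else d2) (shift x) (shift y))"

lemma glue_case_nat [simp]:
  "glue d1 d2 (case_nat b x) (case_nat c y) = (if b \<noteq> c then 1 else (if b then d1 else d2) x y)"
  by (simp add: glue_def)

lemma bits_cases:
  fixes x :: bits
  obtains b y where "x = case_nat b y"
  using case_nat_shift[of x] by metis

lemma agree_case_nat: "agree (Suc n) (case_nat b x) (case_nat c y) \<longleftrightarrow> b = c \<and> agree n x y"
  by (simp add: agree_Suc)

lemma cantor_distD:
  assumes "cantor_dist d"
  shows "Metric_space UNIV d" "d x y \<le> 1"
    "\<exists>e>0. \<forall>y. d x y < e \<longrightarrow> agree n x y"
    "e > 0 \<Longrightarrow> \<exists>n. \<forall>y. agree n x y \<longrightarrow> d x y < e"
    "0 \<le> d x y" "d x y = d y x" "d x y = 0 \<longleftrightarrow> x = y" "d x z \<le> d x y + d y z"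
proof -
  show "Metric_space UNIV d" "d x y \<le> 1"
    "\<exists>e>0. \<forall>y. d x y < e \<longrightarrow> agree n x y"
    "e > 0 \<Longrightarrow> \<exists>n. \<forall>y. agree n x y \<longrightarrow> d x y < e"
    using assms by (auto simp: cantor_dist_def)
  interpret Metric_space UNIV d using assms by (simp add: cantor_dist_def)
  show "0 \<le> d x y" "d x y = d y x" "d x y = 0 \<longleftrightarrow> x = y" "d x z \<le> d x y + d y z"
    using triangle by (auto simp: commute)
qed

lemma cantor_dist_glue:
  assumes d1: "cantor_dist d1" and d2: "cantor_dist d2"
  shows "cantor_dist (glue d1 d2)"
  unfolding cantor_dist_def
proof (intro conjI allI impI)
  note [simp] = cantor_distD(2,5,7)[OF d1] cantor_distD(2,5,7)[OF d2]
  show "Metric_space UNIV (glue d1 d2)"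
  proof
    fix x y z :: bits
    obtain a x' b y' c z' where e: "x = case_nat a x'" "y = case_nat b y'" "z = case_nat c z'"
      using bits_cases by metis
    show "0 \<le> glue d1 d2 x y" by (simp add: e)
    show "glue d1 d2 x y = glue d1 d2 y x"
      using cantor_distD(6)[OF d1, of x' y'] cantor_distD(6)[OF d2, of x' y'] by (simp add: e)
    show "glue d1 d2 x y = 0 \<longleftrightarrow> x = y"
      by (auto simp: e dest: arg_cong[of _ _ shift] arg_cong[of _ _ "\<lambda>f. f 0"])
    show "glue d1 d2 x z \<le> glue d1 d2 x y + glue d1 d2 y z"
      using cantor_distD(8)[OF d1, of x' z' y'] cantor_distD(8)[OF d2, of x' z' y']
        order_trans[OF cantor_distD(2)[OF d1, of x' z'], of 2] order_trans[OF cantor_distD(2)[OF d2, of x' z'], of 2]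
      by (cases a; cases b; cases c) (simp_all add: e add_increasing add_increasing2)
  qed
  fix x :: bits
  obtain b x' where x: "x = case_nat b x'" by (rule bits_cases)
  show "glue d1 d2 x y \<le> 1" for y
    by (cases y rule: bits_cases) (simp add: x)
  show "\<exists>e>0. \<forall>y. glue d1 d2 x y < e \<longrightarrow> agree n x y" for n
  proof -
    obtain e1 where e1: "e1 > 0" "\<And>y. d1 x' y < e1 \<Longrightarrow> agree n x' y"
      using cantor_distD(3)[OF d1] by metis
    obtain e2 where e2: "e2 > 0" "\<And>y. d2 x' y < e2 \<Longrightarrow> agree n x' y"
      using cantor_distD(3)[OF d2] by metis
    have "agree n x y" if "glue d1 d2 x y < min 1 (min e1 e2)" for y
    proof (cases y rule: bits_cases)
      case (1 c y')
      have "agree (Suc n) x y"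
        using that e1(2)[of y'] e2(2)[of y']
        unfolding x 1 agree_case_nat by (auto split: if_splits)
      then show ?thesis by (rule agree_mono) simp
    qed
    then show ?thesis using e1(1) e2(1) by (intro exI[of _ "min 1 (min e1 e2)"]) auto
  qed
  show "\<exists>n. \<forall>y. agree n x y \<longrightarrow> glue d1 d2 x y < e" if "e > 0" for e
  proof -
    obtain n1 where n1: "\<And>y. agree n1 x' y \<Longrightarrow> d1 x' y < e"
      using cantor_distD(4)[OF d1 \<open>e > 0\<close>] by metis
    obtain n2 where n2: "\<And>y. agree n2 x' y \<Longrightarrow> d2 x' y < e"
      using cantor_distD(4)[OF d2 \<open>e > 0\<close>] by metis
    have "glue d1 d2 x y < e" if "agree (Suc (max n1 n2)) x y" for y
    proof (cases y rule: bits_cases)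
      case (1 c y')
      then have "b = c" "agree (max n1 n2) x' y'" using that by (simp_all add: x agree_case_nat)
      then show ?thesis
        using n1[of y'] n2[of y'] agree_mono[of "max n1 n2" x' y'] by (simp add: x 1)
    qed
    then show ?thesis by blast
  qed
qed

lemma glue_le_iff:
  assumes "r < 1"
  shows "glue d1 d2 (case_nat b x) y \<le> r \<longleftrightarrow>
    (\<exists>y'. y = case_nat b y' \<and> (if b then d1 else d2) x y' \<le> r)"
proof (cases y rule: bits_cases)
  case (1 c y')
  have "case_nat c y' = case_nat b z \<longleftrightarrow> c = b \<and> y' = z" for z
    by (auto dest: arg_cong[of _ _ shift] arg_cong[of _ _ "\<lambda>f. f 0"])
  then show ?thesis using assms 1 by auto
qed

lemma doubling_glue:
  assumes d1: "cantor_dist d1" and d2: "cantor_dist d2"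
  shows "doubling_dist (glue d1 d2) \<longleftrightarrow> doubling_dist d1 \<and> doubling_dist d2"
proof
  assume "doubling_dist d1 \<and> doubling_dist d2"
  then obtain N1 N2 where N: "N1 > 0" "N2 > 0"
    and c1: "\<And>x r. r > 0 \<Longrightarrow> \<exists>S. finite S \<and> card S \<le> N1 \<and> (\<forall>y. d1 x y \<le> r \<longrightarrow> (\<exists>s\<in>S. d1 s y \<le> r / 2))"
    and c2: "\<And>x r. r > 0 \<Longrightarrow> \<exists>S. finite S \<and> card S \<le> N2 \<and> (\<forall>y. d2 x y \<le> r \<longrightarrow> (\<exists>s\<in>S. d2 s y \<le> r / 2))"
    unfolding doubling_dist_def by metis
  have "\<exists>S. finite S \<and> card S \<le> N1 + N2 \<and> (\<forall>y. glue d1 d2 x y \<le> r \<longrightarrow> (\<exists>s\<in>S. glue d1 d2 s y \<le> r / 2))"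
    if r: "r > 0" for x r
  proof -
    obtain b x' where x: "x = case_nat b x'" by (rule bits_cases)
    obtain S1 where S1: "finite S1" "card S1 \<le> N1" "\<And>y. d1 x' y \<le> r \<Longrightarrow> \<exists>s\<in>S1. d1 s y \<le> r / 2"
      using c1[OF r] by metis
    obtain S2 where S2: "finite S2" "card S2 \<le> N2" "\<And>y. d2 x' y \<le> r \<Longrightarrow> \<exists>s\<in>S2. d2 s y \<le> r / 2"
      using c2[OF r] by metis
    let ?S = "case_nat True ` S1 \<union> case_nat False ` S2"
    have "card ?S \<le> card (case_nat True ` S1) + card (case_nat False ` S2)" by (rule card_Un_le)
    also have "\<dots> \<le> N1 + N2"
      using card_image_le[OF S1(1), of "case_nat True"] card_image_le[OF S2(1), of "case_nat False"] S1(2) S2(2)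
      by linarith
    finally have "card ?S \<le> N1 + N2" .
    moreover have "\<exists>s\<in>?S. glue d1 d2 s y \<le> r / 2" if y: "glue d1 d2 x y \<le> r" for y
    proof (cases y rule: bits_cases)
      case (1 c y')
      \<comment> \<open>If \<open>y\<close> lies in the half not containing \<open>x\<close>, then
        \<open>r \<ge> 1\<close> and the ball of radius \<open>r\<close> about \<open>x'\<close> is
        that whole half. So the same \<open>x'\<close> serves as centre in both halves.\<close>
      have "d1 x' y' \<le> r" if "c"
        using y that cantor_distD(2)[OF d1, of x' y'] by (cases b) (auto simp: x 1)
      moreover have "d2 x' y' \<le> r" if "\<not> c"
        using y that cantor_distD(2)[OF d2, of x' y'] by (cases b) (auto simp: x 1)
      ultimately show ?thesis
        using S1(3)[of y'] S2(3)[of y'] by (cases c) (force simp: 1)+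
    qed
    ultimately show ?thesis using S1(1) S2(1) by (intro exI[of _ ?S]) simp
  qed
  then show "doubling_dist (glue d1 d2)"
    unfolding doubling_dist_def using N(1) by (intro exI[of _ "N1 + N2"]) simp
next
  assume "doubling_dist (glue d1 d2)"
  then obtain N where N: "N > 0" and c: "\<And>x r. r > 0 \<Longrightarrow> \<exists>S. finite S \<and> card S \<le> N \<and>
      (\<forall>y. glue d1 d2 x y \<le> r \<longrightarrow> (\<exists>s\<in>S. glue d1 d2 s y \<le> r / 2))"
    unfolding doubling_dist_def by metis
  have "doubling_dist (if b then d1 else d2)" for b
    unfolding doubling_dist_def
  proof (intro exI[of _ N] conjI allI impI N)
    fix x and r :: real assume r: "r > 0"
    obtain S where S: "finite S" "card S \<le> N"
      "\<And>y. glue d1 d2 (case_nat b x) y \<le> r \<Longrightarrow> \<exists>s\<in>S. glue d1 d2 s y \<le> r / 2"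
      using c[OF r] by metis
    \<comment> \<open>A centre in the wrong half can be used only when \<open>r / 2 \<ge> 1\<close>;
      then every point of the right half is close enough, in particular its shift.\<close>
    have "\<exists>s\<in>shift ` S. (if b then d1 else d2) s y \<le> r / 2" if y: "(if b then d1 else d2) x y \<le> r" for y
    proof -
      have "glue d1 d2 (case_nat b x) (case_nat b y) \<le> r" using y by simp
      then obtain s where s: "s \<in> S" "glue d1 d2 s (case_nat b y) \<le> r / 2"
        using S(3) by blast
      obtain a s' where s': "s = case_nat a s'" by (rule bits_cases)
      have "(if b then d1 else d2) s' y \<le> r / 2"
        using s(2) cantor_distD(2)[OF d1, of s' y] cantor_distD(2)[OF d2, of s' y]
        unfolding s' by (auto split: if_splits)
      then show ?thesis using s(1) s' by force
    qed
    moreover have "card (shift ` S) \<le> N" using card_image_le[OF S(1)] S(2) order_trans by blast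
    ultimately show "\<exists>S. finite S \<and> card S \<le> N \<and>
        (\<forall>y. (if b then d1 else d2) x y \<le> r \<longrightarrow> (\<exists>s\<in>S. (if b then d1 else d2) s y \<le> r / 2))"
      using S(1) by (intro exI[of _ "shift ` S"]) blast
  qed
  from this[of True] this[of False] show "doubling_dist d1 \<and> doubling_dist d2" by simp
qed

lemma disconnected_glue:
  assumes d1: "cantor_dist d1" and d2: "cantor_dist d2"
  shows "disconnected_dist (glue d1 d2) \<longleftrightarrow> disconnected_dist d1 \<and> disconnected_dist d2"
proof
  assume "disconnected_dist d1 \<and> disconnected_dist d2"
  then obtain \<delta>1 \<delta>2 where \<delta>: "0 < \<delta>1" "\<delta>1 < 1" "0 < \<delta>2" "\<delta>2 < 1"
    and c: "chains_constant d1 \<delta>1" "chains_constant d2 \<delta>2"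
    unfolding disconnected_dist_def by (elim exE conjE)
  note c1 = chains_constantD[OF c(1)] and c2 = chains_constantD[OF c(2)]
  define \<delta> where "\<delta> = min \<delta>1 \<delta>2"
  have \<delta>': "0 < \<delta>" "\<delta> < 1" "\<delta> \<le> \<delta>1" "\<delta> \<le> \<delta>2" using \<delta> by (auto simp: \<delta>_def)
  have "\<forall>i\<in>{0..N}. x i = x 0"
    if ch: "\<forall>i\<in>{1..N}. glue d1 d2 (x (i - 1)) (x i) \<le> \<delta> * glue d1 d2 (x 0) (x N)" for N :: nat and x
  proof -
    have g1: "glue d1 d2 (x 0) (x N) \<le> 1"
      using cantor_distD(2)[OF cantor_dist_glue[OF d1 d2]] .
    \<comment> \<open>Steps shorter than 1 cannot change halves, so the whole chain lives in one
      summand.\<close>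
    have st: "glue d1 d2 (x (i - 1)) (x i) < 1" if "i \<in> {1..N}" for i
    proof -
      have "glue d1 d2 (x (i - 1)) (x i) \<le> \<delta> * glue d1 d2 (x 0) (x N)" using ch that by blast
      also have "\<dots> \<le> \<delta> * 1" using g1 \<delta>' by (intro mult_left_mono) auto
      finally show ?thesis using \<delta>' by simp
    qed
    have b: "x i 0 = x 0 0" if "i \<le> N" for i
      using that
    proof (induction i)
      case (Suc i)
      have "x i 0 = x (Suc i) 0" using st[of "Suc i"] Suc.prems by (auto simp: glue_def split: if_splits)
      then show ?case using Suc by simp
    qed simp
    define d where "d = (if x 0 0 then d1 else d2)"
    have gd: "glue d1 d2 (x i) (x j) = d (shift (x i)) (shift (x j))" if "i \<le> N" "j \<le> N" for i j
      using b[OF that(1)] b[OF that(2)] by (simp add: glue_def d_def)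
    have step: "d (shift (x (i - 1))) (shift (x i)) \<le> \<delta> * d (shift (x 0)) (shift (x N))" if "i \<in> {1..N}" for i
    proof -
      have "i - 1 \<le> N" "i \<le> N" using that by auto
      then show ?thesis using bspec[OF ch that] unfolding gd[OF \<open>i - 1 \<le> N\<close> \<open>i \<le> N\<close>] gd[OF le0 order_refl] by blast
    qed
    have dn: "0 \<le> d u v" for u v using cantor_distD(5)[OF d1] cantor_distD(5)[OF d2] by (simp add: d_def)
    have "\<forall>i\<in>{0..N}. shift (x i) = shift (x 0)"
    proof (cases "x 0 0")
      case True
      then have d: "d = d1" by (simp add: d_def)
      show ?thesis
        by (rule c1) (rule ballI, rule order_trans[OF step mult_right_mono[OF \<delta>'(3) dn], unfolded d])
    next
      case False
      then have d: "d = d2" by (simp add: d_def)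
      show ?thesis
        by (rule c2) (rule ballI, rule order_trans[OF step mult_right_mono[OF \<delta>'(4) dn], unfolded d])
    qed
    then have sh: "shift (x i) = shift (x 0)" if "i \<le> N" for i
      using that by (meson atLeastAtMost_iff le0)
    have "x i = x 0" if "i \<le> N" for i
      by (rule trans[OF case_nat_shift[symmetric] trans[OF _ case_nat_shift]])
         (simp only: b[OF that] sh[OF that])
    then show ?thesis by (meson atLeastAtMost_iff)
  qed
  then have "chains_constant (glue d1 d2) \<delta>"
    unfolding chains_constant_def by (intro allI impI)
  then show "disconnected_dist (glue d1 d2)"
    unfolding disconnected_dist_def using \<delta>'(1,2) by blast
next
  assume "disconnected_dist (glue d1 d2)"
  then obtain \<delta> where \<delta>: "0 < \<delta>" "\<delta> < 1" and c: "chains_constant (glue d1 d2) \<delta>"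
    unfolding disconnected_dist_def by (elim exE conjE)
  have "chains_constant (if b then d1 else d2) \<delta>" for b
    unfolding chains_constant_def
  proof (intro allI impI)
    fix N :: nat and x
    assume a: "\<forall>i\<in>{1..N}. (if b then d1 else d2) (x (i - 1)) (x i) \<le> \<delta> * (if b then d1 else d2) (x 0) (x N)"
    have "\<forall>i\<in>{1..N}. glue d1 d2 (case_nat b (x (i - 1))) (case_nat b (x i))
        \<le> \<delta> * glue d1 d2 (case_nat b (x 0)) (case_nat b (x N))"
      using a by (simp only: glue_case_nat simp_thms if_False)
    from chains_constantD[where x = "\<lambda>i. case_nat b (x i)", OF c this] have e: "\<forall>i\<in>{0..N}. case_nat b (x i) = case_nat b (x 0)" .
    show "\<forall>i\<in>{0..N}. x i = x 0"
    proof
      fix i assume "i \<in> {0..N}"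
      from arg_cong[OF bspec[OF e this], of shift] show "x i = x 0" by (simp only: shift_case_nat)
    qed
  qed
  from this[of True] this[of False] show "disconnected_dist d1 \<and> disconnected_dist d2"
    unfolding disconnected_dist_def using \<delta> by auto
qed

lemma perfect_dist_mono:
  assumes "\<rho>' \<le> \<rho>" "0 < (r::real)" "\<exists>y. \<rho> * r \<le> d x y \<and> d x y \<le> r"
  shows "\<exists>y. \<rho>' * r \<le> d x y \<and> d x y \<le> r"
proof -
  have "\<rho>' * r \<le> \<rho> * r" using assms by simp
  then show ?thesis using assms(3) order_trans by blast
qed

lemma perfect_glue: "perfect_dist (glue d1 d2) \<longleftrightarrow> perfect_dist d1 \<and> perfect_dist d2"
proof
  assume "perfect_dist d1 \<and> perfect_dist d2"
  then obtain \<rho>1 \<rho>2 where \<rho>: "0 < \<rho>1" "\<rho>1 \<le> 1" "0 < \<rho>2" "\<rho>2 \<le> 1"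
    and p: "\<And>x r. 0 < r \<Longrightarrow> r < 1 \<Longrightarrow> \<exists>y. \<rho>1 * r \<le> d1 x y \<and> d1 x y \<le> r"
      "\<And>x r. 0 < r \<Longrightarrow> r < 1 \<Longrightarrow> \<exists>y. \<rho>2 * r \<le> d2 x y \<and> d2 x y \<le> r"
    unfolding perfect_dist_def by metis
  have "\<exists>y. min \<rho>1 \<rho>2 * r \<le> glue d1 d2 x y \<and> glue d1 d2 x y \<le> r" if "0 < r" "r < 1" for x r
  proof -
    obtain b x' where x: "x = case_nat b x'" by (rule bits_cases)
    have "\<exists>y. min \<rho>1 \<rho>2 * r \<le> (if b then d1 else d2) x' y \<and> (if b then d1 else d2) x' y \<le> r"
      using perfect_dist_mono[OF min.cobounded1 that(1) p(1)[OF that, of x'], of \<rho>2]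
        perfect_dist_mono[OF min.cobounded2 that(1) p(2)[OF that, of x'], of \<rho>1] by (cases b) simp_all
    then obtain y where "min \<rho>1 \<rho>2 * r \<le> (if b then d1 else d2) x' y" "(if b then d1 else d2) x' y \<le> r"
      by blast
    then show ?thesis by (intro exI[of _ "case_nat b y"]) (simp add: x)
  qed
  then show "perfect_dist (glue d1 d2)"
    unfolding perfect_dist_def using \<rho> by (intro exI[of _ "min \<rho>1 \<rho>2"]) auto
next
  assume "perfect_dist (glue d1 d2)"
  then obtain \<rho> where \<rho>: "0 < \<rho>" "\<rho> \<le> 1"
    and p: "\<And>x r. 0 < r \<Longrightarrow> r < 1 \<Longrightarrow> \<exists>y. \<rho> * r \<le> glue d1 d2 x y \<and> glue d1 d2 x y \<le> r"
    unfolding perfect_dist_def by metis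
  have "perfect_dist (if b then d1 else d2)" for b
    unfolding perfect_dist_def
  proof (intro exI[of _ \<rho>] conjI allI impI \<rho>)
    fix x and r :: real assume r: "0 < r \<and> r < 1"
    then obtain y where y: "\<rho> * r \<le> glue d1 d2 (case_nat b x) y" "glue d1 d2 (case_nat b x) y \<le> r"
      using p by blast
    then show "\<exists>y. \<rho> * r \<le> (if b then d1 else d2) x y \<and> (if b then d1 else d2) x y \<le> r"
      using glue_le_iff[of r d1 d2 b x y] r by auto
  qed
  from this[of True] this[of False] show "perfect_dist d1 \<and> perfect_dist d2" by simp
qed

section \<open>Distances defined by blocks of bits\<close>

definition block_start :: "(nat \<Rightarrow> nat) \<Rightarrow> nat \<Rightarrow> nat" where
  "block_start s k = (\<Sum>i<k. s i)"

text \<open>A block is read as a binary number, lowest bit first, so that a distance between blocks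
  can be given by a function of two naturals.\<close>

definition block_val :: "(nat \<Rightarrow> nat) \<Rightarrow> bits \<Rightarrow> nat \<Rightarrow> nat" where
  "block_val s x k = horner_sum of_bool 2 (map x [block_start s k..<block_start s (Suc k)])"

definition block_upd :: "(nat \<Rightarrow> nat) \<Rightarrow> nat \<Rightarrow> nat \<Rightarrow> bits \<Rightarrow> bits" where
  "block_upd s k v x = (\<lambda>i. if block_start s k \<le> i \<and> i < block_start s (Suc k)
     then bit v (i - block_start s k) else x i)"

definition same_blocks :: "(nat \<Rightarrow> nat) \<Rightarrow> nat \<Rightarrow> bits \<Rightarrow> bits \<Rightarrow> bool" where
  "same_blocks s k x y \<longleftrightarrow> (\<forall>i<k. block_val s x i = block_val s y i)"

lemma block_start_Suc: "block_start s (Suc k) = block_start s k + s k"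
  by (simp add: block_start_def)

lemma block_start_mono: "i \<le> j \<Longrightarrow> block_start s i \<le> block_start s j"
  unfolding block_start_def by (intro sum_mono2) auto

lemma block_val_less: "block_val s x k < 2 ^ s k"
  using horner_sum_of_bool_2_less[of "map x [block_start s k..<block_start s (Suc k)]"]
  by (simp add: block_val_def block_start_Suc)

lemma block_val_eq_iff:
  "block_val s x k = block_val s y k \<longleftrightarrow> (\<forall>i. block_start s k \<le> i \<and> i < block_start s (Suc k) \<longrightarrow> x i = y i)"
    (is "?L \<longleftrightarrow> ?R")
proof
  assume L: ?L
  show ?R
  proof (intro allI impI)
    fix i assume i: "block_start s k \<le> i \<and> i < block_start s (Suc k)"
    define j where "j = i - block_start s k"
    have j: "i = block_start s k + j" "j < s k" using i by (auto simp: j_def block_start_Suc)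
    have "bit (block_val s z k) j \<longleftrightarrow> z i" for z
      using j by (simp add: block_val_def bit_horner_sum_bit_iff block_start_Suc)
    then show "x i = y i" using L by metis
  qed
next
  assume ?R
  then have "map x [block_start s k..<block_start s (Suc k)] = map y [block_start s k..<block_start s (Suc k)]"
    by simp
  then show ?L by (simp only: block_val_def)
qed

lemma block_val_upd_same:
  assumes "v < 2 ^ s k"
  shows "block_val s (block_upd s k v x) k = v"
proof -
  have "map (block_upd s k v x) [block_start s k..<block_start s (Suc k)] = map (bit v) [0..<s k]"
    by (rule nth_equalityI) (auto simp: block_upd_def block_start_Suc)
  then show ?thesis
    using assms by (simp add: block_val_def horner_sum_bit_eq_take_bit take_bit_nat_eq_self)
qed

lemma block_val_upd_other: "i \<noteq> k \<Longrightarrow> block_val s (block_upd s k v x) i = block_val s x i"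
  unfolding block_val_eq_iff block_upd_def
  using block_start_mono[of "Suc i" k s] block_start_mono[of "Suc k" i s] by (cases "i < k") auto

lemma same_blocks_upd: "same_blocks s k (block_upd s k v x) x"
  by (simp add: same_blocks_def block_val_upd_other)

lemma same_blocks_iff_agree: "same_blocks s k x y \<longleftrightarrow> agree (block_start s k) x y"
proof (induction k)
  case 0
  then show ?case by (simp add: same_blocks_def block_start_def)
next
  case (Suc k)
  have "same_blocks s (Suc k) x y \<longleftrightarrow> same_blocks s k x y \<and> block_val s x k = block_val s y k"
    by (auto simp: same_blocks_def less_Suc_eq)
  then show ?case
    unfolding Suc block_val_eq_iff agree_def block_start_Suc by (auto simp: not_le[symmetric])
qed

lemma same_blocks_refl [simp]: "same_blocks s k x x"
  by (simp add: same_blocks_def)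

lemma same_blocks_0 [simp]: "same_blocks s 0 x y"
  by (simp add: same_blocks_def)

lemma same_blocks_sym: "same_blocks s k x y \<Longrightarrow> same_blocks s k y x"
  by (simp add: same_blocks_def)

lemma same_blocks_trans: "same_blocks s k x y \<Longrightarrow> same_blocks s k y z \<Longrightarrow> same_blocks s k x z"
  by (simp add: same_blocks_def)

lemma same_blocks_Suc: "same_blocks s (Suc k) x y \<longleftrightarrow> same_blocks s k x y \<and> block_val s x k = block_val s y k"
  by (auto simp: same_blocks_def less_Suc_eq)

lemma same_blocks_mono: "same_blocks s k x y \<Longrightarrow> j \<le> k \<Longrightarrow> same_blocks s j x y"
  by (simp add: same_blocks_def)

definition first_diff :: "(nat \<Rightarrow> nat) \<Rightarrow> bits \<Rightarrow> bits \<Rightarrow> nat" where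
  "first_diff s x y = (LEAST k. block_val s x k \<noteq> block_val s y k)"

lemma first_diff_eq:
  assumes "same_blocks s k x y" "block_val s x k \<noteq> block_val s y k"
  shows "first_diff s x y = k"
  unfolding first_diff_def
  by (rule Least_equality) (use assms in \<open>auto simp: same_blocks_def not_less[symmetric]\<close>)

text \<open>Distinct children of a cylinder of level \<open>k\<close> are at distance at least
  \<open>r k\<close>, and \<open>R k\<close> bounds the diameter of the cylinder itself. The crucial
  condition is \<open>R (Suc k) \<le> r k\<close>: a child is no larger than the gaps between the
  children, so that the first differing block alone may determine the distance.\<close>

locale block_space =
  fixes s :: "nat \<Rightarrow> nat" and w :: "nat \<Rightarrow> nat \<Rightarrow> real" and r R :: "nat \<Rightarrow> real"
  assumes s_pos: "s k \<ge> 1"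
    and r_pos: "r k > 0"
    and w_refl: "w a a = 0" and w_sym: "w a b = w b a" and w_tri: "w a c \<le> w a b + w b c"
    and w_ge: "a \<noteq> b \<Longrightarrow> w a b \<ge> 1"
    and rw_le: "a < 2 ^ s k \<Longrightarrow> b < 2 ^ s k \<Longrightarrow> r k * w a b \<le> R k"
    and R_Suc: "R (Suc k) \<le> r k" and R_0: "R 0 \<le> 1" and R_lim: "R \<longlonglongrightarrow> 0"
begin

definition D :: "bits \<Rightarrow> bits \<Rightarrow> real" where
  "D x y = r (first_diff s x y) * w (block_val s x (first_diff s x y)) (block_val s y (first_diff s x y))"

abbreviation "V \<equiv> block_val s"
abbreviation "same \<equiv> same_blocks s"
abbreviation "upd \<equiv> block_upd s"

lemma start_ge: "k \<le> block_start s k"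
proof (induction k)
  case (Suc k)
  then show ?case using s_pos[of k] by (simp add: block_start_Suc)
qed simp

lemma cases_eq:
  obtains "x = y" | k where "same k x y" "V x k \<noteq> V y k"
proof (cases "\<forall>k. V x k = V y k")
  case True
  then have "agree k x y" for k
    using start_ge[of k] agree_mono[of "block_start s k" x y k]
    by (simp flip: same_blocks_iff_agree add: same_blocks_def)
  then show ?thesis using that(1) agree_all_eq by blast
next
  case False
  then obtain k where "V x k \<noteq> V y k" by blast
  define l where "l = (LEAST k. V x k \<noteq> V y k)"
  have "V x l \<noteq> V y l" unfolding l_def by (rule LeastI[of _ k]) fact
  moreover have "same l x y" unfolding same_blocks_def l_def using not_less_Least by blast
  ultimately show ?thesis using that(2) by blast
qed

lemma D_eq: "same k x y \<Longrightarrow> V x k \<noteq> V y k \<Longrightarrow> D x y = r k * w (V x k) (V y k)"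
  by (simp add: D_def first_diff_eq)

lemma D_refl [simp]: "D x x = 0"
  by (simp add: D_def w_refl)

lemma D_Suc_eq: "same k x y \<Longrightarrow> \<not> same (Suc k) x y \<Longrightarrow> D x y = r k * w (V x k) (V y k)"
  by (simp add: D_eq same_blocks_Suc)

lemma r_le_R: "r k \<le> R k"
proof -
  have "1 < (2::nat) ^ s k" using s_pos[of k] one_less_power[of "2::nat" "s k"] by simp
  then have "r k * w 0 1 \<le> R k" by (intro rw_le) auto
  moreover have "r k * 1 \<le> r k * w 0 1" using r_pos[of k] w_ge[of 0 1] by (intro mult_left_mono) auto
  ultimately show ?thesis by simp
qed

lemma rw_V_le: "r k * w (V x k) (V y k) \<le> R k"
  by (intro rw_le block_val_less)

lemma R_pos: "R k > 0"
  using r_le_R[of k] r_pos[of k] by simp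

lemma R_decseq: "j \<le> k \<Longrightarrow> R k \<le> R j"
  using decseqD[of R j k] R_Suc r_le_R by (metis decseq_Suc_iff order_trans)

lemma r_decseq: "j \<le> k \<Longrightarrow> r k \<le> r j"
  using decseqD[of r j k] R_Suc r_le_R by (metis decseq_Suc_iff order_trans)

lemma D_ge: "\<not> same (Suc k) x y \<Longrightarrow> r k \<le> D x y"
proof (cases rule: cases_eq[of x y])
  case (2 j)
  assume n: "\<not> same (Suc k) x y"
  have "j \<le> k"
  proof (rule ccontr)
    assume "\<not> j \<le> k"
    then show False using n same_blocks_mono[OF 2(1), of "Suc k"] by simp
  qed
  have "r k \<le> r j" using \<open>j \<le> k\<close> by (rule r_decseq)
  also have "\<dots> \<le> r j * w (V x j) (V y j)"
    using r_pos[of j] w_ge[OF 2(2)] by simp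
  finally show ?thesis using D_eq[OF 2] by simp
qed simp

lemma D_le: "same k x y \<Longrightarrow> D x y \<le> R k"
proof (cases rule: cases_eq[of x y])
  case 1
  then show ?thesis using R_pos[of k] by simp
next
  case (2 j)
  assume n: "same k x y"
  then have "k \<le> j" using 2(2) by (meson not_le same_blocks_def)
  have "D x y \<le> R j" using D_eq[OF 2] rw_V_le by simp
  also have "\<dots> \<le> R k" using \<open>k \<le> j\<close> by (rule R_decseq)
  finally show ?thesis .
qed

lemma D_less_same: "D x y < r k \<Longrightarrow> same (Suc k) x y"
  using D_ge by force

text \<open>Let \<open>x\<close> and \<open>z\<close> first differ in block \<open>k\<close>. If
  \<open>y\<close> agrees with \<open>x\<close> before \<open>k\<close>, the triangle inequality of
  \<open>w\<close> applies. If \<open>y\<close> leaves at an earlier \<open>j\<close>, then already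
  \<open>D x y \<ge> r j \<ge> R (Suc j) \<ge> D x z\<close>.\<close>

lemma D_metric: "Metric_space UNIV D"
proof
  show sym: "D x y = D y x" for x y
    unfolding D_def first_diff_def by (subst w_sym) (simp add: eq_commute)
  show nn: "0 \<le> D x y" for x y
  proof (cases rule: cases_eq[of x y])
    case (2 j)
    then show ?thesis using D_eq[OF 2] r_pos[of j] w_ge[OF 2(2)] by simp
  qed simp
  show "D x y = 0 \<longleftrightarrow> x = y" for x y
  proof (cases rule: cases_eq[of x y])
    case (2 j)
    then show ?thesis using D_eq[OF 2] r_pos[of j] w_ge[OF 2(2)] by auto
  qed simp
  show "D x z \<le> D x y + D y z" for x y z
  proof (cases rule: cases_eq[of x z])
    case 1
    then show ?thesis using nn by simp
  next
    case (2 k)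
    consider (all) "same k x y" | (other) j where "j < k" "same j x y" "V x j \<noteq> V y j"
    proof (cases "same k x y")
      case False
      then show ?thesis
      proof (cases rule: cases_eq[of x y])
        case (2 j)
        then have "j < k" using False by (meson not_le same_blocks_mono)
        then show ?thesis using that(2) 2 by blast
      qed auto
    qed
    then show ?thesis
    proof cases
      case all
      then have yz: "same k y z" using 2(1) same_blocks_sym same_blocks_trans by blast
      have "D x z = r k * w (V x k) (V z k)" by (rule D_eq[OF 2])
      also have "\<dots> \<le> r k * (w (V x k) (V y k) + w (V y k) (V z k))"
        using r_pos[of k] w_tri by simp
      also have "\<dots> = r k * w (V x k) (V y k) + r k * w (V y k) (V z k)" by (rule distrib_left)
      also have "r k * w (V x k) (V y k) \<le> D x y"
        using D_eq[OF all] nn by (cases "V x k = V y k") (auto simp: w_refl)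
      also have "r k * w (V y k) (V z k) \<le> D y z"
        using D_eq[OF yz] nn by (cases "V y k = V z k") (auto simp: w_refl)
      finally show ?thesis by simp
    next
      case other
      have "same (Suc j) x z" using same_blocks_mono[OF 2(1), of "Suc j"] other(1) by simp
      have "D x z \<le> R k" using D_le[OF 2(1)] .
      also have "\<dots> \<le> R (Suc j)" using other(1) by (intro R_decseq) simp
      also have "\<dots> \<le> r j" by (rule R_Suc)
      also have "\<dots> \<le> D x y" using other(2,3) by (intro D_ge) (simp add: same_blocks_Suc)
      finally show ?thesis using nn[of y z] by simp
    qed
  qed
qed

lemma cantor_D: "cantor_dist D"
  unfolding cantor_dist_def
proof (intro conjI allI impI D_metric)
  show "D x y \<le> 1" for x y
    using D_le[of 0 x y] R_0 by simp
  show "\<exists>e>0. \<forall>y. D x y < e \<longrightarrow> agree n x y" for x n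
  proof (intro exI[of _ "r n"] conjI allI impI r_pos)
    fix y assume "D x y < r n"
    then have "same (Suc n) x y" by (rule D_less_same)
    then show "agree n x y"
      using agree_mono start_ge[of "Suc n"] unfolding same_blocks_iff_agree by fastforce
  qed
  show "\<exists>n. \<forall>y. agree n x y \<longrightarrow> D x y < e" if "e > 0" for x e
  proof -
    have "eventually (\<lambda>k. R k < e) sequentially"
      using R_lim that by (simp add: order_tendstoD(2))
    then obtain k where "R k < e" by (auto simp: eventually_sequentially)
    then show ?thesis
      using D_le[of k x] by (intro exI[of _ "block_start s k"]) (force simp flip: same_blocks_iff_agree)
  qed
qed

text \<open>The first level whose scale is at most \<open>t\<close>: a ball of radius
  \<open>t\<close> then stays inside one cylinder of level \<open>k\<close>. For
  \<open>k = 0\<close> that cylinder is the whole space.\<close>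

lemma level:
  assumes "0 < t"
  obtains k where "r k \<le> t" "k = 0 \<or> t < r (k - 1)"
proof -
  have "eventually (\<lambda>k. R k < t) sequentially"
    using R_lim assms by (simp add: order_tendstoD(2))
  then obtain k0 where "R k0 < t" by (auto simp: eventually_sequentially)
  then have k0: "r k0 \<le> t" using r_le_R[of k0] by simp
  define k where "k = (LEAST k. r k \<le> t)"
  have "r k \<le> t" unfolding k_def by (rule LeastI[of _ k0]) fact
  moreover have "k = 0 \<or> t < r (k - 1)"
    using not_less_Least[of "k - 1" "\<lambda>k. r k \<le> t"] unfolding k_def[symmetric]
    by (cases k) auto
  ultimately show ?thesis by (rule that)
qed

lemma ball_same: "D x y \<le> t \<Longrightarrow> k = 0 \<or> t < r (k - 1) \<Longrightarrow> same k x y"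
  using D_less_same[of x y "k - 1"] by (cases k) auto

lemma V_upd_same: "v < 2 ^ s k \<Longrightarrow> V (upd k v x) k = v"
  by (rule block_val_upd_same)

lemma D_upd: "v < 2 ^ s k \<Longrightarrow> D x (upd k v x) = r k * w (V x k) v"
proof (cases "V x k = v")
  case True
  assume v: "v < 2 ^ s k"
  have "upd k v x = x"
  proof (cases rule: cases_eq[of "upd k v x" x])
    case (2 j)
    then show ?thesis using V_upd_same[OF v, of x] block_val_upd_other[of j k s v x] True by (cases "j = k") auto
  qed
  then show ?thesis using True by (simp add: w_refl)
next
  case False
  assume v: "v < 2 ^ s k"
  show ?thesis
    using D_eq[of k x "upd k v x"] same_blocks_sym[OF same_blocks_upd] V_upd_same[OF v] False by simp
qed

end

section \<open>Types of block distances\<close>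

definition ultrametric :: "('b \<Rightarrow> 'b \<Rightarrow> real) \<Rightarrow> bool" where
  "ultrametric d \<longleftrightarrow> (\<forall>x y z. d x z \<le> max (d x y) (d y z))"

text \<open>If all steps are at most half the distance of the endpoints, the strong triangle
  inequality keeps every point of the chain, including the last, within that half; so the distance
  is 0.\<close>

lemma ultrametric_disconnected:
  assumes M: "Metric_space UNIV d" and u: "ultrametric d"
  shows "disconnected_dist d"
proof -
  interpret Metric_space UNIV d by (rule M)
  have "chains_constant d (1 / 2)"
    unfolding chains_constant_def
  proof (intro allI impI)
    fix N :: nat and x
    assume ch: "\<forall>i\<in>{1..N}. d (x (i - 1)) (x i) \<le> 1 / 2 * d (x 0) (x N)"
    define m where "m = d (x 0) (x N) / 2"
    have *: "d (x 0) (x i) \<le> m" if "i \<le> N" for i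
      using that
    proof (induction i)
      case 0
      show ?case by (simp add: m_def)
    next
      case (Suc i)
      have "d (x 0) (x (Suc i)) \<le> max (d (x 0) (x i)) (d (x i) (x (Suc i)))"
        using u unfolding ultrametric_def by blast
      moreover have "d (x i) (x (Suc i)) \<le> m"
        using bspec[OF ch, of "Suc i"] Suc.prems by (simp add: m_def)
      ultimately show ?case using Suc by simp
    qed
    have "m \<le> 0" using *[of N] by (simp add: m_def)
    then have "d (x 0) (x i) = 0" if "i \<le> N" for i
      using *[OF that] nonneg[of "x 0" "x i"] by linarith
    then have "x i = x 0" if "i \<le> N" for i using that zero[of "x 0" "x i"] by auto
    then show "\<forall>i\<in>{0..N}. x i = x 0" by (meson atLeastAtMost_iff)
  qed
  then show ?thesis
    unfolding disconnected_dist_def by (intro exI[of _ "1 / 2"]) simp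
qed

text \<open>Colour each ball with boundedly many colours so that points of equal colour are close;
  one representative of each colour is a centre. Colours that do not occur get an arbitrary
  centre.\<close>

lemma doubling_by_colours:
  fixes c :: "'b \<Rightarrow> real \<Rightarrow> 'b \<Rightarrow> 'e"
  assumes "N > 0"
    and "\<And>x r. r > 0 \<Longrightarrow> finite (A x r)" "\<And>x r. r > 0 \<Longrightarrow> card (A x r) \<le> N"
    and "\<And>x r y. r > 0 \<Longrightarrow> d x y \<le> r \<Longrightarrow> c x r y \<in> A x r"
    and "\<And>x r y z. r > 0 \<Longrightarrow> d x y \<le> r \<Longrightarrow> d x z \<le> r \<Longrightarrow> c x r y = c x r z \<Longrightarrow> d y z \<le> r / 2"
  shows "doubling_dist d"
  unfolding doubling_dist_def
proof (intro exI[of _ N] conjI allI impI assms(1))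
  fix x and r :: real assume r: "r > 0"
  define p where "p a = (SOME y. d x y \<le> r \<and> c x r y = a)" for a
  show "\<exists>S. finite S \<and> card S \<le> N \<and> (\<forall>y. d x y \<le> r \<longrightarrow> (\<exists>s\<in>S. d s y \<le> r / 2))"
  proof (intro exI[of _ "p ` A x r"] conjI allI impI)
    show "finite (p ` A x r)" using assms(2)[OF r] by simp
    show "card (p ` A x r) \<le> N"
      using card_image_le[OF assms(2)[OF r], of p x] assms(3)[OF r, of x] by linarith
    fix y assume y: "d x y \<le> r"
    have "d x (p (c x r y)) \<le> r \<and> c x r (p (c x r y)) = c x r y"
      unfolding p_def by (rule someI[of _ y]) (use y in simp)
    then have "d (p (c x r y)) y \<le> r / 2" using assms(5)[OF r] y by blast
    then show "\<exists>s\<in>p ` A x r. d s y \<le> r / 2" using assms(4)[OF r y] by blast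
  qed
qed

lemma (in block_space) D_upd_upd:
  assumes "u < 2 ^ s k" "v < 2 ^ s k"
  shows "D (upd k u x) (upd k v x) = r k * w u v"
proof (cases "u = v")
  case False
  have "same k (upd k u x) (upd k v x)"
    using same_blocks_trans[OF same_blocks_upd same_blocks_sym[OF same_blocks_upd]] .
  then show ?thesis
    using D_eq[of k "upd k u x" "upd k v x"] V_upd_same assms False by simp
qed (simp add: w_refl)

section \<open>Blocks with equidistant values: ultrametric spaces\<close>

locale ultra_space =
  fixes s :: "nat \<Rightarrow> nat" and r :: "nat \<Rightarrow> real"
  assumes s_ge: "s k \<ge> 1" and r_gt: "r k > 0" and r_Suc: "r (Suc k) \<le> r k"
    and r_0: "r 0 = 1" and r_lim: "r \<longlonglongrightarrow> 0"
begin

sublocale block_space s "\<lambda>a b. of_bool (a \<noteq> b)" r r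
  by unfold_locales (rule s_ge r_gt r_Suc r_lim | use r_gt in \<open>auto simp: r_0 less_imp_le\<close>)+

lemma D_ultra: "same k x y \<Longrightarrow> \<not> same (Suc k) x y \<Longrightarrow> D x y = r k"
  using D_Suc_eq[of k x y] by (simp add: same_blocks_Suc)

lemma ultrametric_D: "ultrametric D"
  unfolding ultrametric_def
proof (intro allI)
  fix x y z
  show "D x z \<le> max (D x y) (D y z)"
  proof (cases rule: cases_eq[of x z])
    case 1
    then show ?thesis using cantor_distD(5)[OF cantor_D, of x y] by simp
  next
    case (2 k)
    then have "D x z = r k" using D_ultra by (simp add: same_blocks_Suc)
    moreover have "\<not> same (Suc k) x y \<or> \<not> same (Suc k) y z"
      using 2(2) by (auto simp: same_blocks_Suc)
    ultimately show ?thesis using D_ge[of k x y] D_ge[of k y z] by auto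
  qed
qed

lemma doubling_D:
  assumes "\<And>k. s k \<le> 2" "\<And>k. r (Suc k) \<le> r k / 2"
  shows "doubling_dist D"
proof -
  define l where "l t = (SOME k. r k \<le> t \<and> (k = 0 \<or> t < r (k - 1)))" for t
  have l: "r (l t) \<le> t \<and> (l t = 0 \<or> t < r (l t - 1))" if "t > 0" for t
    unfolding l_def by (rule someI_ex) (rule level[OF that], intro exI conjI)
  show ?thesis
  \<comment> \<open>The colour is the value of the first block not fixed by the ball. A block has at
    most 2 bits, hence 4 values, and points that also agree there are within the next scale, at most
    \<open>t / 2\<close>.\<close>
  proof (rule doubling_by_colours[where N = 4 and A = "\<lambda>x t. {..<4}" and c = "\<lambda>x t y. V y (l t)"])
    fix x t y assume t: "(t::real) > 0"
    have "V y (l t) < 2 ^ s (l t)" by (rule block_val_less)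
    also have "\<dots> \<le> 2 ^ 2" using assms(1) by (intro power_increasing) auto
    finally show "V y (l t) \<in> {..<4}" by simp
    fix z assume y: "D x y \<le> t" and z: "D x z \<le> t" and eq: "V y (l t) = V z (l t)"
    have "same (l t) y z"
      using same_blocks_trans[OF same_blocks_sym[OF ball_same[OF y l[OF t, THEN conjunct2]]]
          ball_same[OF z l[OF t, THEN conjunct2]]] .
    then have "same (Suc (l t)) y z" using eq by (simp add: same_blocks_Suc)
    then have "D y z \<le> r (Suc (l t))" by (rule D_le)
    then show "D y z \<le> t / 2" using assms(2)[of "l t"] l[OF t] by simp
  qed auto
qed

text \<open>A long block gives \<open>2 ^ s k\<close> points at mutual distance \<open>r k\<close>,
  and a ball of radius \<open>r k / 2\<close> contains at most one of them.\<close>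

lemma not_doubling_D:
  assumes "\<And>N. \<exists>k. N \<le> s k"
  shows "\<not> doubling_dist D"
proof
  assume "doubling_dist D"
  then obtain N where N: "\<And>x t. t > 0 \<Longrightarrow> \<exists>S. finite S \<and> card S \<le> N \<and> (\<forall>y. D x y \<le> t \<longrightarrow> (\<exists>s\<in>S. D s y \<le> t / 2))"
    unfolding doubling_dist_def by blast
  obtain k where k: "N \<le> s k" using assms by blast
  define x :: bits where "x = (\<lambda>_. False)"
  obtain S where S: "finite S" "card S \<le> N" "\<And>y. D x y \<le> r k \<Longrightarrow> \<exists>s\<in>S. D s y \<le> r k / 2"
    using N[OF r_gt] by metis
  have "\<exists>p\<in>S. D p (upd k v x) \<le> r k / 2" for v
    using S(3)[OF D_le[OF same_blocks_sym[OF same_blocks_upd]]] .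
  then obtain p where p: "\<And>v. p v \<in> S" "\<And>v. D (p v) (upd k v x) \<le> r k / 2" by metis
  have "inj_on p {..<2 ^ s k}"
  proof (rule inj_onI, rule ccontr)
    fix u v :: nat assume uv: "u \<in> {..<2 ^ s k}" "v \<in> {..<2 ^ s k}" "p u = p v" "u \<noteq> v"
    have "D (upd k u x) (upd k v x) \<le> max (D (upd k u x) (p u)) (D (p u) (upd k v x))"
      using ultrametric_D unfolding ultrametric_def by blast
    also have "\<dots> \<le> r k / 2"
      using p(2)[of u] p(2)[of v] uv(3) cantor_distD(6)[OF cantor_D, of "upd k u x" "p u"] by simp
    finally show False using D_upd_upd[of u k v x] uv r_gt[of k] by simp
  qed
  then have "card {..<2 ^ s k :: nat} \<le> card S"
    using S(1) p(1) by (intro card_inj_on_le) auto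
  then have "2 ^ s k \<le> N" using S(2) by simp
  then show False using k less_exp[of "s k"] by linarith
qed

lemma perfect_D:
  assumes "\<And>k. r k / 2 \<le> r (Suc k)"
  shows "perfect_dist D"
  unfolding perfect_dist_def
proof (intro exI[of _ "1 / 2"] conjI allI impI)
  fix x and t :: real assume t: "0 < t \<and> t < 1"
  obtain k where k: "r k \<le> t" "k = 0 \<or> t < r (k - 1)" using level t by blast
  have "k \<noteq> 0" using k(1) t r_0 by (cases k) auto
  then have "t \<le> 2 * r k" using k(2) assms[of "k - 1"] by simp
  \<comment> \<open>Any value other than that of \<open>x\<close> would do; 0 and 1 are always
    available because \<open>s k \<ge> 1\<close>.\<close>
  define v where "v = (if V x k = 0 then 1 else 0 :: nat)"
  have "v < 2 ^ s k" "V x k \<noteq> v" using one_less_power[of "2::nat" "s k"] s_ge[of k] by (auto simp: v_def)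
  then have "D x (upd k v x) = r k" using D_upd by simp
  then show "\<exists>y. 1 / 2 * t \<le> D x y \<and> D x y \<le> t"
    using k(1) \<open>t \<le> 2 * r k\<close> by (intro exI[of _ "upd k v x"]) simp
qed auto

lemma not_perfect_D:
  assumes "\<And>e. e > 0 \<Longrightarrow> \<exists>k. r (Suc k) < e * r k"
  shows "\<not> perfect_dist D"
proof
  assume "perfect_dist D"
  then obtain \<rho> where \<rho>: "0 < \<rho>" "\<And>x t. 0 < t \<and> t < 1 \<Longrightarrow> \<exists>y. \<rho> * t \<le> D x y \<and> D x y \<le> t"
    unfolding perfect_dist_def by blast
  obtain k where k: "r (Suc k) < \<rho> * r k" using assms \<rho>(1) by blast
  then have "r (Suc k) / \<rho> < r k" using \<rho>(1) by (simp add: divide_simps mult.commute)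
  \<comment> \<open>With this choice the interval from \<open>\<rho> * t\<close> to \<open>t\<close>
    lies strictly between two consecutive scales, so it contains no distance.\<close>
  then obtain t where t: "r (Suc k) / \<rho> < t" "t < r k" using dense by blast
  have "t > 0" using t(1) r_gt[of "Suc k"] \<rho>(1) by (smt (verit) divide_pos_pos)
  moreover have "r k \<le> 1" using r_decseq[of 0 k] r_0 by simp
  ultimately obtain y where y: "\<rho> * t \<le> D (\<lambda>_. False) y" "D (\<lambda>_. False) y \<le> t"
    using \<rho>(2)[of t] t(2) by force
  have "D (\<lambda>_. False) y \<le> r (Suc k)" using y(2) t(2) by (intro D_le D_less_same) simp
  moreover have "r (Suc k) < \<rho> * t" using t(1) \<rho>(1) by (simp add: divide_simps mult.commute)
  ultimately show False using y(1) by simp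
qed

end

text \<open>The children of a cylinder form an arithmetic progression with step \<open>r k\<close>,
  and each has diameter at most half that step. The factor 1/2 keeps the children apart while
  successive scales still fit together closely enough for uniform perfectness.\<close>

locale lin_space =
  fixes s :: "nat \<Rightarrow> nat" and r :: "nat \<Rightarrow> real"
  assumes s_ge: "s k \<ge> 1" and r_gt: "r k > 0" and r_Suc: "r (Suc k) * 2 ^ s (Suc k) = r k / 2"
    and r_0: "r 0 * 2 ^ s 0 = 1 / 2"
begin

lemma pow_s_ge: "(2::real) \<le> 2 ^ s k"
  using power_increasing[OF s_ge[of k], of "2::real"] by simp

sublocale block_space s "\<lambda>a b. \<bar>real a - real b\<bar>" r "\<lambda>k. r k * 2 ^ s k"
proof
  fix a b k :: nat assume "a < 2 ^ s k" "b < 2 ^ s k"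
  then have "real a < 2 ^ s k" "real b < 2 ^ s k"
    by (metis of_nat_less_iff of_nat_numeral of_nat_power)+
  then have "\<bar>real a - real b\<bar> \<le> 2 ^ s k" by linarith
  then show "r k * \<bar>real a - real b\<bar> \<le> r k * 2 ^ s k" using r_gt[of k] by simp
next
  have *: "r k * 2 ^ s k \<le> (1 / 2) ^ k" for k
  proof (induction k)
    case (Suc k)
    have "r k * 1 \<le> r k * 2 ^ s k" using r_gt[of k] pow_s_ge[of k] by (intro mult_left_mono) auto
    then show ?case using Suc r_Suc[of k] by simp
  qed (use r_0 in simp)
  have lim: "(\<lambda>k. (1 / 2 :: real) ^ k) \<longlonglongrightarrow> 0" by (rule LIMSEQ_realpow_zero) auto
  show "(\<lambda>k. r k * 2 ^ s k) \<longlonglongrightarrow> 0"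
    by (rule tendsto_sandwich[OF _ _ tendsto_const lim]) (use * r_gt in \<open>auto simp: less_imp_le\<close>)
next
  fix a b c k :: nat
  show "1 \<le> s k" by (rule s_ge)
  show "0 < r k" by (rule r_gt)
  show "\<bar>real a - real a\<bar> = 0" by simp
  show "\<bar>real a - real b\<bar> = \<bar>real b - real a\<bar>" by (rule abs_minus_commute)
  show "\<bar>real a - real c\<bar> \<le> \<bar>real a - real b\<bar> + \<bar>real b - real c\<bar>" by linarith
  show "1 \<le> \<bar>real a - real b\<bar>" if "a \<noteq> b" using that by linarith
  show "r (Suc k) * 2 ^ s (Suc k) \<le> r k" using r_Suc[of k] r_gt[of k] by simp
  show "r 0 * 2 ^ s 0 \<le> 1" using r_0 by simp
qed

lemma D_same_Suc: "same (Suc k) x y \<Longrightarrow> D x y \<le> r k / 2"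
  using D_le[of "Suc k" x y] r_Suc[of k] by simp

lemma doubling_D: "doubling_dist D"
proof -
  define l where "l t = (SOME k. r k \<le> t \<and> (k = 0 \<or> t < r (k - 1)))" for t
  have l: "r (l t) \<le> t \<and> (l t = 0 \<or> t < r (l t - 1))" if "t > 0" for t
    unfolding l_def by (rule someI_ex) (rule level[OF that], intro exI conjI)
  \<comment> \<open>The position of \<open>y\<close> on its line, rounded down to a multiple of
    \<open>t / 2\<close>. In a ball of radius \<open>t\<close> it differs by at most 2 units from
    that of the centre, hence 5 colours.\<close>
  define c where "c t y = \<lfloor>2 * r (l t) * V y (l t) / t\<rfloor>" for t y
  have lin: "r (l t) * \<bar>real (V y (l t)) - real (V z (l t))\<bar> \<le> D y z" if "same (l t) y z" for t y z
    using D_eq[OF that] cantor_distD(5)[OF cantor_D, of y z] by (cases "V y (l t) = V z (l t)") auto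
  show ?thesis
  proof (rule doubling_by_colours[where N = 5 and A = "\<lambda>x t. {c t x - 2..c t x + 2}" and c = "\<lambda>x. c"])
    fix x t y assume t: "(t::real) > 0" and y: "D x y \<le> t"
    have sy: "same (l t) x y" using ball_same[OF y l[OF t, THEN conjunct2]] .
    have "r (l t) * \<bar>real (V x (l t)) - real (V y (l t))\<bar> \<le> t" using lin[OF sy] y by simp
    then have "\<bar>r (l t) * V x (l t) - r (l t) * V y (l t)\<bar> \<le> t"
      using r_gt[of "l t"] by (simp add: abs_mult flip: right_diff_distrib)
    then have "\<bar>2 * r (l t) * V x (l t) / t - 2 * r (l t) * V y (l t) / t\<bar> \<le> 2"
      using t by (simp add: abs_le_iff field_simps)
    then show "c t y \<in> {c t x - 2..c t x + 2}" unfolding c_def by (simp, linarith)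
    fix z assume z: "D x z \<le> t" and eq: "c t y = c t z"
    have yz: "same (l t) y z"
      using same_blocks_trans[OF same_blocks_sym[OF sy] ball_same[OF z l[OF t, THEN conjunct2]]] .
    show "D y z \<le> t / 2"
    proof (cases "V y (l t) = V z (l t)")
      case True
      then have "D y z \<le> r (l t) / 2" using yz by (intro D_same_Suc) (simp add: same_blocks_Suc)
      then show ?thesis using l[OF t] by simp
    next
      case False
      have "\<bar>2 * r (l t) * V y (l t) / t - 2 * r (l t) * V z (l t) / t\<bar> \<le> 1"
        using eq unfolding c_def by linarith
      then have "\<bar>r (l t) * V y (l t) - r (l t) * V z (l t)\<bar> \<le> t / 2"
        unfolding abs_le_iff using t by (auto simp: field_simps)
      then show ?thesis
        using D_eq[OF yz False] r_gt[of "l t"] by (simp add: abs_mult flip: right_diff_distrib)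
    qed
  qed auto
qed

text \<open>The values fill an interval of length twice the bound on \<open>n\<close>, so there is
  room for \<open>n\<close> on at least one side of \<open>v\<close>.\<close>

lemma far_value:
  assumes "v < 2 ^ s k" "n \<le> 2 ^ (s k - 1)"
  obtains u where "u < 2 ^ s k" "\<bar>real v - real u\<bar> = real n"
proof (cases "n \<le> v")
  case True
  then show ?thesis using assms by (intro that[of "v - n"]) auto
next
  case False
  have "(2::nat) ^ s k = 2 * 2 ^ (s k - 1)"
    using s_ge[of k] by (cases "s k") auto
  then show ?thesis using assms False by (intro that[of "v + n"]) auto
qed

lemma perfect_D: "perfect_dist D"
  unfolding perfect_dist_def
proof (intro exI[of _ "1 / 4"] conjI allI impI)
  fix x and t :: real assume t: "0 < t \<and> t < 1"
  obtain k where k: "r k \<le> t" "k = 0 \<or> t < r (k - 1)" using level t by blast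
  have R: "t < 2 * (r k * 2 ^ s k)"
    using k(2) r_Suc[of "k - 1"] r_0 t by (cases k) auto
  have half: "(2::real) ^ s k = 2 * 2 ^ (s k - 1)" using s_ge[of k] by (cases "s k") auto
  \<comment> \<open>The number of steps of length \<open>r k\<close> that fit into \<open>t\<close>,
    capped by what \<open>far_value\<close> allows. Rounding costs a factor 2 at most; if the cap is
    effective, \<open>R\<close> gives \<open>t < 4 * (r k * n)\<close>. This is the origin of
    1/4.\<close>
  define n where "n = min (nat \<lfloor>t / r k\<rfloor>) (2 ^ (s k - 1))"
  have q: "1 \<le> t / r k" using k(1) r_gt[of k] by (simp add: divide_simps)
  then have "1 \<le> \<lfloor>t / r k\<rfloor>" by simp
  moreover from this have "real (nat \<lfloor>t / r k\<rfloor>) = of_int \<lfloor>t / r k\<rfloor>" by simp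
  moreover have "of_int \<lfloor>q\<rfloor> \<le> q" "1 \<le> \<lfloor>q\<rfloor> \<Longrightarrow> q / 2 \<le> of_int \<lfloor>q\<rfloor>" for q :: real by linarith+
  ultimately have f: "real (nat \<lfloor>t / r k\<rfloor>) \<le> t / r k" "t / r k / 2 \<le> real (nat \<lfloor>t / r k\<rfloor>)"
    by (simp_all only:)
  obtain u where u: "u < 2 ^ s k" "\<bar>real (V x k) - real u\<bar> = real n"
    by (rule far_value[OF block_val_less[of s x k], of n]) (auto simp: n_def)
  have D: "D x (upd k u x) = r k * real n" using D_upd[OF u(1)] u(2) by simp
  have "real n \<le> real (nat \<lfloor>t / r k\<rfloor>)" unfolding n_def of_nat_le_iff by (rule min.cobounded1)
  then have "real n \<le> t / r k" using f(1) by (rule order_trans)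
  then have "r k * real n \<le> t" using r_gt[of k] by (simp add: divide_simps mult.commute)
  moreover have "t / 4 \<le> r k * real n"
  proof (cases "nat \<lfloor>t / r k\<rfloor> \<le> 2 ^ (s k - 1)")
    case True
    then have "t / r k / 2 \<le> real n" using f(2) by (simp add: n_def)
    then have "t / 2 \<le> r k * real n" using r_gt[of k] by (simp add: divide_simps mult.commute)
    then show ?thesis using t by simp
  next
    case False
    then have "real n = 2 ^ (s k - 1)" by (simp add: n_def)
    then show ?thesis using R half by simp
  qed
  ultimately show "\<exists>y. 1 / 4 * t \<le> D x y \<and> D x y \<le> t" using D by (intro exI[of _ "upd k u x"]) simp
qed auto

lemma not_disconnected_D:
  assumes "\<And>n. \<exists>k. n \<le> s k"
  shows "\<not> disconnected_dist D"
proof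
  assume "disconnected_dist D"
  then obtain \<delta> where \<delta>: "0 < \<delta>" "chains_constant D \<delta>"
    unfolding disconnected_dist_def by (elim exE conjE)
  obtain n :: nat where n: "1 / \<delta> < real n" using reals_Archimedean2 by blast
  obtain k where k: "n \<le> s k" using assms by blast
  \<comment> \<open>The chain runs through all values of block \<open>k\<close>: steps of length
    \<open>r k\<close>, endpoints \<open>r k * N\<close> apart, and \<open>N\<close> exceeds
    \<open>1 / \<delta>\<close>.\<close>
  define N where "N = (2::nat) ^ s k - 1"
  define x where "x i = upd k i (\<lambda>_. False)" for i
  have N: "i \<le> N \<Longrightarrow> i < 2 ^ s k" for i
    unfolding N_def by (metis Suc_pred' less_Suc_eq_le pos2 zero_less_power)
  have D: "D (x i) (x j) = r k * \<bar>real i - real j\<bar>" if "i \<le> N" "j \<le> N" for i j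
    unfolding x_def using D_upd_upd N that by simp
  have "n \<le> N" using k less_exp[of "s k"] unfolding N_def by linarith
  then have "1 \<le> \<delta> * N" using n \<delta>(1) by (smt (verit) divide_less_eq mult.commute of_nat_mono mult_left_mono)
  have "\<forall>i\<in>{1..N}. D (x (i - 1)) (x i) \<le> \<delta> * D (x 0) (x N)"
  proof
    fix i assume i: "i \<in> {1..N}"
    then obtain j where j: "i = Suc j" by (cases i) auto
    have "D (x (i - 1)) (x i) = r k * 1" using i D[of j i] by (simp add: j)
    also have "\<dots> \<le> r k * (\<delta> * N)" using \<open>1 \<le> \<delta> * N\<close> r_gt[of k] by (intro mult_left_mono) auto
    also have "\<dots> = \<delta> * D (x 0) (x N)" using D[of 0 N] by simp
    finally show "D (x (i - 1)) (x i) \<le> \<delta> * D (x 0) (x N)" .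
  qed
  from chains_constantD[where x = x, OF \<delta>(2) this] have "x N = x 0" by (meson atLeastAtMost_iff le0 order_refl)
  then have "r k * real N = 0" using D[of N 0] by simp
  moreover have "N > 0" using \<open>1 \<le> \<delta> * N\<close> by (cases N) auto
  ultimately show False using r_gt[of k] by simp
qed

end

section \<open>Images of cylinders\<close>

text \<open>Cylinders of a glued space, taken only in its coded half, where the first bit is
  \<open>True\<close>.\<close>

definition cyl :: "(nat \<Rightarrow> nat) \<Rightarrow> nat \<Rightarrow> bits \<Rightarrow> bits set" where
  "cyl s k x = {y. y 0 \<and> same_blocks s k (shift x) (shift y)}"

lemma cyl_self: "x 0 \<Longrightarrow> x \<in> cyl s k x"
  by (simp add: cyl_def)

lemma cyl_eq: "y \<in> cyl s k x \<Longrightarrow> cyl s k y = cyl s k x"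
  unfolding cyl_def using same_blocks_sym same_blocks_trans by blast

lemma cyl_mono: "j \<le> k \<Longrightarrow> cyl s k x \<subseteq> cyl s j x"
  by (auto simp: cyl_def intro: same_blocks_mono)

lemma cyl_True: "y \<in> cyl s k x \<Longrightarrow> y 0"
  by (simp add: cyl_def)

lemma cyl_Suc_neq:
  assumes "s k \<ge> 1"
  shows "cyl s (Suc k) x \<noteq> cyl s k x"
proof
  assume eq: "cyl s (Suc k) x = cyl s k x"
  define v where "v = (if block_val s (shift x) k = 0 then 1 else 0 :: nat)"
  have v: "v < 2 ^ s k" "v \<noteq> block_val s (shift x) k"
    using one_less_power[of "2::nat" "s k"] assms by (auto simp: v_def)
  have "case_nat True (block_upd s k v (shift x)) \<in> cyl s k x"
    by (simp add: cyl_def same_blocks_sym[OF same_blocks_upd])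
  then have "block_val s (block_upd s k v (shift x)) k = block_val s (shift x) k"
    unfolding eq[symmetric] by (simp add: cyl_def same_blocks_Suc)
  then show False using v by (simp add: block_val_upd_same)
qed

lemma card_cyl_children:
  "card ((\<lambda>y. cyl s (Suc k) y) ` cyl s k x) = 2 ^ s k"
proof -
  define g where "g v = cyl s (Suc k) (case_nat True (block_upd s k v (shift x)))" for v
  have sv: "same_blocks s k (shift x) (block_upd s k v (shift x))" for v
    by (rule same_blocks_sym[OF same_blocks_upd])
  have "(\<lambda>y. cyl s (Suc k) y) ` cyl s k x = g ` {..<2 ^ s k}"
  proof (rule set_eqI, rule iffI)
    fix C assume "C \<in> (\<lambda>y. cyl s (Suc k) y) ` cyl s k x"
    then obtain y where y: "y 0" "same_blocks s k (shift x) (shift y)" "C = cyl s (Suc k) y"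
      by (auto simp: cyl_def)
    define v where "v = block_val s (shift y) k"
    have v: "v < 2 ^ s k" unfolding v_def by (rule block_val_less)
    have "same_blocks s (Suc k) (block_upd s k v (shift x)) (shift y)"
      unfolding same_blocks_Suc
      using same_blocks_trans[OF same_blocks_upd y(2)] block_val_upd_same[of v s k, OF v] v_def by simp
    then have "y \<in> cyl s (Suc k) (case_nat True (block_upd s k v (shift x)))"
      using y(1) by (simp add: cyl_def)
    then have "C = g v" unfolding y(3) g_def by (rule cyl_eq)
    then show "C \<in> g ` {..<2 ^ s k}" using v by blast
  next
    fix C assume "C \<in> g ` {..<2 ^ s k}"
    then obtain v where "C = g v" by blast
    moreover have "case_nat True (block_upd s k v (shift x)) \<in> cyl s k x"
      by (simp add: cyl_def sv)
    ultimately show "C \<in> (\<lambda>y. cyl s (Suc k) y) ` cyl s k x" unfolding g_def by blast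
  qed
  moreover have "inj_on g {..<2 ^ s k}"
  proof (rule inj_onI)
    fix u v :: nat assume uv: "u \<in> {..<2 ^ s k}" "v \<in> {..<2 ^ s k}" and eq: "g u = g v"
    have "case_nat True (block_upd s k v (shift x)) \<in> g u"
      unfolding eq unfolding g_def by (rule cyl_self) simp
    then have "block_val s (block_upd s k u (shift x)) k = block_val s (block_upd s k v (shift x)) k"
      by (simp add: g_def cyl_def same_blocks_Suc)
    then show "u = v" using uv by (simp add: block_val_upd_same)
  qed
  ultimately show ?thesis by (simp add: card_image)
qed

text \<open>A bijection preserves strict inclusion, so along nested cylinders the levels of the
  images strictly increase; the same for the inverse shows that no level is skipped. From some level
  on, children therefore go to children, and there are \<open>2 ^ s k\<close> of them.\<close>

lemma cylinder_shift:
  assumes s: "\<And>k. s k \<ge> 1" and s': "\<And>k. s' k \<ge> 1" and F: "bij F"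
    and A: "\<And>k x. k \<ge> K \<Longrightarrow> x 0 \<Longrightarrow> F x 0 \<and> (\<exists>j. F ` cyl s k x = cyl s' j (F x))"
    and B: "\<And>k y. k \<ge> K' \<Longrightarrow> y 0 \<Longrightarrow> inv F y 0 \<and> (\<exists>j. inv F ` cyl s' k y = cyl s j (inv F y))"
  obtains a b where "\<And>n. s (a + n) = s' (b + n)"
proof -
  have FF: "inv F (F x) = x" "F (inv F y) = y" for x y
    using F by (simp_all add: bij_is_inj bij_is_surj surj_f_inv_f)
  have inj: "F ` S = F ` T \<longleftrightarrow> S = T" for S T using F by (simp add: bij_is_inj inj_image_eq_iff)
  have less: "m < n"
    if "k < l" "x 0" "F ` cyl s k x = cyl s' m (F x)" "F ` cyl s l x = cyl s' n (F x)" for k l m n x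
  proof -
    have "cyl s l x \<subseteq> cyl s (Suc k) x" using that(1) by (intro cyl_mono) simp
    moreover have "cyl s (Suc k) x \<subset> cyl s k x"
      using cyl_Suc_neq[of s k x, OF s] cyl_mono[of k "Suc k" s x] by auto
    ultimately have "cyl s l x \<subset> cyl s k x" by blast
    then have "F ` cyl s l x \<subset> F ` cyl s k x"
      using inj by (metis image_mono psubset_eq)
    then show ?thesis
      unfolding that(3,4) using cyl_mono[of n m s' "F x"] by (meson not_le psubsetE subset_trans)
  qed
  define x :: bits where "x = (\<lambda>_. True)"
  have x: "x 0" by (simp add: x_def)
  have "\<forall>k. \<exists>j. K \<le> k \<longrightarrow> F ` cyl s k x = cyl s' j (F x)"
    using A[of _ x] x by blast
  from choice[OF this] obtain j where "\<forall>k. K \<le> k \<longrightarrow> F ` cyl s k x = cyl s' (j k) (F x)" ..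
  then have j: "F ` cyl s k x = cyl s' (j k) (F x)" if "K \<le> k" for k using that by blast
  have ge: "j (K + n) \<ge> n" for n
  proof (induction n)
    case (Suc n)
    have "j (K + n) < j (K + Suc n)"
      by (rule less[where x = x, OF _ x j j]) auto
    then show ?case using Suc by simp
  qed simp
  \<comment> \<open>Image levels grow at least as fast as levels, so this makes the image level
    \<open>b\<close> at least \<open>K'\<close>, where the hypothesis on the inverse takes
    effect.\<close>
  define a where "a = K + K'"
  define b where "b = j a"
  have ab: "a \<ge> K" "b \<ge> K'" using ge[of K'] by (auto simp: a_def b_def)
  \<comment> \<open>In the induction the next cylinder goes to some level \<open>m > b + n\<close>.
    Conversely the cylinder of level \<open>b + Suc n\<close> comes from a level
    \<open>l > a + n\<close>, and this gives the opposite inclusion.\<close>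
  have key: "F ` cyl s (a + n) y = cyl s' (b + n) (F y)" if y: "y \<in> cyl s a x" for n y
  proof (induction n)
    case 0
    have "F y \<in> cyl s' b (F x)" using y j[OF ab(1)] unfolding b_def by blast
    then show ?case using j[OF ab(1)] cyl_eq[OF y] cyl_eq[of "F y" s' b "F x"] by (simp add: b_def)
  next
    case (Suc n)
    have y0: "y 0" using cyl_True[OF y] .
    have Fy0: "F y 0" using A[of a y, OF ab(1) y0] by simp
    obtain m where m: "F ` cyl s (a + Suc n) y = cyl s' m (F y)"
      using A[of "a + Suc n" y] ab(1) y0 by auto
    have "b + n < m" by (rule less[where x = y, OF _ y0 Suc m]) simp
    obtain l where "inv F ` cyl s' (b + Suc n) (F y) = cyl s l (inv F (F y))"
      using B[of "b + Suc n" "F y"] ab(2) Fy0 by auto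
    then have "F ` inv F ` cyl s' (b + Suc n) (F y) = F ` cyl s l y" by (simp add: FF)
    then have l: "F ` cyl s l y = cyl s' (b + Suc n) (F y)" by (simp add: image_comp comp_def FF)
    have "a + n < l"
    proof (rule ccontr)
      assume "\<not> a + n < l"
      then have "cyl s (a + n) y \<subseteq> cyl s l y" by (intro cyl_mono) simp
      then have "cyl s' (b + n) (F y) \<subseteq> cyl s' (b + Suc n) (F y)"
        using Suc l by (metis image_mono)
      then show False
        using cyl_Suc_neq[of s' "b + n" "F y", OF s'] cyl_mono[of "b + n" "Suc (b + n)" s' "F y"] by auto
    qed
    then have "cyl s l y \<subseteq> cyl s (a + Suc n) y" by (intro cyl_mono) simp
    then have "cyl s' (b + Suc n) (F y) \<subseteq> cyl s' m (F y)" using l m by (metis image_mono)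
    moreover have "cyl s' m (F y) \<subseteq> cyl s' (b + Suc n) (F y)"
      using \<open>b + n < m\<close> by (intro cyl_mono) simp
    ultimately show ?case using m by auto
  qed
  have "s (a + n) = s' (b + n)" for n
  proof -
    have xa: "x \<in> cyl s a x" using cyl_self x .
    have sub: "cyl s (a + n) x \<subseteq> cyl s a x" by (rule cyl_mono) simp
    have "(\<lambda>y. cyl s' (Suc (b + n)) y) ` cyl s' (b + n) (F x) =
        (\<lambda>y. cyl s' (b + Suc n) (F y)) ` cyl s (a + n) x"
      unfolding key[OF xa, symmetric] by (simp add: image_comp comp_def)
    also have "\<dots> = (\<lambda>y. F ` cyl s (a + Suc n) y) ` cyl s (a + n) x"
    proof (rule image_cong[OF refl])
      fix y assume "y \<in> cyl s (a + n) x"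
      then have "y \<in> cyl s a x" using sub by blast
      then show "cyl s' (b + Suc n) (F y) = F ` cyl s (a + Suc n) y" by (rule key[symmetric])
    qed
    also have "\<dots> = (`) F ` (\<lambda>y. cyl s (Suc (a + n)) y) ` cyl s (a + n) x"
      by (simp add: image_comp comp_def)
    finally have "card ((\<lambda>y. cyl s' (Suc (b + n)) y) ` cyl s' (b + n) (F x)) =
        card ((\<lambda>y. cyl s (Suc (a + n)) y) ` cyl s (a + n) x)"
      using inj by (simp add: card_image inj_on_def)
    then have "(2::nat) ^ s' (b + n) = 2 ^ s (a + n)" by (simp only: card_cyl_children)
    then show ?thesis by simp
  qed
  then show ?thesis by (rule that)
qed

context block_space
begin

text \<open>The smallest cylinder containing \<open>E\<close>: the witness \<open>q\<close> lies in
  a different child from \<open>p\<close>.\<close>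

lemma first_level:
  assumes E: "\<And>y. y \<in> E \<Longrightarrow> y 0" and p: "p \<in> E" and ne: "E \<noteq> {p}"
  obtains j q where "E \<subseteq> cyl s j p" "q \<in> E" "V (shift p) j \<noteq> V (shift q) j"
proof -
  let ?P = "\<lambda>j. \<exists>q\<in>E. V (shift p) j \<noteq> V (shift q) j"
  obtain q where q: "q \<in> E" "q \<noteq> p" using p ne by blast
  have "shift q \<noteq> shift p"
  proof
    assume "shift q = shift p"
    moreover have "q 0 = p 0" using E[OF q(1)] E[OF p] by simp
    ultimately have "case_nat (q 0) (shift q) = case_nat (p 0) (shift p)" by simp
    then show False using q(2) unfolding case_nat_shift by blast
  qed
  then obtain j where "V (shift p) j \<noteq> V (shift q) j"
    by (cases rule: cases_eq[of "shift p" "shift q"]) auto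
  then have "?P j" using q by blast
  define l where "l = (LEAST j. ?P j)"
  have "?P l" unfolding l_def by (rule LeastI[of ?P j]) fact
  moreover have "E \<subseteq> cyl s l p"
  proof
    fix y assume "y \<in> E"
    then have "V (shift p) i = V (shift y) i" if "i < l" for i
      using not_less_Least[of i ?P] that unfolding l_def by blast
    then show "y \<in> cyl s l p" using E[OF \<open>y \<in> E\<close>] by (simp add: cyl_def same_blocks_def)
  qed
  ultimately show ?thesis using that by blast
qed

lemma glue_D_in_cyl:
  assumes "x 0" "y \<in> cyl s k x"
  shows "glue D Z x y = D (shift x) (shift y)" "glue D Z x y \<le> R k"
  using assms D_le[of k "shift x" "shift y"] by (auto simp: glue_def cyl_def)

lemma r_le_1: "r k \<le> 1"
  using r_decseq[of 0 k] r_le_R[of 0] R_0 by simp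

lemma glue_D_not_in_cyl:
  assumes "x 0" "z \<notin> cyl s (Suc k) x"
  shows "r k \<le> glue D Z x z"
  using assms D_ge[of k "shift x" "shift z"] r_le_1[of k] by (auto simp: glue_def cyl_def)

lemma R_ev_le: "e > 0 \<Longrightarrow> \<exists>K. \<forall>k\<ge>K. R k \<le> e"
  using order_tendstoD(2)[OF R_lim, of e] unfolding eventually_sequentially by (meson less_imp_le)

end

text \<open>The image of a small ball that is isolated (its diameter is tiny compared to the distance to its
  complement) is again isolated, hence a cylinder: a uniformly perfect part contains no isolated sets.\<close>

lemma (in ultra_space) isolated_cylinder_image:
  assumes d': "d' = glue (block_space.D s' (\<lambda>a b. of_bool (a \<noteq> b)) r') Z'"
    and X': "ultra_space s' r'" and Z: "cantor_dist Z" and Z': "cantor_dist Z'" and perf: "perfect_dist Z'"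
    and q: "qs (glue D Z) d' F"
    and gap: "\<And>e. e > 0 \<Longrightarrow> \<exists>K. \<forall>k\<ge>K. r (Suc k) \<le> e * r k"
  obtains K where "\<And>k x. k \<ge> K \<Longrightarrow> x 0 \<Longrightarrow> F x 0 \<and> (\<exists>j. F ` cyl s k x = cyl s' j (F x))"
proof -
  interpret X': ultra_space s' r' by (rule X')
  have cd': "cantor_dist d'" unfolding d' by (rule cantor_dist_glue[OF X'.cantor_D Z'])
  have bij: "bij F" using q by (simp add: qs_def)
  obtain \<rho> where \<rho>: "0 < \<rho>" "\<rho> \<le> 1" "\<And>x t. 0 < t \<and> t < 1 \<Longrightarrow> \<exists>y. \<rho> * t \<le> Z' x y \<and> Z' x y \<le> t"
    using perf unfolding perfect_dist_def by blast
  define e where "e = \<rho> / 4"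
  have e: "0 < e" "e < 1" "2 * e < \<rho>" using \<rho> by (auto simp: e_def)
  obtain t where t: "t > 0" "\<And>x y z. glue D Z x y \<le> t * glue D Z x z \<Longrightarrow> d' (F x) (F y) \<le> e * d' (F x) (F z)"
    using qs_small[OF q e(1)] by metis
  obtain K where K: "\<And>k. k \<ge> K \<Longrightarrow> r (Suc k) \<le> t * r k" using gap[OF t(1)] by blast
  have "F x 0 \<and> (\<exists>j. F ` cyl s k x = cyl s' j (F x))" if k: "k \<ge> Suc K" and x: "x 0" for k x
  proof -
    obtain l where l: "k = Suc l" "l \<ge> K" using k by (cases k) auto
    define E where "E = F ` cyl s k x"
    define p where "p = F x"
    have p: "p \<in> E" using cyl_self[of x, OF x] by (simp add: E_def p_def)
    \<comment> \<open>Leaving the cylinder costs at least \<open>r l\<close> with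
      \<open>l = k - 1\<close>, while its points are within \<open>r k \<le> t * r l\<close> of
      \<open>x\<close>. The choice of \<open>t\<close> turns this into isolation of the image with
      factor \<open>e\<close>.\<close>
    have iso: "d' p q \<le> e * d' p w" if "q \<in> E" "w \<notin> E" for q w
    proof -
      obtain y where y: "y \<in> cyl s k x" "q = F y" using \<open>q \<in> E\<close> by (auto simp: E_def)
      obtain z where z: "w = F z" using bij by (metis bij_pointE)
      then have "z \<notin> cyl s k x" using \<open>w \<notin> E\<close> by (auto simp: E_def)
      have "glue D Z x y \<le> r k" using glue_D_in_cyl(2)[of x y k Z, OF x y(1)] .
      also have "\<dots> \<le> t * r l" using K[OF l(2)] l(1) by simp
      also have "\<dots> \<le> t * glue D Z x z"
        using glue_D_not_in_cyl[of x z l Z, OF x] \<open>z \<notin> cyl s k x\<close> t(1) l(1) by (intro mult_left_mono) auto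
      finally show ?thesis unfolding y(2) z p_def by (rule t(2))
    qed
    \<comment> \<open>A point of the other half. Isolation from its image, which is at distance at
      most 1, bounds \<open>E\<close> by \<open>e < 1\<close> and so confines it to one
      half.\<close>
    have "(\<lambda>_. False) \<notin> cyl s k x" by (simp add: cyl_def)
    then have out: "F (\<lambda>_. False) \<notin> E"
      using bij by (auto simp: E_def bij_is_inj inj_image_mem_iff)
    have small: "d' p q \<le> e" if "q \<in> E" for q
      using iso[OF that out] cantor_distD(2)[OF cd', of p "F (\<lambda>_. False)"] e(1)
      by (smt (verit) mult_left_le)
    have part: "q 0 = p 0" if "q \<in> E" for q
      using small[OF that] e(2) unfolding d' by (auto simp: glue_def split: if_splits)
    have "cyl s (Suc k) x \<subseteq> cyl s k x" "cyl s (Suc k) x \<noteq> cyl s k x"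
      using cyl_mono[of k "Suc k"] cyl_Suc_neq[of s k x, OF s_ge] by auto
    then have "\<exists>y. y \<in> cyl s k x \<and> y \<noteq> x" using cyl_self[of x, OF x] by blast
    then obtain y where "y \<in> cyl s k x" "y \<noteq> x" by blast
    then have y: "F y \<in> E" "F y \<noteq> p"
      using bij by (auto simp: E_def p_def bij_is_inj inj_eq)
    have ne: "E \<noteq> {p}" using y by blast
    show ?thesis
    proof (cases "p 0")
      case True
      obtain j q where j: "E \<subseteq> cyl s' j p" "q \<in> E" "X'.V (shift p) j \<noteq> X'.V (shift q) j"
        by (rule X'.first_level[of E p]) (use part True p ne in auto)
      have q: "d' p q = r' j"
        using X'.D_ultra[of j "shift p" "shift q"] j part[OF j(2)] True
        unfolding d' by (auto simp: glue_def cyl_def same_blocks_Suc)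
      \<comment> \<open>\<open>q\<close> realises the diameter of the smallest cylinder around
        \<open>E\<close>. A point of that cylinder outside \<open>E\<close> would be no further from
        \<open>p\<close> than \<open>q\<close> is, against isolation.\<close>
      have "E = cyl s' j p"
      proof (rule ccontr)
        assume "E \<noteq> cyl s' j p"
        then obtain w where w: "w \<in> cyl s' j p" "w \<notin> E" using j(1) by blast
        have "d' p w \<le> r' j" using X'.glue_D_in_cyl(2)[of p w j Z', OF True w(1)] by (simp add: d')
        then have "e * d' p w \<le> e * r' j" using e(1) by simp
        then have "r' j \<le> e * r' j" using iso[OF j(2) w(2)] q by simp
        then show False using mult_strict_right_mono[OF e(2) X'.r_gt[of j]] by simp
      qed
      then show ?thesis using True unfolding E_def p_def by blast
    next
      case False
      \<comment> \<open>Perfectness at radius \<open>2 * \<sigma> / \<rho>\<close> yields a point at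
        distance at least \<open>2 * \<sigma>\<close> from \<open>p\<close>, hence outside
        \<open>E\<close>. Isolation from it gives
        \<open>\<sigma> \<le> e * (2 * \<sigma> / \<rho>) = \<sigma> / 2\<close>.\<close>
      define \<sigma> where "\<sigma> = Sup (d' p ` E)"
      have bdd: "bdd_above (d' p ` E)" using small by (auto intro!: bdd_aboveI2)
      have le: "d' p q \<le> \<sigma>" if "q \<in> E" for q
        unfolding \<sigma>_def using that bdd by (intro cSup_upper) auto
      have "0 < d' p (F y)"
        using cantor_distD(5)[OF cd', of p "F y"] cantor_distD(7)[OF cd', of p "F y"] y(2)
        by (auto simp: order_less_le)
      then have pos: "0 < \<sigma>" using le[OF y(1)] by linarith
      have "\<sigma> \<le> e" unfolding \<sigma>_def using p small by (intro cSup_least) auto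
      then have "0 < 2 * \<sigma> / \<rho> \<and> 2 * \<sigma> / \<rho> < 1" using pos \<rho>(1) e(3) by (simp add: divide_simps)
      from \<rho>(3)[OF this, of "shift p"] obtain w' where w': "\<rho> * (2 * \<sigma> / \<rho>) \<le> Z' (shift p) w'" "Z' (shift p) w' \<le> 2 * \<sigma> / \<rho>"
        by (elim exE conjE)
      define w where "w = case_nat False w'"
      have pw: "d' p w = Z' (shift p) w'" using False by (simp add: d' w_def glue_def)
      have "2 * \<sigma> \<le> d' p w" using w'(1) \<rho>(1) pw by simp
      then have "w \<notin> E" using le[of w] pos by auto
      then have "d' p q \<le> e * (2 * \<sigma> / \<rho>)" if "q \<in> E" for q
        using order_trans[OF iso[OF that \<open>w \<notin> E\<close>]] mult_left_mono[OF w'(2), of e] e(1) pw by simp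
      then have "\<sigma> \<le> e * (2 * \<sigma> / \<rho>)" unfolding \<sigma>_def using p by (intro cSup_least) auto
      then show ?thesis using pos \<rho>(1) e(3) by (simp add: e_def)
    qed
  qed
  then show ?thesis by (rule that)
qed


text \<open>Connectedness by steps of length \<open>t\<close>, phrased with cuts instead of chains:
  a cut is easily pulled back along a bijection, and the uses below each need just one step across a
  particular cut.\<close>

definition step_connected :: "('b \<Rightarrow> 'b \<Rightarrow> real) \<Rightarrow> 'b set \<Rightarrow> real \<Rightarrow> bool" where
  "step_connected d E t \<longleftrightarrow> (\<forall>A. A \<subseteq> E \<and> A \<noteq> {} \<and> A \<noteq> E \<longrightarrow> (\<exists>u\<in>A. \<exists>v\<in>E - A. d u v \<le> t))"

lemma step_connectedD:
  assumes "step_connected d E t" "A \<subseteq> E" "a \<in> A" "b \<in> E" "b \<notin> A"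
  obtains u v where "u \<in> A" "v \<in> E" "v \<notin> A" "d u v \<le> t"
proof -
  have "A \<noteq> {}" "A \<noteq> E" using assms by auto
  then show ?thesis using assms(1,2) that unfolding step_connected_def by blast
qed

context lin_space
begin

lemma step_connected_same: "step_connected D {y. same k x y} (r k)"
  unfolding step_connected_def
proof (intro allI impI, rule ccontr)
  fix A assume A: "A \<subseteq> {y. same k x y} \<and> A \<noteq> {} \<and> A \<noteq> {y. same k x y}"
    and no: "\<not> (\<exists>u\<in>A. \<exists>v\<in>{y. same k x y} - A. D u v \<le> r k)"
  \<comment> \<open>Without a short step out of it, \<open>A\<close> is closed under changes of the
    later blocks and under changing the value of block \<open>k\<close> by 1. These moves reach the
    whole cylinder.\<close>
  have cl: "v \<in> A" if "u \<in> A" "same k x v" "D u v \<le> r k" for u v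
    using no that by blast
  have sv: "v \<in> A" if "u \<in> A" "same k x v" "V u k = V v k" for u v
  proof (rule cl[OF that(1,2)])
    have "same k x u" using A that(1) by blast
    then have "same (Suc k) u v"
      using same_blocks_trans[OF same_blocks_sym that(2)] that(3) by (simp add: same_blocks_Suc)
    then show "D u v \<le> r k" using D_same_Suc r_gt[of k] by fastforce
  qed
  define P where "P v \<longleftrightarrow> (\<exists>u\<in>A. V u k = v)" for v
  have move: "P v" if "P u" "v < 2 ^ s k" "u = Suc v \<or> v = Suc u" for u v
  proof -
    obtain a where a: "a \<in> A" "V a k = u" using \<open>P u\<close> by (auto simp: P_def)
    have "same k x (upd k v a)"
      using A a(1) same_blocks_trans[OF _ same_blocks_sym[OF same_blocks_upd], of s k x a v] by blast
    moreover have "D a (upd k v a) \<le> r k"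
      using D_upd[OF that(2), of a] a(2) that(3) by auto
    ultimately have "upd k v a \<in> A" using cl a(1) by blast
    then show ?thesis using V_upd_same[OF that(2), of a] by (auto simp: P_def)
  qed
  obtain a where a: "a \<in> A" using A by blast
  have up: "P v" if "V a k \<le> v" "v < 2 ^ s k" for v
    using that
  proof (induction v rule: dec_induct)
    case base
    then show ?case using a by (auto simp: P_def)
  next
    case (step n)
    then show ?case using move[of n "Suc n"] by simp
  qed
  have down: "P v" if "v \<le> V a k" for v
    using that
  proof (induction v rule: inc_induct)
    case base
    then show ?case using a by (auto simp: P_def)
  next
    case (step n)
    have "n < 2 ^ s k" using step(2) block_val_less[of s a k] by simp
    then show ?case using move[of "Suc n" n] step by simp
  qed
  have "y \<in> A" if "same k x y" for y
  proof -
    have "P (V y k)" using up down block_val_less[of s y k] by (meson nat_le_linear)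
    then show ?thesis using sv that by (auto simp: P_def)
  qed
  then show False using A by blast
qed

lemma step_connected_cyl:
  assumes "x 0"
  shows "step_connected (glue D Z) (cyl s k x) (r k)"
  unfolding step_connected_def
proof (intro allI impI)
  fix A assume A: "A \<subseteq> cyl s k x \<and> A \<noteq> {} \<and> A \<noteq> cyl s k x"
  obtain a b where ab: "a \<in> A" "b \<in> cyl s k x" "b \<notin> A" using A by blast
  have mem: "y 0 \<and> case_nat True (shift y) = y" if "y \<in> cyl s k x" for y
    using that case_nat_shift[of y] by (simp add: cyl_def)
  have nb: "shift b \<notin> shift ` A"
  proof
    assume "shift b \<in> shift ` A"
    then obtain c where "c \<in> A" "shift b = shift c" by blast
    then have "b = c" using mem[of b] mem[of c] ab A by (metis subsetD)
    then show False using ab(3) \<open>c \<in> A\<close> by simp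
  qed
  have sub: "shift ` A \<subseteq> {y. same k (shift x) y}" using A by (auto simp: cyl_def)
  have sb: "shift b \<in> {y. same k (shift x) y}" using ab by (auto simp: cyl_def)
  obtain u v where uv: "u \<in> shift ` A" "v \<in> {y. same k (shift x) y}" "v \<notin> shift ` A" "D u v \<le> r k"
    by (rule step_connectedD[OF step_connected_same sub imageI[OF ab(1)] sb nb])
  obtain c where c: "c \<in> A" "u = shift c" using uv(1) by blast
  have "case_nat True v \<in> cyl s k x - A"
    using uv(2,3) by (force simp: cyl_def)
  moreover have "glue D Z c (case_nat True v) \<le> r k"
    using uv(4) c mem[of c] A by (auto simp: glue_def)
  ultimately show "\<exists>u\<in>A. \<exists>v\<in>cyl s k x - A. glue D Z u v \<le> r k" using c(1) by blast
qed

text \<open>Moving block \<open>k\<close> by half its range shows that a cylinder extends, seen from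
  any of its points, over at least half its diameter bound.\<close>

lemma far_point:
  assumes "x 0" "u \<in> cyl s k x"
  obtains z where "z \<in> cyl s k x" "r k * 2 ^ s k \<le> 2 * glue D Z u z"
proof -
  obtain v where v: "v < 2 ^ s k" "\<bar>real (V (shift u) k) - real v\<bar> = real (2 ^ (s k - 1))"
    by (rule far_value[OF block_val_less[of s "shift u" k], of "2 ^ (s k - 1)"]) auto
  have half: "(2::real) ^ s k = 2 * 2 ^ (s k - 1)" using s_ge[of k] by (cases "s k") auto
  have "D (shift u) (upd k v (shift u)) = r k * 2 ^ (s k - 1)" using D_upd[OF v(1)] v(2) by simp
  moreover have "case_nat True (upd k v (shift u)) \<in> cyl s k x"
    using assms same_blocks_trans[OF _ same_blocks_sym[OF same_blocks_upd], of s k "shift x" "shift u" v]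
    by (simp add: cyl_def)
  ultimately show ?thesis
    using that[of "case_nat True (upd k v (shift u))"] half assms by (simp add: glue_def cyl_def)
qed

text \<open>A cylinder is connected through steps that are tiny compared to its diameter, hence so is its image.
  The image lies in a smallest cylinder, whose own steps are tiny as well; a step leaving
  the image would pull back to a tiny step leaving the original cylinder, which is isolated.\<close>

lemma connected_cylinder_image:
  assumes d': "d' = glue (block_space.D s' (\<lambda>a b. \<bar>real a - real b\<bar>) r') Z'"
    and X': "lin_space s' r'" and Z: "cantor_dist Z" and Z': "cantor_dist Z'" and ultra: "ultrametric Z'"
    and q: "qs (glue D Z) d' F"
    and big: "\<And>N. \<exists>K. \<forall>k\<ge>K. N \<le> s k"
  obtains K where "\<And>k x. k \<ge> K \<Longrightarrow> x 0 \<Longrightarrow> F x 0 \<and> (\<exists>j. F ` cyl s k x = cyl s' j (F x))"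
proof -
  interpret X': lin_space s' r' by (rule X')
  have cd: "cantor_dist (glue D Z)" by (rule cantor_dist_glue[OF cantor_D Z])
  have cd': "cantor_dist d'" unfolding d' by (rule cantor_dist_glue[OF X'.cantor_D Z'])
  have bij: "bij F" using q by (simp add: qs_def)
  have FF: "inv F (F x) = x" for x using bij by (simp add: bij_is_inj)
  obtain e0 where e0: "e0 > 0"
    "\<And>x y z. d' x y \<le> e0 * d' x z \<Longrightarrow> glue D Z (inv F x) (inv F y) \<le> 1 / 2 * glue D Z (inv F x) (inv F z)"
    using qs_small[OF qs_inverse[OF q cantor_distD(1)[OF cd] cantor_distD(1)[OF cd']], of "1 / 2"] by auto
  \<comment> \<open>\<open>4 * e < 1\<close> keeps the step size \<open>2 * e * \<sigma>\<close>
    below \<open>\<sigma> / 2\<close>. \<open>8 * e \<le> e0\<close> makes such a step at most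
    \<open>e0\<close> times the distance \<open>\<sigma> / 4\<close> to a far point of the
    image.\<close>
  define e where "e = min (e0 / 8) (1 / 8)"
  have e: "0 < e" "e < 1" "4 * e < 1" "8 * e \<le> e0" using e0(1) by (auto simp: e_def)
  obtain t where t: "t > 0" "\<And>x y z. glue D Z x y \<le> t * glue D Z x z \<Longrightarrow> d' (F x) (F y) \<le> e * d' (F x) (F z)"
    using qs_small[OF q e(1)] by metis
  \<comment> \<open>From \<open>K1\<close> on cylinders are small compared with the distance 1 to
    the other half; from \<open>K2\<close> on a step \<open>r k\<close> is at most \<open>t\<close>
    times half of the length \<open>r k * 2 ^ s k\<close>.\<close>
  obtain K1 where K1: "\<And>k. k \<ge> K1 \<Longrightarrow> r k * 2 ^ s k \<le> t" using R_ev_le[OF t(1)] by blast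
  obtain N :: nat where N: "2 / t < real N" using reals_Archimedean2 by blast
  obtain K2 where K2: "\<And>k. k \<ge> K2 \<Longrightarrow> N \<le> s k" using big by blast
  have "F x 0 \<and> (\<exists>j. F ` cyl s k x = cyl s' j (F x))" if k: "k \<ge> Suc (max K1 K2)" and x: "x 0" for k x
  proof -
    define E where "E = F ` cyl s k x"
    define p where "p = F x"
    have p: "p \<in> E" using cyl_self[of x, OF x] by (simp add: E_def p_def)
    have k12: "K1 \<le> k" "K2 \<le> k" using k by auto
    have "real N < 2 ^ s k"
      using of_nat_mono[OF K2[OF k12(2)], where 'a = real] of_nat_less_two_power[of "s k", where 'a = real]
      by linarith
    then have tk: "2 \<le> t * 2 ^ s k" using N t(1) by (smt (verit) divide_less_eq mult.commute mult_left_mono)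
    have small: "d' p q \<le> e" if "q \<in> E" for q
    proof -
      obtain y where y: "y \<in> cyl s k x" "q = F y" using \<open>q \<in> E\<close> by (auto simp: E_def)
      have "glue D Z x y \<le> t" using glue_D_in_cyl(2)[of x y k Z, OF x y(1)] K1[OF k12(1)] by simp
      then have "glue D Z x y \<le> t * glue D Z x (\<lambda>_. False)" using x by (simp add: glue_def)
      from t(2)[OF this] have "d' p q \<le> e * d' p (F (\<lambda>_. False))" by (simp add: y(2) p_def)
      also have "\<dots> \<le> e * 1" using cantor_distD(2)[OF cd'] e(1) by (intro mult_left_mono) auto
      finally show ?thesis by simp
    qed
    have part: "q 0 = p 0" if "q \<in> E" for q
      using small[OF that] e(2) unfolding d' by (auto simp: glue_def split: if_splits)
    have "cyl s (Suc k) x \<subseteq> cyl s k x" "cyl s (Suc k) x \<noteq> cyl s k x"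
      using cyl_mono[of k "Suc k"] cyl_Suc_neq[of s k x, OF s_ge] by auto
    then have "\<exists>y. y \<in> cyl s k x \<and> y \<noteq> x" using cyl_self[of x, OF x] by blast
    then obtain y where "y \<in> cyl s k x" "y \<noteq> x" by blast
    then have y: "F y \<in> E" "F y \<noteq> p"
      using bij by (auto simp: E_def p_def bij_is_inj inj_eq)
    have ne: "E \<noteq> {p}" using y by blast
    define \<sigma> where "\<sigma> = Sup (d' p ` E)"
    have bdd: "bdd_above (d' p ` E)" using small by (auto intro!: bdd_aboveI2)
    have le: "d' p q \<le> \<sigma>" if "q \<in> E" for q
      unfolding \<sigma>_def using that bdd by (intro cSup_upper) auto
    have "0 < d' p (F y)"
      using cantor_distD(5)[OF cd', of p "F y"] cantor_distD(7)[OF cd', of p "F y"] y(2)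
      by (auto simp: order_less_le)
    then have pos: "0 < \<sigma>" using le[OF y(1)] by linarith
    have "\<exists>q\<in>E. \<sigma> / 2 < d' p q"
      using less_cSup_iff[of "d' p ` E" "\<sigma> / 2"] p bdd pos unfolding \<sigma>_def[symmetric] by auto
    then obtain q1 where q1: "q1 \<in> E" "\<sigma> / 2 < d' p q1" by blast
    have diam: "d' u v \<le> 2 * \<sigma>" if "u \<in> E" "v \<in> E" for u v
      using cantor_distD(8)[OF cd', of u v p] cantor_distD(6)[OF cd', of u p] le[OF that(1)] le[OF that(2)] by linarith
    have far: "\<exists>q\<in>E. \<sigma> / 4 \<le> d' u q" for u
    proof (cases "\<sigma> / 4 \<le> d' u p")
      case False
      then have "\<sigma> / 4 \<le> d' u q1"
        using cantor_distD(8)[OF cd', of p q1 u] cantor_distD(6)[OF cd', of u p] q1(2) by linarith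
      then show ?thesis using q1(1) by blast
    qed (use p in blast)
    have conn: "step_connected d' E (2 * e * \<sigma>)"
      unfolding step_connected_def
    proof (intro allI impI)
      fix A assume A: "A \<subseteq> E \<and> A \<noteq> {} \<and> A \<noteq> E"
      \<comment> \<open>The cut is pulled back and crossed by a step of length at most
        \<open>r k\<close>. Relative to a far point \<open>z\<close> of the cylinder this step has
        ratio at most \<open>t\<close>, so its image is at most \<open>e\<close> times a distance
        inside \<open>E\<close>.\<close>
      define B where "B = {y \<in> cyl s k x. F y \<in> A}"
      have FB: "F ` B = A" using A unfolding B_def E_def by blast
      have Bs: "B \<subseteq> cyl s k x" by (auto simp: B_def)
      obtain a b where ab: "a \<in> B" "b \<in> cyl s k x" "b \<notin> B" using A FB unfolding B_def E_def by blast
      obtain u v where uv: "u \<in> B" "v \<in> cyl s k x" "v \<notin> B" "glue D Z u v \<le> r k"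
        by (rule step_connectedD[OF step_connected_cyl[of x Z k, OF x] Bs ab])
      have u: "u \<in> cyl s k x" using uv(1) by (simp add: B_def)
      obtain z where z: "z \<in> cyl s k x" "r k * 2 ^ s k \<le> 2 * glue D Z u z" by (rule far_point[of x u k Z, OF x u])
      have "2 * r k \<le> t * 2 ^ s k * r k" using tk r_gt[of k] by (intro mult_right_mono) auto
      also have "\<dots> \<le> t * (2 * glue D Z u z)" using z(2) t(1) by (simp add: mult.commute)
      finally have "glue D Z u v \<le> t * glue D Z u z" using uv(4) by simp
      from t(2)[OF this] have "d' (F u) (F v) \<le> e * d' (F u) (F z)" .
      also have "\<dots> \<le> e * (2 * \<sigma>)" using diam[of "F u" "F z"] u z(1) e(1) by (intro mult_left_mono) (auto simp: E_def)
      finally have "d' (F u) (F v) \<le> 2 * e * \<sigma>" by simp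
      moreover have "F u \<in> A" "F v \<in> E - A" using uv(1,2,3) by (auto simp: B_def E_def)
      ultimately show "\<exists>u\<in>A. \<exists>v\<in>E - A. d' u v \<le> 2 * e * \<sigma>" by blast
    qed
    have e\<sigma>: "2 * e * \<sigma> < \<sigma> / 2" using e(3) pos mult_strict_right_mono[OF e(3) pos] by simp
    show ?thesis
    proof (cases "p 0")
      case True
      obtain j q where j: "E \<subseteq> cyl s' j p" "q \<in> E" "X'.V (shift p) j \<noteq> X'.V (shift q) j"
        by (rule X'.first_level[of E p]) (use part True p ne in auto)
      \<comment> \<open>The cut separates the child containing \<open>p\<close> from the rest of
        \<open>E\<close>. Crossing it takes at least \<open>r' j\<close>, so the natural step of the
        target cylinder is at most \<open>2 * e * \<sigma>\<close>.\<close>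
      obtain u v where uv: "u \<in> {u \<in> E. X'.V (shift p) j = X'.V (shift u) j}" "v \<in> E"
          "v \<notin> {u \<in> E. X'.V (shift p) j = X'.V (shift u) j}" "d' u v \<le> 2 * e * \<sigma>"
        by (rule step_connectedD[OF conn, of "{u \<in> E. X'.V (shift p) j = X'.V (shift u) j}" p q])
           (use p j in auto)
      have "r' j \<le> X'.D (shift u) (shift v)"
        using uv(1,2,3) by (intro X'.D_ge) (auto simp: same_blocks_Suc)
      also have "\<dots> = d' u v" using part[of u] part[of v] uv(1,2) True by (auto simp: d' glue_def)
      finally have r': "r' j \<le> 2 * e * \<sigma>" using uv(4) by simp
      have "E = cyl s' j p"
      proof (rule ccontr)
        assume "E \<noteq> cyl s' j p"
        then obtain w0 where w0: "w0 \<in> cyl s' j p" "w0 \<notin> E" using j(1) by blast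
        \<comment> \<open>A natural step of the target cylinder that leaves \<open>E\<close>. Pulled
          back, it is at most half of a distance inside \<open>cyl s k x\<close>, hence at most
          \<open>r l / 4\<close> with \<open>k = Suc l\<close>, whereas leaving that cylinder costs
          at least \<open>r l\<close>.\<close>
        obtain u w where uw: "u \<in> E" "w \<in> cyl s' j p" "w \<notin> E" "d' u w \<le> r' j"
          unfolding d' by (rule step_connectedD[OF X'.step_connected_cyl[of p Z' j, OF True] j(1) p w0])
        obtain q2 where q2: "q2 \<in> E" "\<sigma> / 4 \<le> d' u q2" using far by blast
        have "d' u w \<le> 8 * e * (\<sigma> / 4)" using uw(4) r' by (simp add: mult.commute mult.left_commute)
        also have "\<dots> \<le> e0 * d' u q2"
          using q2(2) e pos by (intro mult_mono) auto
        finally have *: "glue D Z (inv F u) (inv F w) \<le> 1 / 2 * glue D Z (inv F u) (inv F q2)" by (rule e0(2))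
        have iu: "inv F u \<in> cyl s k x" "inv F q2 \<in> cyl s k x"
          using uw(1) q2(1) by (auto simp: E_def FF)
        have "F (inv F w) = w" using bij by (simp add: bij_is_surj surj_f_inv_f)
        then have iw: "inv F w \<notin> cyl s k x" using uw(3) unfolding E_def by (metis imageI)
        obtain l where l: "k = Suc l" using k by (cases k) auto
        have cu: "cyl s k (inv F u) = cyl s k x" by (rule cyl_eq[OF iu(1)])
        have u0: "inv F u 0" using cyl_True[OF iu(1)] .
        have "r l \<le> glue D Z (inv F u) (inv F w)"
          by (rule glue_D_not_in_cyl[of "inv F u", OF u0]) (use iw cu l in simp)
        also have "\<dots> \<le> 1 / 2 * glue D Z (inv F u) (inv F q2)" by (rule *)
        also have "\<dots> \<le> 1 / 2 * (r k * 2 ^ s k)"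
          using glue_D_in_cyl(2)[of "inv F u" "inv F q2" k Z, OF u0] iu(2) cu by simp
        also have "\<dots> = r l / 4" using r_Suc[of l] l by simp
        finally show False using r_gt[of l] by simp
      qed
      then show ?thesis using True unfolding E_def p_def by blast
    next
      case False
      have dZ: "d' u v = Z' (shift u) (shift v)" if "u \<in> E" "v \<in> E" for u v
        using part[OF that(1)] part[OF that(2)] False by (simp add: d' glue_def)
      have ult: "d' u w \<le> max (d' u v) (d' v w)" if "u \<in> E" "v \<in> E" "w \<in> E" for u v w
        using ultra that unfolding ultrametric_def dZ[OF that(1,2)] dZ[OF that(1,3)] dZ[OF that(2,3)] by blast
      \<comment> \<open>In an ultrametric, steps of length \<open>2 * e * \<sigma>\<close> never
        leave the ball of that radius; but \<open>q1\<close> lies in \<open>E\<close> outside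
        it.\<close>
      define A where "A = {q \<in> E. d' p q \<le> 2 * e * \<sigma>}"
      have "d' p p = 0" using cantor_distD(7)[OF cd', of p p] by simp
      then have "p \<in> A" using p e(1) pos by (simp add: A_def)
      moreover have "q1 \<notin> A" using q1(2) e\<sigma> by (simp add: A_def)
      moreover have "A \<subseteq> E" by (auto simp: A_def)
      ultimately obtain u v where uv: "u \<in> A" "v \<in> E" "v \<notin> A" "d' u v \<le> 2 * e * \<sigma>"
        using step_connectedD[OF conn, of A p q1] q1(1) by metis
      then have "d' p v \<le> 2 * e * \<sigma>" using ult[OF p, of u v] unfolding A_def by auto
      then show ?thesis using uv by (simp add: A_def)
    qed
  qed
  then show ?thesis by (rule that)
qed

end

section \<open>Coding sets of naturals by large blocks\<close>

text \<open>The exponent encodes the index together with the part of \<open>A\<close> up to it, so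
  different sets share only finitely many marks. Taking powers of 2 spreads the marks out, which
  makes them insensitive to shifts and bounded errors.\<close>

definition mark :: "nat set \<Rightarrow> nat \<Rightarrow> nat" where
  "mark A n = 2 ^ prod_encode (n, set_encode (A \<inter> {..n}))"

definition marks :: "nat set \<Rightarrow> nat set" where
  "marks A = range (mark A)"

lemma mark_ge: "n \<le> mark A n"
proof -
  have "n \<le> prod_encode (n, set_encode (A \<inter> {..n}))" by (rule le_prod_encode_1)
  also have "\<dots> \<le> mark A n" unfolding mark_def using less_exp less_imp_le by blast
  finally show ?thesis .
qed

lemma marks_unbounded: "\<exists>k\<ge>K. k \<in> marks A"
  using mark_ge[of K A] unfolding marks_def by blast

lemma mark_eqD:
  assumes "mark A n = mark B m"
  shows "n = m" "A \<inter> {..n} = B \<inter> {..n}"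
proof -
  have "prod_encode (n, set_encode (A \<inter> {..n})) = prod_encode (m, set_encode (B \<inter> {..m}))"
    using assms by (simp add: mark_def del: prod_encode_eq)
  then have eq: "n = m \<and> set_encode (A \<inter> {..n}) = set_encode (B \<inter> {..m})"
    unfolding prod_encode_eq prod.inject .
  then show "n = m" ..
  have "set_encode (A \<inter> {..n}) = set_encode (B \<inter> {..n})"
    using conjunct2[OF eq] unfolding conjunct1[OF eq] .
  then show "A \<inter> {..n} = B \<inter> {..n}" by (simp add: set_encode_eq)
qed

lemma marks_infinitely_common:
  assumes "\<And>K. \<exists>k\<ge>K. k \<in> marks A \<and> k \<in> marks B"
  shows "A = B"
proof (rule set_eqI)
  fix e
  \<comment> \<open>A mark beyond all those of index below \<open>e\<close> has index at least
    \<open>e\<close> and so records whether \<open>e\<close> belongs to the set.\<close>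
  define K where "K = Suc (\<Sum>n<e. mark A n)"
  obtain k where k: "k \<ge> K" "k \<in> marks A" "k \<in> marks B" using assms by blast
  obtain n where n: "k = mark A n" using k(2) by (auto simp: marks_def)
  obtain m where m: "k = mark B m" using k(3) by (auto simp: marks_def)
  have "e \<le> n"
  proof (rule ccontr)
    assume "\<not> e \<le> n"
    then have "mark A n \<le> (\<Sum>n<e. mark A n)" by (intro member_le_sum) auto
    then show False using k(1) n by (simp add: K_def)
  qed
  moreover have "A \<inter> {..n} = B \<inter> {..n}" using mark_eqD(2)[of A n B m] n m by simp
  ultimately show "e \<in> A \<longleftrightarrow> e \<in> B" by (metis IntD1 IntI atMost_iff)
qed

lemma marks_sparse:
  assumes "k \<in> marks A" "l \<in> marks B" "k < l"
  shows "2 * k \<le> l"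
proof -
  obtain a b where ab: "k = 2 ^ a" "l = 2 ^ b" using assms by (auto simp: marks_def mark_def)
  then have "a < b" using assms(3) by simp
  then have "2 ^ Suc a \<le> (2::nat) ^ b" by (intro power_increasing) auto
  then show ?thesis using ab by simp
qed

lemma marks_shift:
  assumes "\<And>n. a + n \<in> marks A \<longleftrightarrow> b + n \<in> marks B"
  shows "A = B"
proof -
  \<comment> \<open>If \<open>a \<noteq> b\<close>, then \<open>k\<close> and its shift are distinct
    marks less than a factor 2 apart, for \<open>k\<close> this large.\<close>
  obtain k where k: "k \<ge> 2 * (a + b) + 1" "k \<in> marks A" using marks_unbounded by blast
  have kb: "b + (k - a) \<in> marks B" using assms[of "k - a"] k by simp
  have "a = b"
  proof (rule ccontr)
    assume "a \<noteq> b"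
    then have "k < b + (k - a) \<or> b + (k - a) < k" using k(1) by arith
    then consider "k < b + (k - a)" | "b + (k - a) < k" by blast
    then show False
    proof cases
      case 1
      then have "2 * k \<le> b + (k - a)" by (rule marks_sparse[OF k(2) kb])
      then show False using k(1) by simp
    next
      case 2
      then have "2 * (b + (k - a)) \<le> k" by (rule marks_sparse[OF kb k(2)])
      then show False using k(1) by simp
    qed
  qed
  have "\<exists>k\<ge>K. k \<in> marks A \<and> k \<in> marks B" for K
  proof -
    obtain l where l: "l \<ge> K + a" "l \<in> marks A" using marks_unbounded by blast
    then have "l \<in> marks B" using assms[of "l - a"] \<open>a = b\<close> by simp
    then show ?thesis using l by (intro exI[of _ l]) simp
  qed
  then show ?thesis by (rule marks_infinitely_common)
qed

text \<open>Factorials make one marked block larger than any fixed number of blocks marked below it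
  taken together. The scales remain powers of 1/2, which keeps the space uniformly perfect.\<close>

definition fat_sizes :: "nat set \<Rightarrow> nat \<Rightarrow> nat" where
  "fat_sizes A k = (if k \<in> marks A then fact k else 1)"

definition fat_dist :: "nat set \<Rightarrow> bits \<Rightarrow> bits \<Rightarrow> real" where
  "fat_dist A = block_space.D (fat_sizes A) (\<lambda>a b. of_bool (a \<noteq> b)) (\<lambda>k. (1 / 2) ^ k)"

lemma fat_space: "ultra_space (fat_sizes A) (\<lambda>k. (1 / 2) ^ k)"
proof
  show "(\<lambda>k. (1 / 2 :: real) ^ k) \<longlonglongrightarrow> 0" by (rule LIMSEQ_realpow_zero) auto
qed (auto simp: fat_sizes_def)

lemma fat_dist_values:
  assumes "x \<noteq> y"
  obtains j where "fat_dist A x y = (1 / 2) ^ j"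
proof -
  interpret ultra_space "fat_sizes A" "\<lambda>k. (1 / 2) ^ k" by (rule fat_space)
  show ?thesis
    using assms that D_ultra unfolding fat_dist_def
    by (cases rule: cases_eq[of x y]) (auto simp: same_blocks_Suc)
qed

lemma fat_dist_realized: obtains y where "fat_dist A x y = (1 / 2) ^ k"
proof -
  interpret ultra_space "fat_sizes A" "\<lambda>k. (1 / 2) ^ k" by (rule fat_space)
  define v where "v = (if V x k = 0 then 1 else 0 :: nat)"
  have "v < 2 ^ fat_sizes A k" "V x k \<noteq> v"
    using one_less_power[of "2::nat" "fat_sizes A k"] s_ge[of k] by (auto simp: v_def)
  then show ?thesis
    using D_upd[of v k x] by (intro that[of "upd k v x"]) (simp add: fat_dist_def)
qed

lemma cantor_fat_dist: "cantor_dist (fat_dist A)"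
proof -
  interpret ultra_space "fat_sizes A" "\<lambda>k. (1 / 2) ^ k" by (rule fat_space)
  show ?thesis unfolding fat_dist_def by (rule cantor_D)
qed

text \<open>The block of size \<open>fact k\<close> gives \<open>2 ^ fact k\<close> points at mutual distance \<open>2 ^ -k\<close>. Their images have
  comparable mutual distances, so they are told apart by a bounded number of consecutive blocks,
  one of which therefore has size more than \<open>fact (k - 1)\<close>.\<close>

lemma fat_block_image:
  assumes q: "qs (fat_dist A) (fat_dist B) F"
  shows "\<exists>h K. \<forall>k x y j. k \<ge> K \<longrightarrow> k \<in> marks A \<longrightarrow> fat_dist A x y = (1 / 2) ^ k \<longrightarrow>
    fat_dist B (F x) (F y) = (1 / 2) ^ j \<longrightarrow> (\<exists>i\<ge>k. i \<in> marks B \<and> i \<le> j + h)"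
proof -
  interpret X: ultra_space "fat_sizes A" "\<lambda>k. (1 / 2) ^ k" by (rule fat_space)
  interpret Y: ultra_space "fat_sizes B" "\<lambda>k. (1 / 2) ^ k" by (rule fat_space)
  note dA = fat_dist_def[of A] and dB = fat_dist_def[of B]
  obtain H where H: "H > 0" "\<And>x y z. X.D x y \<le> 1 * X.D x z \<Longrightarrow> Y.D (F x) (F y) \<le> H * Y.D (F x) (F z)"
    using qs_bounded[OF q, of 1] unfolding dA dB by auto
  \<comment> \<open>Rounding the distortion up to a power of 2 turns it into a displacement by
    \<open>h\<close> levels.\<close>
  obtain h where h: "H < 2 ^ h" using real_arch_pow[of 2 H] by auto
  have Yn: "0 \<le> Y.D u v" for u v by (rule cantor_distD(5)[OF Y.cantor_D])
  have cmp: "Y.D (F x) (F y) \<le> 2 ^ h * Y.D (F x) (F z)" if "X.D x y \<le> X.D x z" for x y z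
    using H(2)[of x y z] that mult_right_mono[OF less_imp_le[OF h] Yn[of "F x" "F z"]] by simp
  show ?thesis
  proof (rule exI[of _ "2 * h"], rule exI[of _ "3 * h + 2"], intro allI impI)
    fix k x y j assume k: "3 * h + 2 \<le> k" "k \<in> marks A"
      and xy: "fat_dist A x y = (1 / 2) ^ k" and Fxy: "fat_dist B (F x) (F y) = (1 / 2) ^ j"
    define p where "p v = X.upd k v x" for v
    have pp: "X.D (p u) (p v) = (1 / 2) ^ k" if "u < 2 ^ fat_sizes A k" "v < 2 ^ fat_sizes A k" "u \<noteq> v" for u v
      using X.D_upd_upd[OF that(1,2), of x] that(3) by (simp add: p_def)
    have xp: "X.D x (p v) = (if x = p v then 0 else (1 / 2) ^ k)" if "v < 2 ^ fat_sizes A k" for v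
    proof (cases "x = p v")
      case False
      then have "X.D x (p v) \<noteq> 0" using cantor_distD(7)[OF X.cantor_D] by simp
      then show ?thesis using X.D_upd[OF that, of x] False by (auto simp: p_def split: if_splits)
    qed simp
    have xy': "X.D x y = (1 / 2) ^ k" and Fxy': "Y.D (F x) (F y) = (1 / 2) ^ j"
      using xy Fxy by (simp_all add: dA dB)
    \<comment> \<open>All images are within \<open>2 ^ h * (1 / 2) ^ j\<close> of
      \<open>F x\<close>, so they share their first \<open>j - h\<close> blocks. For
      \<open>j < h\<close> the truncated difference is 0 and nothing is claimed.\<close>
    define m where "m = j - h"
    have near: "Y.same m (F x) (F (p v))" if v: "v < 2 ^ fat_sizes A k" for v
    proof (cases "j < h")
      case True
      then show ?thesis by (simp add: m_def)
    next
      case False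
      have "Y.D (F x) (F (p v)) \<le> 2 ^ h * (1 / 2) ^ j"
        using cmp[of x "p v" y] xp[OF v] xy' Fxy' by simp
      also have "\<dots> = (1 / 2) ^ m" using False by (simp add: m_def power_diff power_one_over)
      finally have le: "Y.D (F x) (F (p v)) \<le> (1 / 2) ^ m" .
      show ?thesis
      proof (cases m)
        case (Suc l)
        have "(1 / 2 :: real) ^ m < (1 / 2) ^ l" using Suc by simp
        with le have "Y.D (F x) (F (p v)) < (1 / 2) ^ l" by (rule order.strict_trans1)
        then show ?thesis unfolding Suc by (rule Y.D_less_same)
      qed simp
    qed
    \<comment> \<open>Comparing the images with \<open>F x\<close>, and \<open>F x\<close> with
      \<open>F y\<close>, costs a factor \<open>2 ^ h\<close> each time. So two images are at least
      \<open>(1 / 2) ^ (j + 2 * h)\<close> apart and differ by block \<open>j + 2 * h\<close> at the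
      latest.\<close>
    have apart: "\<not> Y.same (Suc (j + 2 * h)) (F (p u)) (F (p v))"
      if uv: "u < 2 ^ fat_sizes A k" "v < 2 ^ fat_sizes A k" "u \<noteq> v" for u v
    proof
      assume "Y.same (Suc (j + 2 * h)) (F (p u)) (F (p v))"
      then have le: "Y.D (F (p u)) (F (p v)) \<le> (1 / 2) ^ Suc (j + 2 * h)" by (rule Y.D_le)
      have pu: "Y.D (F x) (F y) \<le> 2 ^ h * Y.D (F x) (F (p w))" if "w < 2 ^ fat_sizes A k" "x \<noteq> p w" for w
        using cmp[of x y "p w"] xp[OF that(1)] xy' that(2) by simp
      have one: "(1::real) \<le> 2 ^ h" by simp
      have "(1 / 2) ^ j \<le> 2 ^ h * (2 ^ h * Y.D (F (p u)) (F (p v)))"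
      proof (cases "x = p u")
        case True
        then have "x \<noteq> p v" using pp[OF uv] X.r_gt[of k] by auto
        then have "(1 / 2) ^ j \<le> 2 ^ h * Y.D (F (p u)) (F (p v))" using pu[OF uv(2)] Fxy' True by simp
        also have "\<dots> \<le> 2 ^ h * (2 ^ h * Y.D (F (p u)) (F (p v)))"
          using mult_right_mono[OF one Yn[of "F (p u)" "F (p v)"]] by (intro mult_left_mono) auto
        finally show ?thesis .
      next
        case False
        have "X.D (p u) x \<le> X.D (p u) (p v)"
          using xp[OF uv(1)] pp[OF uv] cantor_distD(6)[OF X.cantor_D, of "p u" x] False by simp
        then have "Y.D (F x) (F (p u)) \<le> 2 ^ h * Y.D (F (p u)) (F (p v))"
          using cmp[of "p u" x "p v"] cantor_distD(6)[OF Y.cantor_D, of "F (p u)" "F x"] by simp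
        then have "2 ^ h * Y.D (F x) (F (p u)) \<le> 2 ^ h * (2 ^ h * Y.D (F (p u)) (F (p v)))"
          by (intro mult_left_mono) auto
        then show ?thesis unfolding Fxy'[symmetric] by (rule order_trans[OF pu[OF uv(1) False]])
      qed
      also have "\<dots> \<le> 2 ^ h * (2 ^ h * (1 / 2) ^ Suc (j + 2 * h))"
        using le by (intro mult_left_mono) auto
      also have "\<dots> = (1 / 2) ^ j / 2"
      proof -
        have "a * (a * (1 / 2 * (b * (c * c)))) = b / 2" if "a * c = 1" for a b c :: real
        proof -
          have "a * (a * (1 / 2 * (b * (c * c)))) = (a * c) * (a * c) * b / 2" by (simp add: algebra_simps)
          then show ?thesis using that by simp
        qed
        moreover have "2 ^ h * (1 / 2) ^ h = (1 :: real)" by (simp flip: power_mult_distrib)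
        ultimately show ?thesis unfolding power_Suc power_add mult_2 by blast
      qed
      finally have "(1 / 2 :: real) ^ j \<le> (1 / 2) ^ j / 2" .
      moreover have "(1 / 2 :: real) ^ j > 0" by simp
      ultimately show False by linarith
    qed
    define I where "I = {m..<Suc (j + 2 * h)}"
    \<comment> \<open>The blocks in \<open>I\<close> alone distinguish all
      \<open>2 ^ fat_sizes A k\<close> images, so their sizes must add up to at least
      \<open>fact k\<close>.\<close>
    define g where "g v = restrict (\<lambda>i. Y.V (F (p v)) i) I" for v
    have fin: "finite I" by (simp add: I_def)
    have "inj_on g {..<2 ^ fat_sizes A k}"
    proof (rule inj_onI, rule ccontr)
      fix u v assume uv: "u \<in> {..<2 ^ fat_sizes A k}" "v \<in> {..<2 ^ fat_sizes A k}" "g u = g v" "u \<noteq> v"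
      have "Y.same m (F (p u)) (F (p v))"
        using near[of u] near[of v] uv same_blocks_sym same_blocks_trans by blast
      moreover have "Y.V (F (p u)) i = Y.V (F (p v)) i" if "i \<in> I" for i
        using fun_cong[OF uv(3), of i] that by (simp add: g_def)
      ultimately have "Y.same (Suc (j + 2 * h)) (F (p u)) (F (p v))"
        unfolding same_blocks_def I_def by (meson atLeastLessThan_iff not_le)
      then show False using apart uv by blast
    qed
    moreover have "g ` {..<2 ^ fat_sizes A k} \<subseteq> (\<Pi>\<^sub>E i\<in>I. {..<2 ^ fat_sizes B i})"
      using block_val_less by (auto simp: g_def)
    ultimately have "card {..<(2::nat) ^ fat_sizes A k} \<le> card (\<Pi>\<^sub>E i\<in>I. {..<(2::nat) ^ fat_sizes B i})"
      by (intro card_inj_on_le) (auto simp: fin intro!: finite_PiE)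
    also have "\<dots> = 2 ^ (\<Sum>i\<in>I. fat_sizes B i)"
      by (simp add: card_PiE fin power_sum)
    finally have "fat_sizes A k \<le> (\<Sum>i\<in>I. fat_sizes B i)" by simp
    then have le: "fact k \<le> (\<Sum>i\<in>I. fat_sizes B i)" using k(2) by (simp add: fat_sizes_def)
    show "\<exists>i\<ge>k. i \<in> marks B \<and> i \<le> j + 2 * h"
    proof (rule ccontr)
      assume no: "\<not> ?thesis"
      \<comment> \<open>Without the desired mark, marked blocks in \<open>I\<close> have index below
        \<open>k\<close>. At most \<open>3 * h + 1\<close> blocks of this size cannot reach
        \<open>fact k = k * fact (k - 1)\<close>, because \<open>k \<ge> 3 * h + 2\<close>.\<close>
      have "fat_sizes B i \<le> fact (k - 1)" if "i \<in> I" for i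
      proof (cases "i \<in> marks B")
        case True
        then have "i < k" using no that by (auto simp: I_def not_less)
        then show ?thesis using True by (simp add: fat_sizes_def fact_mono)
      qed (simp add: fat_sizes_def)
      then have "(\<Sum>i\<in>I. fat_sizes B i) \<le> card I * fact (k - 1)"
        using sum_bounded_above[of I "fat_sizes B" "fact (k - 1)"] by simp
      moreover have "card I \<le> 3 * h + 1" by (simp add: I_def m_def)
      ultimately have "fact k \<le> (3 * h + 1) * fact (k - 1)"
        using le by (meson le_trans mult_le_mono1)
      moreover have "fact k = k * (fact (k - 1) :: nat)" using k(1) by (simp add: fact_reduce)
      ultimately have "k * fact (k - 1) \<le> (3 * h + 1) * (fact (k - 1) :: nat)" by argo
      then have "k \<le> 3 * h + 1" unfolding mult_le_cancel2 by simp
      then show False using k(1) by simp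
    qed
  qed
qed

text \<open>A mark \<open>k\<close> of \<open>A\<close> leads to a mark \<open>i \<ge> k\<close> of
  \<open>B\<close>, and the inverse map leads on to a mark \<open>i' \<ge> i\<close> of
  \<open>A\<close>. The round trip moves the level up by a bounded amount only, so sparsity forces
  \<open>i' = k\<close>, and \<open>k\<close> is a common mark.\<close>

lemma fat_dist_rigid:
  assumes q: "qs (fat_dist A) (fat_dist B) F"
  shows "A = B"
proof (rule marks_infinitely_common)
  fix K
  have bij: "bij F" using q by (simp add: qs_def)
  have FF: "inv F (F x) = x" "F (inv F y) = y" for x y
    using bij by (simp_all add: bij_is_inj bij_is_surj surj_f_inv_f)
  have qi: "qs (fat_dist B) (fat_dist A) (inv F)"
    by (rule qs_inverse[OF q cantor_distD(1) cantor_distD(1)]) (rule cantor_fat_dist)+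
  obtain h K1 where 1: "\<forall>k x y j. k \<ge> K1 \<longrightarrow> k \<in> marks A \<longrightarrow> fat_dist A x y = (1 / 2) ^ k \<longrightarrow>
    fat_dist B (F x) (F y) = (1 / 2) ^ j \<longrightarrow> (\<exists>i\<ge>k. i \<in> marks B \<and> i \<le> j + h)"
    using fat_block_image[OF q] by (elim exE)
  obtain h' K2 where 2: "\<forall>k x y j. k \<ge> K2 \<longrightarrow> k \<in> marks B \<longrightarrow> fat_dist B x y = (1 / 2) ^ k \<longrightarrow>
    fat_dist A (inv F x) (inv F y) = (1 / 2) ^ j \<longrightarrow> (\<exists>i\<ge>k. i \<in> marks A \<and> i \<le> j + h')"
    using fat_block_image[OF qi] by (elim exE)
  obtain H where H: "H > 0" "\<And>x y z. fat_dist B x y \<le> 2 ^ h * fat_dist B x z \<Longrightarrow>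
      fat_dist A (inv F x) (inv F y) \<le> H * fat_dist A (inv F x) (inv F z)"
  proof (rule qs_bounded[OF qi, of "2 ^ h"])
    show "(0::real) < 2 ^ h" by simp
  qed (rule that)
  obtain c where c: "H < 2 ^ c" using real_arch_pow[of 2 H] by auto
  obtain k where k: "k \<ge> K + K1 + K2 + c + h' + 1" "k \<in> marks A" using marks_unbounded by blast
  define x :: bits where "x = (\<lambda>_. True)"
  obtain y where y: "fat_dist A x y = (1 / 2) ^ k" by (rule fat_dist_realized)
  then have "x \<noteq> y" using cantor_distD(7)[OF cantor_fat_dist, of A x y] by auto
  then have "F x \<noteq> F y" using bij by (simp add: bij_is_inj inj_eq)
  then obtain j where j: "fat_dist B (F x) (F y) = (1 / 2) ^ j" by (rule fat_dist_values)
  obtain i where i: "i \<ge> k" "i \<in> marks B" "i \<le> j + h" using 1[rule_format, OF _ k(2) y j] k(1) by auto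
  \<comment> \<open>A companion of \<open>F x\<close> at the scale of the marked block
    \<open>i\<close>, to which the inverse map is applied next.\<close>
  obtain w where w: "fat_dist B (F x) w = (1 / 2) ^ i" by (rule fat_dist_realized)
  then have "F x \<noteq> w" using cantor_distD(7)[OF cantor_fat_dist, of B "F x" w] by auto
  then have "x \<noteq> inv F w" by (metis FF(2))
  then obtain j' where j': "fat_dist A x (inv F w) = (1 / 2) ^ j'" by (rule fat_dist_values)
  obtain i' where i': "i' \<ge> i" "i' \<in> marks A" "i' \<le> j' + h'"
    using 2[rule_format, of i "F x" w j'] i k(1) w j' by (auto simp: FF)
  \<comment> \<open>This closes the round trip: pulled back, it bounds the level \<open>j'\<close>
    of \<open>inv F w\<close> in terms of \<open>k\<close>, whatever \<open>j\<close> may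
    be.\<close>
  have "fat_dist B (F x) (F y) \<le> 2 ^ h * fat_dist B (F x) w"
  proof -
    have "(1 / 2 :: real) ^ (j + h) \<le> (1 / 2) ^ i" using i(3) by (intro power_decreasing) auto
    then have "2 ^ h * (1 / 2 :: real) ^ (j + h) \<le> 2 ^ h * (1 / 2) ^ i" by simp
    then show ?thesis unfolding j w by (simp add: power_add power_one_over)
  qed
  from H(2)[OF this] have "(1 / 2) ^ k \<le> H * (1 / 2) ^ j'" by (simp add: FF y j')
  also have "\<dots> < 2 ^ c * (1 / 2) ^ j'" using c by simp
  finally have "(2::real) ^ j' < 2 ^ (c + k)"
    by (simp add: power_one_over divide_simps power_add mult.commute)
  then have "j' < c + k" by simp
  have "i' = k"
  proof (rule ccontr)
    assume "i' \<noteq> k"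
    then have "k < i'" using i(1) i'(1) by simp
    then have "2 * k \<le> i'" by (rule marks_sparse[OF k(2) i'(2)])
    then show False using i'(3) \<open>j' < c + k\<close> k(1) by simp
  qed
  then have "i = k" using i(1) i'(1) by simp
  then show "\<exists>k\<ge>K. k \<in> marks A \<and> k \<in> marks B" using i(2) k by (intro exI[of _ k]) simp
qed

section \<open>The families\<close>

text \<open>The standard dyadic ultrametric on bit sequences. It has all three properties and serves
  as a neutral summand.\<close>

definition binary_dist :: "bits \<Rightarrow> bits \<Rightarrow> real" where
  "binary_dist = block_space.D (\<lambda>_. 1) (\<lambda>a b. of_bool (a \<noteq> b)) (\<lambda>k. (1 / 2) ^ k)"

lemma binary_space: "ultra_space (\<lambda>_. 1) (\<lambda>k. (1 / 2) ^ k)"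
proof
  show "(\<lambda>k. (1 / 2 :: real) ^ k) \<longlonglongrightarrow> 0" by (rule LIMSEQ_realpow_zero) auto
qed auto

lemma binary_dist_props:
  "cantor_dist binary_dist" "ultrametric binary_dist" "doubling_dist binary_dist"
  "disconnected_dist binary_dist" "perfect_dist binary_dist"
proof -
  interpret ultra_space "\<lambda>_. 1" "\<lambda>k. (1 / 2) ^ k" by (rule binary_space)
  show "cantor_dist binary_dist" unfolding binary_dist_def by (rule cantor_D)
  show u: "ultrametric binary_dist" unfolding binary_dist_def by (rule ultrametric_D)
  show "doubling_dist binary_dist" unfolding binary_dist_def by (rule doubling_D) simp_all
  show "disconnected_dist binary_dist"
    using D_metric u unfolding binary_dist_def by (rule ultrametric_disconnected)
  show "perfect_dist binary_dist" unfolding binary_dist_def by (rule perfect_D) simp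
qed

lemma fat_dist_props:
  "ultrametric (fat_dist A)" "\<not> doubling_dist (fat_dist A)"
  "disconnected_dist (fat_dist A)" "perfect_dist (fat_dist A)"
proof -
  interpret ultra_space "fat_sizes A" "\<lambda>k. (1 / 2) ^ k" by (rule fat_space)
  show u: "ultrametric (fat_dist A)" unfolding fat_dist_def by (rule ultrametric_D)
  show "\<not> doubling_dist (fat_dist A)"
    unfolding fat_dist_def
  proof (rule not_doubling_D)
    fix N
    obtain k where "k \<ge> N" "k \<in> marks A" using marks_unbounded by blast
    then have "N \<le> fat_sizes A k" using fact_ge_self[of k] by (simp add: fat_sizes_def)
    then show "\<exists>k. N \<le> fat_sizes A k" by blast
  qed
  show "disconnected_dist (fat_dist A)"
    using D_metric u unfolding fat_dist_def by (rule ultrametric_disconnected)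
  show "perfect_dist (fat_dist A)" unfolding fat_dist_def by (rule perfect_D) simp
qed

text \<open>The code is the number of children, 2 or 4. It stays bounded for the sake of doubling;
  the reciprocal factorials as scales have ratios tending to 0 and destroy uniform
  perfectness.\<close>

definition gap_sizes :: "nat set \<Rightarrow> nat \<Rightarrow> nat" where
  "gap_sizes A k = 1 + of_bool (k \<in> marks A)"

definition gap_dist :: "nat set \<Rightarrow> bits \<Rightarrow> bits \<Rightarrow> real" where
  "gap_dist A = block_space.D (gap_sizes A) (\<lambda>a b. of_bool (a \<noteq> b)) (\<lambda>k. 1 / fact (Suc k))"

lemma gap_scale_Suc: "1 / fact (Suc (Suc k)) = (1 / fact (Suc k)) / real (k + 2)"
  by (simp add: divide_simps)

lemma gap_scale_small:
  assumes "e > 0"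
  shows "\<exists>K. \<forall>k\<ge>K. 1 / fact (Suc (Suc k)) < e * (1 / fact (Suc k) :: real)"
proof -
  obtain K :: nat where K: "1 / e < real K" using reals_Archimedean2 by blast
  have "1 / fact (Suc (Suc k)) < e * (1 / fact (Suc k) :: real)" if "k \<ge> K" for k
  proof -
    have "real K \<le> real (k + 2)" using that by simp
    then have "1 / e < real (k + 2)" using K by linarith
    then have "1 / real (k + 2) < e" using assms by (simp add: field_simps)
    then have "1 / real (k + 2) * (1 / fact (Suc k)) < e * (1 / fact (Suc k))"
      by (intro mult_strict_right_mono) auto
    then show ?thesis unfolding gap_scale_Suc by (simp add: field_simps)
  qed
  then show ?thesis by blast
qed

lemma gap_space: "ultra_space (gap_sizes A) (\<lambda>k. 1 / fact (Suc k))"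
proof
  fix k
  show "1 \<le> gap_sizes A k" by (simp add: gap_sizes_def)
  show "(0::real) < 1 / fact (Suc k)" by simp
  show "1 / fact (Suc (Suc k)) \<le> (1 / fact (Suc k) :: real)"
    unfolding gap_scale_Suc using divide_left_mono[of 1 "real (k + 2)" "1 / fact (Suc k)"] by simp
  show "1 / fact (Suc 0) = (1 :: real)" by simp
  have "(\<lambda>n. inverse (fact n) :: real) \<longlonglongrightarrow> 0"
    using summable_LIMSEQ_zero[OF summable_exp[of "1 :: real"]] by simp
  then show "(\<lambda>k. 1 / fact (Suc k) :: real) \<longlonglongrightarrow> 0"
    using LIMSEQ_Suc by (fastforce simp: inverse_eq_divide)
qed

lemma gap_dist_props:
  "cantor_dist (gap_dist A)" "doubling_dist (gap_dist A)"
  "disconnected_dist (gap_dist A)" "\<not> perfect_dist (gap_dist A)"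
proof -
  interpret ultra_space "gap_sizes A" "\<lambda>k. 1 / fact (Suc k)" by (rule gap_space)
  show "cantor_dist (gap_dist A)" unfolding gap_dist_def by (rule cantor_D)
  show "doubling_dist (gap_dist A)"
    unfolding gap_dist_def
  proof (rule doubling_D)
    fix k
    show "gap_sizes A k \<le> 2" by (simp add: gap_sizes_def)
    show "1 / fact (Suc (Suc k)) \<le> 1 / fact (Suc k) / (2::real)"
      unfolding gap_scale_Suc by (intro divide_left_mono) auto
  qed
  show "disconnected_dist (gap_dist A)"
    using D_metric ultrametric_D unfolding gap_dist_def by (rule ultrametric_disconnected)
  show "\<not> perfect_dist (gap_dist A)"
    unfolding gap_dist_def
  proof (rule not_perfect_D)
    fix e :: real assume "e > 0"
    then show "\<exists>k. 1 / fact (Suc (Suc k)) < e * (1 / fact (Suc k))"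
      using gap_scale_small[of e] by blast
  qed
qed

lemma gap_cylinder_image:
  assumes q: "qs (glue (gap_dist A) Z) (glue (gap_dist B) Z') F"
    and Z: "cantor_dist Z" "cantor_dist Z'" "perfect_dist Z'"
  obtains K where "\<And>k x. k \<ge> K \<Longrightarrow> x 0 \<Longrightarrow>
    F x 0 \<and> (\<exists>j. F ` cyl (gap_sizes A) k x = cyl (gap_sizes B) j (F x))"
proof -
  interpret ultra_space "gap_sizes A" "\<lambda>k. 1 / fact (Suc k)" by (rule gap_space)
  show ?thesis
  proof (rule isolated_cylinder_image[OF refl gap_space[of B] Z])
    show "qs (glue D Z) (glue (block_space.D (gap_sizes B) (\<lambda>a b. of_bool (a \<noteq> b)) (\<lambda>k. 1 / fact (Suc k))) Z') F"
      using q unfolding gap_dist_def .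
    show "\<exists>K. \<forall>k\<ge>K. 1 / fact (Suc (Suc k)) \<le> e * (1 / fact (Suc k))" if "e > 0" for e :: real
      using gap_scale_small[OF that] by (meson less_imp_le)
  qed (rule that)
qed

lemma gap_dist_rigid:
  assumes q: "qs (glue (gap_dist A) Z) (glue (gap_dist B) Z) F"
    and Z: "cantor_dist Z" "perfect_dist Z"
  shows "A = B"
proof -
  have qi: "qs (glue (gap_dist B) Z) (glue (gap_dist A) Z) (inv F)"
    by (rule qs_inverse[OF q])
       (intro cantor_distD(1) cantor_dist_glue gap_dist_props(1) Z(1))+
  have bij: "bij F" using q by (simp add: qs_def)
  obtain K where K: "\<And>k x. k \<ge> K \<Longrightarrow> x 0 \<Longrightarrow>
      F x 0 \<and> (\<exists>j. F ` cyl (gap_sizes A) k x = cyl (gap_sizes B) j (F x))"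
    using gap_cylinder_image[OF q Z(1) Z] by metis
  obtain K' where K': "\<And>k x. k \<ge> K' \<Longrightarrow> x 0 \<Longrightarrow>
      inv F x 0 \<and> (\<exists>j. inv F ` cyl (gap_sizes B) k x = cyl (gap_sizes A) j (inv F x))"
    using gap_cylinder_image[OF qi Z(1) Z] by metis
  have ge: "gap_sizes C k \<ge> 1" for C k by (simp add: gap_sizes_def)
  obtain a b where "\<And>n. gap_sizes A (a + n) = gap_sizes B (b + n)"
    using cylinder_shift[OF ge ge bij K K'] by metis
  then have "a + n \<in> marks A \<longleftrightarrow> b + n \<in> marks B" for n
    unfolding gap_sizes_def by (metis add_left_cancel of_bool_eq_iff)
  then show ?thesis by (rule marks_shift)
qed

text \<open>The growth of \<open>2 * k\<close> destroys uniform disconnectedness. The mark sits in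
  the parity of the size, which a shift of \<open>k\<close> leaves alone.\<close>

definition line_sizes :: "nat set \<Rightarrow> nat \<Rightarrow> nat" where
  "line_sizes A k = 2 * k + 1 + of_bool (k \<in> marks A)"

text \<open>The solution of the two scale equations of \<open>lin_space\<close> for given block
  sizes.\<close>

primrec line_scale :: "(nat \<Rightarrow> nat) \<Rightarrow> nat \<Rightarrow> real" where
  "line_scale s 0 = 1 / 2 / 2 ^ s 0"
| "line_scale s (Suc k) = line_scale s k / 2 / 2 ^ s (Suc k)"

definition line_dist :: "nat set \<Rightarrow> bits \<Rightarrow> bits \<Rightarrow> real" where
  "line_dist A = block_space.D (line_sizes A) (\<lambda>a b. \<bar>real a - real b\<bar>) (line_scale (line_sizes A))"

lemma line_space: "lin_space (line_sizes A) (line_scale (line_sizes A))"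
proof
  fix k
  show "1 \<le> line_sizes A k" by (simp add: line_sizes_def)
  show "0 < line_scale (line_sizes A) k" by (induction k) auto
qed auto

lemma line_sizes_ge: "k \<le> line_sizes A k"
  by (simp add: line_sizes_def)

lemma line_dist_props:
  "cantor_dist (line_dist A)" "doubling_dist (line_dist A)"
  "\<not> disconnected_dist (line_dist A)" "perfect_dist (line_dist A)"
proof -
  interpret lin_space "line_sizes A" "line_scale (line_sizes A)" by (rule line_space)
  show "cantor_dist (line_dist A)" unfolding line_dist_def by (rule cantor_D)
  show "doubling_dist (line_dist A)" unfolding line_dist_def by (rule doubling_D)
  show "\<not> disconnected_dist (line_dist A)"
    unfolding line_dist_def by (rule not_disconnected_D) (use line_sizes_ge in blast)
  show "perfect_dist (line_dist A)" unfolding line_dist_def by (rule perfect_D)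
qed

lemma line_cylinder_image:
  assumes q: "qs (glue (line_dist A) Z) (glue (line_dist B) Z') F"
    and Z: "cantor_dist Z" "cantor_dist Z'" "ultrametric Z'"
  obtains K where "\<And>k x. k \<ge> K \<Longrightarrow> x 0 \<Longrightarrow>
    F x 0 \<and> (\<exists>j. F ` cyl (line_sizes A) k x = cyl (line_sizes B) j (F x))"
proof -
  interpret lin_space "line_sizes A" "line_scale (line_sizes A)" by (rule line_space)
  show ?thesis
  proof (rule connected_cylinder_image[OF refl line_space[of B] Z])
    show "qs (glue D Z) (glue (block_space.D (line_sizes B) (\<lambda>a b. \<bar>real a - real b\<bar>)
        (line_scale (line_sizes B))) Z') F"
      using q unfolding line_dist_def .
    show "\<exists>K. \<forall>k\<ge>K. N \<le> line_sizes A k" for N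
      using line_sizes_ge order_trans by blast
  qed (rule that)
qed

lemma line_dist_rigid:
  assumes q: "qs (glue (line_dist A) Z) (glue (line_dist B) Z) F"
    and Z: "cantor_dist Z" "ultrametric Z"
  shows "A = B"
proof -
  have qi: "qs (glue (line_dist B) Z) (glue (line_dist A) Z) (inv F)"
    by (rule qs_inverse[OF q])
       (intro cantor_distD(1) cantor_dist_glue line_dist_props(1) Z(1))+
  have bij: "bij F" using q by (simp add: qs_def)
  obtain K where K: "\<And>k x. k \<ge> K \<Longrightarrow> x 0 \<Longrightarrow>
      F x 0 \<and> (\<exists>j. F ` cyl (line_sizes A) k x = cyl (line_sizes B) j (F x))"
    using line_cylinder_image[OF q Z(1) Z] by metis
  obtain K' where K': "\<And>k x. k \<ge> K' \<Longrightarrow> x 0 \<Longrightarrow>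
      inv F x 0 \<and> (\<exists>j. inv F ` cyl (line_sizes B) k x = cyl (line_sizes A) j (inv F x))"
    using line_cylinder_image[OF qi Z(1) Z] by metis
  have ge: "line_sizes C k \<ge> 1" for C k by (simp add: line_sizes_def)
  obtain a b where ab: "\<And>n. line_sizes A (a + n) = line_sizes B (b + n)"
    using cylinder_shift[OF ge ge bij K K'] by metis
  \<comment> \<open>The equal sizes are compared modulo 2.\<close>
  have "a + n \<in> marks A \<longleftrightarrow> b + n \<in> marks B" for n
    using ab[of n] unfolding line_sizes_def of_bool_def by (auto split: if_splits) presburger+
  then show ?thesis by (rule marks_shift)
qed

text \<open>\<open>rigid\<close> is needed only for two members of the family; the gauges themselves
  also contain spaces that are not realised on bit sequences. The hypothesis \<open>diam\<close>
  makes \<open>perfect_dist\<close> express uniform perfectness.\<close>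

lemma continuum_of_gauges:
  fixes fam :: "nat set \<Rightarrow> bits \<Rightarrow> bits \<Rightarrow> real"
  assumes card: "(UNIV :: real set) \<lesssim> (UNIV :: 'a set)"
    and cantor: "\<And>A. cantor_dist (fam A)" and diam: "\<And>A. \<exists>x y. fam A x y = 1"
    and type: "\<And>A. of_bool (doubling_dist (fam A)) = u" "\<And>A. of_bool (disconnected_dist (fam A)) = v"
      "\<And>A. of_bool (perfect_dist (fam A)) = w"
    and rigid: "\<And>A B F. qs (fam A) (fam B) F \<Longrightarrow> A = B"
  shows "(gauge_collection u v w :: 'a metric set set) \<approx> (UNIV :: nat set set)"
proof (rule lepoll_antisym)
  obtain code :: "'a metric set \<Rightarrow> nat set" where
    code: "inj_on code {conformal_gauge m | m. Cantor_metric_space m}"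
    by (rule cantor_gauge_code)
  have "gauge_collection u v w \<subseteq> {conformal_gauge m | m :: 'a metric. Cantor_metric_space m}"
    unfolding gauge_collection_def by blast
  then have "inj_on code (gauge_collection u v w)" using code inj_on_subset by blast
  then show "(gauge_collection u v w :: 'a metric set set) \<lesssim> (UNIV :: nat set set)"
    unfolding lepoll_def by blast
next
  have "(UNIV :: bits set) \<lesssim> (UNIV :: real set)"
    using inj_ternary unfolding lepoll_def by blast
  then have "(UNIV :: bits set) \<lesssim> (UNIV :: 'a set)" using card lepoll_trans by blast
  then obtain h :: "bits \<Rightarrow> 'a" where h: "inj h" unfolding lepoll_def by blast
  define M where "M A = push_metric h (fam A)" for A
  have metric: "Metric_space UNIV (fam A)" for A using cantor_distD(1)[OF cantor] .
  note ps = push_metric_simps[OF h metric]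
  have "M A \<in> {m. Cantor_metric_space m \<and> has_type m (u, v, w)}" for A
  proof -
    obtain x y where xy: "fam A x y = 1" using diam by blast
    have "Cantor_metric_space (M A)" unfolding M_def by (rule Cantor_push_metric[OF h cantor])
    moreover have "has_type (M A) (u, v, w)"
      using type[of A]
      unfolding has_type_def truth_value_def M_def doubling_push_metric[OF h metric]
        uniformly_disconnected_push_metric[OF h metric]
        uniformly_perfect_push_metric[where d = "fam A" and a = x and b = y, OF h metric cantor_distD(2)[OF cantor[of A]] xy]
      by (simp add: of_bool_def)
    ultimately show ?thesis by simp
  qed
  then have "range (\<lambda>A. conformal_gauge (M A)) \<subseteq> gauge_collection u v w"
    unfolding gauge_collection_def by blast
  moreover have "inj (\<lambda>A. conformal_gauge (M A))"
  proof (rule injI)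
    fix A B assume "conformal_gauge (M A) = conformal_gauge (M B)"
    \<comment> \<open>\<open>M B\<close> belongs to its own gauge, so equality of the gauges yields
      a quasi-symmetric map from \<open>M A\<close> to \<open>M B\<close>.\<close>
    then have "M B \<in> conformal_gauge (M A)" using conformal_gauge_refl by simp
    then obtain f where f: "quasi_symmetric (M A) (M B) f" unfolding conformal_gauge_def by blast
    have b: "bij_betw h UNIV (mspace (M C))" for C
      unfolding M_def ps(1) bij_betw_def using h by simp
    have i: "mdist (M C) (h x) (h y) = fam C x y" for C x y
      unfolding M_def by (rule ps(2))
    obtain F where "qs (fam A) (fam B) F"
      using quasi_symmetric_imp_qs[OF f b i b i] .
    then show "A = B" by (rule rigid)
  qed
  ultimately show "(UNIV :: nat set set) \<lesssim> (gauge_collection u v w :: 'a metric set set)"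
    unfolding lepoll_def by blast
qed

lemma glue_diam: "\<exists>x y. glue d1 d2 x y = 1"
  by (intro exI[of _ "\<lambda>_. True"] exI[of _ "\<lambda>_. False"]) (simp add: glue_def)

text \<open>The coded part is doubling and uniformly disconnected but not uniformly perfect, so
  \<open>Z\<close> decides the first two entries of the type. Perfectness of \<open>Z\<close> keeps
  images of isolated cylinders out of it.\<close>

lemma gap_family_continuum:
  assumes card: "(UNIV :: real set) \<lesssim> (UNIV :: 'a set)"
    and Z: "cantor_dist Z" "perfect_dist Z"
    and type: "of_bool (doubling_dist Z) = u" "of_bool (disconnected_dist Z) = v"
  shows "(gauge_collection u v 0 :: 'a metric set set) \<approx> (UNIV :: nat set set)"
proof (rule continuum_of_gauges[OF card, of "\<lambda>A. glue (gap_dist A) Z"])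
  fix A
  note g = gap_dist_props[of A]
  show "cantor_dist (glue (gap_dist A) Z)" by (rule cantor_dist_glue[OF g(1) Z(1)])
  show "of_bool (doubling_dist (glue (gap_dist A) Z)) = u"
    using doubling_glue[OF g(1) Z(1)] g type by simp
  show "of_bool (disconnected_dist (glue (gap_dist A) Z)) = v"
    using disconnected_glue[OF g(1) Z(1)] g type by simp
  show "of_bool (perfect_dist (glue (gap_dist A) Z)) = (0::nat)"
    using perfect_glue[of "gap_dist A" Z] g by simp
qed (use glue_diam gap_dist_rigid[OF _ Z] in blast)+

text \<open>Here the coded part fails only uniform disconnectedness, so \<open>Z\<close> decides
  whether the union is doubling. As an ultrametric space, \<open>Z\<close> admits no images of
  finely connected cylinders.\<close>

lemma line_family_continuum:
  assumes card: "(UNIV :: real set) \<lesssim> (UNIV :: 'a set)"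
    and Z: "cantor_dist Z" "ultrametric Z" "perfect_dist Z"
    and type: "of_bool (doubling_dist Z) = u"
  shows "(gauge_collection u 0 1 :: 'a metric set set) \<approx> (UNIV :: nat set set)"
proof (rule continuum_of_gauges[OF card, of "\<lambda>A. glue (line_dist A) Z"])
  fix A
  note g = line_dist_props[of A]
  show "cantor_dist (glue (line_dist A) Z)" by (rule cantor_dist_glue[OF g(1) Z(1)])
  show "of_bool (doubling_dist (glue (line_dist A) Z)) = u"
    using doubling_glue[OF g(1) Z(1)] g type by simp
  show "of_bool (disconnected_dist (glue (line_dist A) Z)) = (0::nat)"
    using disconnected_glue[OF g(1) Z(1)] g by simp
  show "of_bool (perfect_dist (glue (line_dist A) Z)) = (1::nat)"
    using perfect_glue[of "line_dist A" Z] g Z(3) by simp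
qed (use glue_diam line_dist_rigid[OF _ Z(1,2)] in blast)+

lemma fat_family_continuum:
  assumes card: "(UNIV :: real set) \<lesssim> (UNIV :: 'a set)"
  shows "(gauge_collection 0 1 1 :: 'a metric set set) \<approx> (UNIV :: nat set set)"
proof (rule continuum_of_gauges[OF card, of fat_dist])
  fix A
  show "cantor_dist (fat_dist A)" by (rule cantor_fat_dist)
  have "\<exists>y. fat_dist A (\<lambda>_. True) y = (1 / 2) ^ 0" using fat_dist_realized by blast
  then show "\<exists>x y. fat_dist A x y = 1" by auto
qed (use fat_dist_props fat_dist_rigid in auto)

theorem theorem1p1:
  fixes u v w :: nat
  assumes "(UNIV :: real set) \<lesssim> (UNIV :: 'a set)"
    and "(u, v, w) \<in> {0, 1} \<times> {0, 1} \<times> {0, 1}"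
    and "(u, v, w) \<noteq> (1, 1, 1)"
  shows "(gauge_collection u v w :: 'a metric set set) \<approx> (UNIV :: nat set set)"
proof -
  \<comment> \<open>Uniformly perfect summands that are not uniformly disconnected, one doubling and
    one not, for the two types with \<open>v = w = 0\<close>. The empty set is an arbitrary choice
    of code.\<close>
  let ?L = "glue (line_dist {}) binary_dist" and ?M = "glue (line_dist {}) (fat_dist {})"
  note b = binary_dist_props and f = cantor_fat_dist[of "{}"] fat_dist_props[of "{}"]
    and l = line_dist_props[of "{}"]
  have L: "cantor_dist ?L" "perfect_dist ?L" "doubling_dist ?L" "\<not> disconnected_dist ?L"
    using cantor_dist_glue[OF l(1) b(1)] perfect_glue[of "line_dist {}" binary_dist]
      doubling_glue[OF l(1) b(1)] disconnected_glue[OF l(1) b(1)] b l by simp_all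
  have M: "cantor_dist ?M" "perfect_dist ?M" "\<not> doubling_dist ?M" "\<not> disconnected_dist ?M"
    using cantor_dist_glue[OF l(1) f(1)] perfect_glue[of "line_dist {}" "fat_dist {}"]
      doubling_glue[OF l(1) f(1)] disconnected_glue[OF l(1) f(1)] f l by simp_all
  note gap = gap_family_continuum[OF assms(1)] and line = line_family_continuum[OF assms(1)]
  from assms(2,3) consider "w = 0" "u = 1" "v = 1" | "w = 0" "u = 0" "v = 1" | "w = 0" "u = 1" "v = 0"
    | "w = 0" "u = 0" "v = 0" | "w = 1" "u = 0" "v = 1" | "w = 1" "u = 1" "v = 0" | "w = 1" "u = 0" "v = 0"
    by auto
  then show ?thesis
  proof cases
    case 1
    then show ?thesis using gap[OF b(1) b(5), of u v] b by simp
  next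
    case 2
    then show ?thesis using gap[OF f(1) f(5), of u v] f by simp
  next
    case 3
    then show ?thesis using gap[OF L(1,2), of u v] L by simp
  next
    case 4
    then show ?thesis using gap[OF M(1,2), of u v] M by simp
  next
    case 5
    then show ?thesis using fat_family_continuum[OF assms(1)] by simp
  next
    case 6
    then show ?thesis using line[OF b(1,2,5), of u] b by simp
  next
    case 7
    then show ?thesis using line[OF f(1,2,5), of u] f by simp
  qed
qed

end
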